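(* Let $\mathcal{E}$ be an atomic topos. If the category of atoms of $\mathcal{E}$ is co-well-founded, then $\mathcal{E}$ is locally finitely presentable. Moreover, in this case, the finitely presentable objects of $\mathcal{E}$ are exactly the finite objects of $\mathcal{E}$.
   Context: "Topos" means Grothendieck (sheaf) topos. An atom of an object $X$ of an atomic topos is a minimal non-empty (i.e. non-initial) sub-object of $X$; an atom of $\mathcal{E}$ is a non-initial object whose only sub-objects are the initial object and itself. The category of atoms of $\mathcal{E}$ is the full subcategory of $\mathcal{E}$ on its atoms. An object $X$ of $\mathcal{E}$ is called finite if its set of atoms is finite (equivalently, if its poset of sub-objects is finite). A chain in a category is a diagram $(x_i)_{i\in I}$ indexed by a (non-empty) well-ordered poset $I$. It stabilizes at $i\in I$ if the morphisms $x_i\to x_j$ are isomorphisms for all $j>i$; it stabilizes if it stabilizes at some $i$. A category is co-well-founded if every chain in it stabilizes; equivalently, every chain $x_0\to x_1\to x_2\to\cdots$ indexed by $\omega$ stabilizes. *)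

theory Defs
  imports "HOL-Library.Equipollence"
begin

section \<open>Smallness\<close>

text \<open>
  As usual for Grothendieck toposes, smallness refers to a universe.  The universe is given by a
  type \<open>'u\<close> of strongly inaccessible cardinality; the small sets (of any type) are those of
  strictly smaller cardinality than \<open>'u\<close>, and each of them is in bijection with a subset of \<open>'u\<close>.
  Hence small indexing sets, small sites and the values of sheaves are taken to be subsets of
  \<open>'u\<close> without loss of generality.
\<close>

definition small :: "'u itself \<Rightarrow> 'a set \<Rightarrow> bool"
  where "small _ A \<longleftrightarrow> A \<prec> (UNIV :: 'u set)"

definition strongly_inaccessible :: "'u itself \<Rightarrow> bool"
  where "strongly_inaccessible U \<longleftrightarrow>
    small U (UNIV :: nat set) \<and>
    (\<forall>A :: 'u set. small U A \<longrightarrow> small U (Pow A)) \<and>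
    (\<forall>(I :: 'u set) (A :: 'u \<Rightarrow> 'u set).
       small U I \<and> (\<forall>i\<in>I. small U (A i)) \<longrightarrow> small U (\<Union>i\<in>I. A i))"


section \<open>Categories and functors\<close>

record ('o, 'a) cat =
  Ob :: "'o set"
  Ar :: "'a set"
  Dom :: "'a \<Rightarrow> 'o"
  Cod :: "'a \<Rightarrow> 'o"
  Id :: "'o \<Rightarrow> 'a"
  Comp :: "'a \<Rightarrow> 'a \<Rightarrow> 'a"  (infixl \<open>\<cdot>\<index>\<close> 70)

definition hom :: "('o, 'a) cat \<Rightarrow> 'o \<Rightarrow> 'o \<Rightarrow> 'a set"
  where "hom C X Y = {f \<in> Ar C. Dom C f = X \<and> Cod C f = Y}"

locale category =
  fixes C :: "('o, 'a) cat" (structure)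
  assumes Dom_in_Ob: "f \<in> Ar C \<Longrightarrow> Dom C f \<in> Ob C"
    and Cod_in_Ob: "f \<in> Ar C \<Longrightarrow> Cod C f \<in> Ob C"
    and Id_in_hom: "X \<in> Ob C \<Longrightarrow> Id C X \<in> hom C X X"
    and Comp_in_hom: "f \<in> hom C X Y \<Longrightarrow> g \<in> hom C Y Z \<Longrightarrow> g \<cdot> f \<in> hom C X Z"
    and Comp_Id: "f \<in> hom C X Y \<Longrightarrow> f \<cdot> Id C X = f"
    and Id_Comp: "f \<in> hom C X Y \<Longrightarrow> Id C Y \<cdot> f = f"
    and Comp_assoc:
      "f \<in> hom C W X \<Longrightarrow> g \<in> hom C X Y \<Longrightarrow> h \<in> hom C Y Z \<Longrightarrow> h \<cdot> g \<cdot> f = h \<cdot> (g \<cdot> f)"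

definition small_category :: "'u itself \<Rightarrow> ('o, 'a) cat \<Rightarrow> bool"
  where "small_category U C \<longleftrightarrow> category C \<and> small U (Ob C) \<and> small U (Ar C)"

definition locally_small :: "'u itself \<Rightarrow> ('o, 'a) cat \<Rightarrow> bool"
  where "locally_small U C \<longleftrightarrow> (\<forall>X\<in>Ob C. \<forall>Y\<in>Ob C. small U (hom C X Y))"

definition full_subcategory :: "('o, 'a) cat \<Rightarrow> ('o \<Rightarrow> bool) \<Rightarrow> ('o, 'a) cat"
  where "full_subcategory C P =
    C\<lparr>Ob := {X \<in> Ob C. P X}, Ar := {f \<in> Ar C. P (Dom C f) \<and> P (Cod C f)}\<rparr>"

definition iso :: "('o, 'a) cat \<Rightarrow> 'a \<Rightarrow> bool"
  where "iso C f \<longleftrightarrow> f \<in> Ar C \<and>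
    (\<exists>g \<in> hom C (Cod C f) (Dom C f). g \<cdot>\<^bsub>C\<^esub> f = Id C (Dom C f) \<and> f \<cdot>\<^bsub>C\<^esub> g = Id C (Cod C f))"

definition mono :: "('o, 'a) cat \<Rightarrow> 'a \<Rightarrow> bool"
  where "mono C m \<longleftrightarrow> m \<in> Ar C \<and>
    (\<forall>f\<in>Ar C. \<forall>g\<in>Ar C. Dom C f = Dom C g \<and> Cod C f = Dom C m \<and> Cod C g = Dom C m \<and>
       m \<cdot>\<^bsub>C\<^esub> f = m \<cdot>\<^bsub>C\<^esub> g \<longrightarrow> f = g)"

definition initial :: "('o, 'a) cat \<Rightarrow> 'o \<Rightarrow> bool"
  where "initial C X \<longleftrightarrow> X \<in> Ob C \<and> (\<forall>Y\<in>Ob C. \<exists>!f. f \<in> hom C X Y)"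

record ('o, 'a, 'p, 'b) ftor =
  omap :: "'o \<Rightarrow> 'p"
  amap :: "'a \<Rightarrow> 'b"

definition "functor" :: "('o, 'a) cat \<Rightarrow> ('p, 'b) cat \<Rightarrow> ('o, 'a, 'p, 'b) ftor \<Rightarrow> bool"
  where "functor C D F \<longleftrightarrow>
    (\<forall>X\<in>Ob C. omap F X \<in> Ob D) \<and>
    (\<forall>f\<in>Ar C. amap F f \<in> hom D (omap F (Dom C f)) (omap F (Cod C f))) \<and>
    (\<forall>X\<in>Ob C. amap F (Id C X) = Id D (omap F X)) \<and>
    (\<forall>f\<in>Ar C. \<forall>g\<in>Ar C. Cod C f = Dom C g \<longrightarrow>
       amap F (g \<cdot>\<^bsub>C\<^esub> f) = amap F g \<cdot>\<^bsub>D\<^esub> amap F f)"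

definition id_functor :: "('o, 'a, 'o, 'a) ftor"
  where "id_functor = \<lparr>omap = (\<lambda>X. X), amap = (\<lambda>f. f)\<rparr>"

definition comp_functor ::
    "('p, 'b, 'q, 'c) ftor \<Rightarrow> ('o, 'a, 'p, 'b) ftor \<Rightarrow> ('o, 'a, 'q, 'c) ftor"
  where "comp_functor G F = \<lparr>omap = omap G \<circ> omap F, amap = amap G \<circ> amap F\<rparr>"

definition naturally_isomorphic ::
    "('o, 'a) cat \<Rightarrow> ('p, 'b) cat \<Rightarrow> ('o, 'a, 'p, 'b) ftor \<Rightarrow> ('o, 'a, 'p, 'b) ftor \<Rightarrow> bool"
  where "naturally_isomorphic C D F G \<longleftrightarrow>
    (\<exists>\<eta>. (\<forall>X\<in>Ob C. \<eta> X \<in> hom D (omap F X) (omap G X) \<and> iso D (\<eta> X)) \<and>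
         (\<forall>f\<in>Ar C. \<eta> (Cod C f) \<cdot>\<^bsub>D\<^esub> amap F f = amap G f \<cdot>\<^bsub>D\<^esub> \<eta> (Dom C f)))"

definition equivalent_categories :: "('o, 'a) cat \<Rightarrow> ('p, 'b) cat \<Rightarrow> bool"
  where "equivalent_categories C D \<longleftrightarrow>
    (\<exists>F G. functor C D F \<and> functor D C G \<and>
       naturally_isomorphic C C id_functor (comp_functor G F) \<and>
       naturally_isomorphic D D (comp_functor F G) id_functor)"


section \<open>Diagrams and colimits\<close>

definition poset_cat :: "'i set \<Rightarrow> 'i rel \<Rightarrow> ('i, 'i \<times> 'i) cat"
  where "poset_cat I r =
    \<lparr>Ob = I, Ar = r, Dom = fst, Cod = snd, Id = (\<lambda>i. (i, i)), Comp = (\<lambda>q p. (fst p, snd q))\<rparr>"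

definition discrete_cat :: "'i set \<Rightarrow> ('i, 'i) cat"
  where "discrete_cat I =
    \<lparr>Ob = I, Ar = I, Dom = (\<lambda>i. i), Cod = (\<lambda>i. i), Id = (\<lambda>i. i), Comp = (\<lambda>j i. i)\<rparr>"

definition cocone ::
    "('i, 'm) cat \<Rightarrow> ('o, 'a) cat \<Rightarrow> ('i, 'm, 'o, 'a) ftor \<Rightarrow> 'o \<Rightarrow> ('i \<Rightarrow> 'a) \<Rightarrow> bool"
  where "cocone S C D X c \<longleftrightarrow> X \<in> Ob C \<and>
    (\<forall>i\<in>Ob S. c i \<in> hom C (omap D i) X) \<and>
    (\<forall>u\<in>Ar S. c (Cod S u) \<cdot>\<^bsub>C\<^esub> amap D u = c (Dom S u))"

definition colimit ::
    "('i, 'm) cat \<Rightarrow> ('o, 'a) cat \<Rightarrow> ('i, 'm, 'o, 'a) ftor \<Rightarrow> 'o \<Rightarrow> ('i \<Rightarrow> 'a) \<Rightarrow> bool"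
  where "colimit S C D X c \<longleftrightarrow> cocone S C D X c \<and>
    (\<forall>Y d. cocone S C D Y d \<longrightarrow>
       (\<exists>!h. h \<in> hom C X Y \<and> (\<forall>i\<in>Ob S. h \<cdot>\<^bsub>C\<^esub> c i = d i)))"

definition coproduct ::
    "'i set \<Rightarrow> ('o, 'a) cat \<Rightarrow> ('i \<Rightarrow> 'o) \<Rightarrow> 'o \<Rightarrow> ('i \<Rightarrow> 'a) \<Rightarrow> bool"
  where "coproduct I C A X c \<longleftrightarrow>
    colimit (discrete_cat I) C \<lparr>omap = A, amap = (\<lambda>i. Id C (A i))\<rparr> X c"

definition cocomplete :: "'u itself \<Rightarrow> ('o, 'a) cat \<Rightarrow> bool"
  where "cocomplete U C \<longleftrightarrow>
    (\<forall>(S :: ('u, 'u) cat) D. small_category U S \<and> functor S C D \<longrightarrow> (\<exists>X c. colimit S C D X c))"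

definition directed_poset :: "'i set \<Rightarrow> 'i rel \<Rightarrow> bool"
  where "directed_poset I r \<longleftrightarrow> partial_order_on I r \<and> I \<noteq> {} \<and>
    (\<forall>i\<in>I. \<forall>j\<in>I. \<exists>k\<in>I. (i, k) \<in> r \<and> (j, k) \<in> r)"


section \<open>Locally finitely presentable categories\<close>

text \<open>
  The colimit of a diagram of sets \<open>T\<close> with transition maps \<open>t\<close>: the quotient of the disjoint
  union by the equivalence relation generated by \<open>(i, x) \<sim> (j, t u x)\<close> for \<open>u : i \<rightarrow> j\<close>.
\<close>

definition set_colimit_rel ::
    "('i, 'm) cat \<Rightarrow> ('i \<Rightarrow> 'x set) \<Rightarrow> ('m \<Rightarrow> 'x \<Rightarrow> 'x) \<Rightarrow> ('i \<times> 'x) rel"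
  where "set_colimit_rel S T t =
    (let r = {((Dom S u, x), (Cod S u, t u x)) |u x. u \<in> Ar S \<and> x \<in> T (Dom S u)}
     in (r \<union> r\<inverse>)\<^sup>*)"

definition set_colimit ::
    "('i, 'm) cat \<Rightarrow> ('i \<Rightarrow> 'x set) \<Rightarrow> ('m \<Rightarrow> 'x \<Rightarrow> 'x) \<Rightarrow> ('i \<times> 'x) set set"
  where "set_colimit S T t = (SIGMA i:Ob S. T i) // set_colimit_rel S T t"

text \<open>
  The functor \<open>Hom(K, -)\<close> preserves the colimit cocone \<open>c\<close> over \<open>D\<close> with vertex \<open>X\<close>: the canonical
  map from the colimit of the sets \<open>Hom(K, D i)\<close> to \<open>Hom(K, X)\<close>, sending the class of
  \<open>g : K \<rightarrow> D i\<close> to \<open>c i \<cdot> g\<close>, is bijective.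
\<close>

definition hom_preserves_colimit ::
    "('o, 'a) cat \<Rightarrow> 'o \<Rightarrow> ('i, 'm) cat \<Rightarrow> ('i, 'm, 'o, 'a) ftor \<Rightarrow> 'o \<Rightarrow> ('i \<Rightarrow> 'a) \<Rightarrow> bool"
  where "hom_preserves_colimit C K S D X c \<longleftrightarrow>
    bij_betw (\<lambda>q. the_elem ((\<lambda>(i, g). c i \<cdot>\<^bsub>C\<^esub> g) ` q))
      (set_colimit S (\<lambda>i. hom C K (omap D i)) (\<lambda>u g. amap D u \<cdot>\<^bsub>C\<^esub> g))
      (hom C K X)"

definition finitely_presentable :: "'u itself \<Rightarrow> ('o, 'a) cat \<Rightarrow> 'o \<Rightarrow> bool"
  where "finitely_presentable U C K \<longleftrightarrow> K \<in> Ob C \<and>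
    (\<forall>(I :: 'u set) r D X c.
       small U I \<and> directed_poset I r \<and> functor (poset_cat I r) C D \<and>
       colimit (poset_cat I r) C D X c \<longrightarrow>
       hom_preserves_colimit C K (poset_cat I r) D X c)"

definition locally_finitely_presentable :: "'u itself \<Rightarrow> ('o, 'a) cat \<Rightarrow> bool"
  where "locally_finitely_presentable U C \<longleftrightarrow>
    category C \<and> locally_small U C \<and> cocomplete U C \<and>
    (\<exists>A. small U A \<and> (\<forall>K\<in>A. finitely_presentable U C K) \<and>
      (\<forall>X\<in>Ob C. \<exists>(I :: 'u set) r D c.
         small U I \<and> directed_poset I r \<and> functor (poset_cat I r) C D \<and>
         (\<forall>i\<in>I. omap D i \<in> A) \<and> colimit (poset_cat I r) C D X c))"


section \<open>Sheaves on a site and Grothendieck toposes\<close>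

definition sieve :: "('c, 'd) cat \<Rightarrow> 'c \<Rightarrow> 'd set \<Rightarrow> bool"
  where "sieve C x S \<longleftrightarrow> S \<subseteq> {f \<in> Ar C. Cod C f = x} \<and>
    (\<forall>f\<in>S. \<forall>g\<in>Ar C. Cod C g = Dom C f \<longrightarrow> f \<cdot>\<^bsub>C\<^esub> g \<in> S)"

definition pullback_sieve :: "('c, 'd) cat \<Rightarrow> 'd \<Rightarrow> 'd set \<Rightarrow> 'd set"
  where "pullback_sieve C h S = {f \<in> Ar C. Cod C f = Dom C h \<and> h \<cdot>\<^bsub>C\<^esub> f \<in> S}"

definition grothendieck_topology :: "('c, 'd) cat \<Rightarrow> ('c \<Rightarrow> 'd set set) \<Rightarrow> bool"
  where "grothendieck_topology C J \<longleftrightarrow>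
    (\<forall>x\<in>Ob C. \<forall>S\<in>J x. sieve C x S) \<and>
    (\<forall>x\<in>Ob C. {f \<in> Ar C. Cod C f = x} \<in> J x) \<and>
    (\<forall>h\<in>Ar C. \<forall>S\<in>J (Cod C h). pullback_sieve C h S \<in> J (Dom C h)) \<and>
    (\<forall>x\<in>Ob C. \<forall>S\<in>J x. \<forall>R. sieve C x R \<and> (\<forall>h\<in>S. pullback_sieve C h R \<in> J (Dom C h)) \<longrightarrow>
       R \<in> J x)"

record ('c, 'd, 'u) psh =
  sec :: "'c \<Rightarrow> 'u set"
  res :: "'d \<Rightarrow> 'u \<Rightarrow> 'u"

definition presheaf :: "('c, 'd) cat \<Rightarrow> ('c, 'd, 'u) psh \<Rightarrow> bool"
  where "presheaf C F \<longleftrightarrow>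
    (\<forall>x\<in>Ob C. small TYPE('u) (sec F x)) \<and>
    (\<forall>f\<in>Ar C. \<forall>s\<in>sec F (Cod C f). res F f s \<in> sec F (Dom C f)) \<and>
    (\<forall>x\<in>Ob C. \<forall>s\<in>sec F x. res F (Id C x) s = s) \<and>
    (\<forall>f\<in>Ar C. \<forall>g\<in>Ar C. Cod C f = Dom C g \<longrightarrow>
       (\<forall>s\<in>sec F (Cod C g). res F (g \<cdot>\<^bsub>C\<^esub> f) s = res F f (res F g s)))"

definition matching_family :: "('c, 'd) cat \<Rightarrow> ('c, 'd, 'u) psh \<Rightarrow> 'd set \<Rightarrow> ('d \<Rightarrow> 'u) \<Rightarrow> bool"
  where "matching_family C F S s \<longleftrightarrow>
    (\<forall>f\<in>S. s f \<in> sec F (Dom C f)) \<and>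
    (\<forall>f\<in>S. \<forall>g\<in>Ar C. Cod C g = Dom C f \<longrightarrow> s (f \<cdot>\<^bsub>C\<^esub> g) = res F g (s f))"

definition sheaf :: "('c, 'd) cat \<Rightarrow> ('c \<Rightarrow> 'd set set) \<Rightarrow> ('c, 'd, 'u) psh \<Rightarrow> bool"
  where "sheaf C J F \<longleftrightarrow> presheaf C F \<and>
    (\<forall>x\<in>Ob C. \<forall>S\<in>J x. \<forall>s. matching_family C F S s \<longrightarrow>
       (\<exists>!a. a \<in> sec F x \<and> (\<forall>f\<in>S. res F f a = s f)))"

text \<open>
  The components of a morphism are required to be \<open>undefined\<close> off the sections of its domain, so
  that equality of arrows is equality of natural transformations.
\<close>

definition presheaf_hom ::
    "('c, 'd) cat \<Rightarrow> ('c, 'd, 'u) psh \<Rightarrow> ('c, 'd, 'u) psh \<Rightarrow> ('c \<Rightarrow> 'u \<Rightarrow> 'u) \<Rightarrow> bool"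
  where "presheaf_hom C F G \<eta> \<longleftrightarrow>
    (\<forall>x\<in>Ob C. \<forall>s\<in>sec F x. \<eta> x s \<in> sec G x) \<and>
    (\<forall>x s. x \<notin> Ob C \<or> s \<notin> sec F x \<longrightarrow> \<eta> x s = undefined) \<and>
    (\<forall>f\<in>Ar C. \<forall>s\<in>sec F (Cod C f). \<eta> (Dom C f) (res F f s) = res G f (\<eta> (Cod C f) s))"

type_synonym ('c, 'd, 'u) psh_arrow =
  "('c, 'd, 'u) psh \<times> ('c, 'd, 'u) psh \<times> ('c \<Rightarrow> 'u \<Rightarrow> 'u)"

definition sheaf_cat ::
    "('c, 'd) cat \<Rightarrow> ('c \<Rightarrow> 'd set set) \<Rightarrow> (('c, 'd, 'u) psh, ('c, 'd, 'u) psh_arrow) cat"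
  where "sheaf_cat C J =
    \<lparr>Ob = {F. sheaf C J F},
     Ar = {(F, G, \<eta>). sheaf C J F \<and> sheaf C J G \<and> presheaf_hom C F G \<eta>},
     Dom = (\<lambda>(F, G, \<eta>). F),
     Cod = (\<lambda>(F, G, \<eta>). G),
     Id = (\<lambda>F. (F, F, \<lambda>x s. if x \<in> Ob C \<and> s \<in> sec F x then s else undefined)),
     Comp = (\<lambda>(G', H, \<theta>) (F, G, \<eta>).
       (F, H, \<lambda>x s. if x \<in> Ob C \<and> s \<in> sec F x then \<theta> x (\<eta> x s) else undefined))\<rparr>"

definition grothendieck_topos :: "'u itself \<Rightarrow> ('o, 'a) cat \<Rightarrow> bool"
  where "grothendieck_topos U E \<longleftrightarrow> category E \<and>
    (\<exists>(C :: ('u, 'u) cat) J. small_category U C \<and> grothendieck_topology C J \<and>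
       equivalent_categories E
         (sheaf_cat C J :: (('u, 'u, 'u) psh, ('u, 'u, 'u) psh_arrow) cat))"


section \<open>Sub-objects, atoms and atomic toposes\<close>

definition monos_into :: "('o, 'a) cat \<Rightarrow> 'o \<Rightarrow> 'a set"
  where "monos_into C X = {m. mono C m \<and> Cod C m = X}"

definition factors_through :: "('o, 'a) cat \<Rightarrow> 'a \<Rightarrow> 'a \<Rightarrow> bool"
  where "factors_through C m n \<longleftrightarrow> (\<exists>h \<in> hom C (Dom C m) (Dom C n). n \<cdot>\<^bsub>C\<^esub> h = m)"

definition subobjects :: "('o, 'a) cat \<Rightarrow> 'o \<Rightarrow> 'a set set"
  where "subobjects C X = monos_into C X //
    {(m, n). m \<in> monos_into C X \<and> n \<in> monos_into C X \<and>
             factors_through C m n \<and> factors_through C n m}"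

definition subobject_le :: "('o, 'a) cat \<Rightarrow> 'a set \<Rightarrow> 'a set \<Rightarrow> bool"
  where "subobject_le C A B \<longleftrightarrow> (\<exists>m\<in>A. \<exists>n\<in>B. factors_through C m n)"

definition nonempty_subobject :: "('o, 'a) cat \<Rightarrow> 'a set \<Rightarrow> bool"
  where "nonempty_subobject C A \<longleftrightarrow> (\<exists>m\<in>A. \<not> initial C (Dom C m))"

definition atoms_of :: "('o, 'a) cat \<Rightarrow> 'o \<Rightarrow> 'a set set"
  where "atoms_of C X = {A \<in> subobjects C X. nonempty_subobject C A \<and>
    (\<forall>B \<in> subobjects C X. nonempty_subobject C B \<and> subobject_le C B A \<longrightarrow> B = A)}"

definition atom :: "('o, 'a) cat \<Rightarrow> 'o \<Rightarrow> bool"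
  where "atom C X \<longleftrightarrow> X \<in> Ob C \<and> \<not> initial C X \<and>
    (\<forall>m \<in> monos_into C X. initial C (Dom C m) \<or> iso C m)"

definition category_of_atoms :: "('o, 'a) cat \<Rightarrow> ('o, 'a) cat"
  where "category_of_atoms C = full_subcategory C (atom C)"

definition finite_object :: "('o, 'a) cat \<Rightarrow> 'o \<Rightarrow> bool"
  where "finite_object C X \<longleftrightarrow> X \<in> Ob C \<and> finite (atoms_of C X)"

definition atomic_topos :: "'u itself \<Rightarrow> ('o, 'a) cat \<Rightarrow> bool"
  where "atomic_topos U E \<longleftrightarrow> grothendieck_topos U E \<and>
    (\<forall>X\<in>Ob E. \<exists>(I :: 'u set) A c.
       small U I \<and> (\<forall>i\<in>I. atom E (A i)) \<and> coproduct I E A X c)"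


section \<open>Chains\<close>

definition chain :: "('o, 'a) cat \<Rightarrow> 'i set \<Rightarrow> 'i rel \<Rightarrow> ('i, 'i \<times> 'i, 'o, 'a) ftor \<Rightarrow> bool"
  where "chain C I r D \<longleftrightarrow> I \<noteq> {} \<and> well_order_on I r \<and> functor (poset_cat I r) C D"

definition stabilizes_at ::
    "('o, 'a) cat \<Rightarrow> 'i rel \<Rightarrow> ('i, 'i \<times> 'i, 'o, 'a) ftor \<Rightarrow> 'i \<Rightarrow> bool"
  where "stabilizes_at C r D i \<longleftrightarrow> (\<forall>j. (i, j) \<in> r \<and> j \<noteq> i \<longrightarrow> iso C (amap D (i, j)))"

definition co_well_founded :: "'u itself \<Rightarrow> ('o, 'a) cat \<Rightarrow> bool"
  where "co_well_founded U C \<longleftrightarrow>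
    (\<forall>(I :: 'u set) r D. small U I \<and> chain C I r D \<longrightarrow> (\<exists>i\<in>I. stabilizes_at C r D i))"


section \<open>The categories defined above are categories\<close>

lemma category_poset_cat: "partial_order_on I r \<Longrightarrow> category (poset_cat I r)"
  by (unfold_locales)
    (auto simp: poset_cat_def hom_def order_on_defs refl_on_def dest: transD)

lemma category_discrete_cat: "category (discrete_cat I)"
  by unfold_locales (auto simp: discrete_cat_def hom_def)

lemma category_full_subcategory:
  assumes "category C"
  shows "category (full_subcategory C P)"
proof -
  interpret category C by fact
  show ?thesis
  proof (unfold_locales, goal_cases)
    case (4 f X Y g Z)
    then show ?case
      using Comp_in_hom[of f X Y g Z] by (auto simp: full_subcategory_def hom_def)
  next
    case (7 f W X g Y h Z)
    then show ?case
      using Comp_assoc[of f W X g Y h Z] by (auto simp: full_subcategory_def hom_def)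
  qed (use Dom_in_Ob Cod_in_Ob Id_in_hom Comp_Id Id_Comp in
        \<open>auto simp: full_subcategory_def hom_def\<close>)
qed

lemma category_sheaf_cat:
  assumes "category C"
  shows "category (sheaf_cat C J)"
proof -
  interpret category C by fact
  show ?thesis
    by unfold_locales
      (auto simp: sheaf_cat_def hom_def sheaf_def presheaf_def presheaf_hom_def fun_eq_iff
        Dom_in_Ob Cod_in_Ob)
qed

end

theory Submission
  imports Defs
begin

text \<open>
  Realise the topos as sheaves on a small site, so that its objects have sections. A sheafification
  in which a section is the graph of its locally given germs computes colimits on sections: two
  sections of the stages agree in the colimit iff they are locally identified, and every section of
  the colimit comes locally from a stage.

  An atom has no proper nonempty subsheaf, so what holds for one section over an object that is not
  covered by the empty sieve holds locally for all of them. Hence arrows out of an atom factor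
  through a single summand of a coproduct of atoms and through a stage of a directed colimit:
  by co-well-foundedness the images of an atom at later stages are eventually isomorphic, and the
  stable image embeds into the colimit. So finite coproducts of atoms are finitely presentable.
  Every object is the directed colimit of its finite sub-coproducts, which gives local finite
  presentability (there is only a small set of atoms up to isomorphism, an atom being determined by
  the kernel of any of its sections); factoring the identity of a finitely presentable object
  through a finite sub-coproduct shows that it is finite.
\<close>

section \<open>Small sets\<close>

text \<open>\<open>E\<close> is known only up to equivalence with sheaves, so statements about it
  are turned into statements about sections, and colimits are recognised by two local conditions on
  sections. Objects covered by the empty sieve are the recurring obstacle: every sheaf has exactly
  one section there, so whoever picks a section must keep track of it being informative. The chain
  condition answers the following difficulty. An arrow \<open>g\<close> from an atom to a directed
  colimit meets the image of some atom \<open>B\<close> of a stage, but \<open>B\<close> need not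
  embed into the colimit, since later stages may identify more of its sections. What
  \<open>g\<close> factors through is the image of \<open>B\<close> in the colimit, and this image
  has to be realised at a stage. Arrows between atoms are epimorphisms, so the images of
  \<open>B\<close> at later stages are quotients of one another. A directed diagram is not a
  sequence; therefore the chain condition is used as well-foundedness of the relation of proper
  quotients, and a minimal image is chosen.\<close>

lemma small_lepoll: "small U B \<Longrightarrow> A \<lesssim> B \<Longrightarrow> small U A"
  unfolding small_def by (rule lesspoll_trans1)

lemma small_subset: "small U B \<Longrightarrow> A \<subseteq> B \<Longrightarrow> small U A"
  by (rule small_lepoll[OF _ subset_imp_lepoll])

lemma small_image: "small U A \<Longrightarrow> small U (f ` A)"
  by (rule small_lepoll[OF _ image_lepoll])

lemma small_inj_on:
  assumes "small U (f ` A)" and "inj_on f A"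
  shows "small U A"
  using assms(1) by (rule small_lepoll) (use assms(2) in \<open>auto simp: lepoll_def\<close>)

lemma small_obtains_inj:
  fixes U :: "'u itself" and A :: "'a set"
  assumes "small U A"
  obtains e :: "'a \<Rightarrow> 'u" where "inj_on e A"
  using assms unfolding small_def lesspoll_def lepoll_def by blast

text \<open>Inaccessibility speaks of subsets of \<open>'u\<close> only; a small set of another type
  is first moved into \<open>'u\<close> by an injection, and the power sets are compared
  there.\<close>

lemma small_Pow:
  fixes U :: "'u itself" and A :: "'a set"
  assumes U: "strongly_inaccessible U" and A: "small U A"
  shows "small U (Pow A)"
proof -
  obtain e :: "'a \<Rightarrow> 'u" where e: "inj_on e A"
    using A by (rule small_obtains_inj)
  have "small U (Pow (e ` A))"
    using U small_image[OF A, of e] by (auto simp: strongly_inaccessible_def small_def)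
  moreover have "(`) e ` Pow A \<subseteq> Pow (e ` A)"
    by blast
  ultimately show ?thesis
    using e by (meson inj_on_image_Pow small_inj_on small_subset)
qed

lemma small_nat:
  fixes N :: "nat set"
  assumes "strongly_inaccessible U"
  shows "small U N"
  using assms by (auto simp: strongly_inaccessible_def small_def intro: small_subset[unfolded small_def])

text \<open>An infinite cardinal equals its square. The pairing keeps the fibres of a dependent sum
  apart inside \<open>'u\<close>.\<close>

lemma inaccessible_pairing:
  assumes "strongly_inaccessible TYPE('u)"
  obtains e :: "'u \<times> 'u \<Rightarrow> 'u" where "inj e"
proof -
  have "infinite (UNIV :: 'u set)"
    using assms by (auto simp: strongly_inaccessible_def small_def infinite_le_lepoll lesspoll_imp_lepoll)
  then obtain e :: "'u \<times> 'u \<Rightarrow> 'u" where "bij e"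
    using card_of_Times_same_infinite[of "UNIV :: 'u set"]
    by (auto simp: card_of_ordIso[symmetric])
  then show thesis
    using that bij_is_inj by blast
qed

lemma small_Sigma:
  fixes U :: "'u itself" and I :: "'i set" and A :: "'i \<Rightarrow> 'a set"
  assumes U: "strongly_inaccessible U" and I: "small U I" and A: "\<And>i. i \<in> I \<Longrightarrow> small U (A i)"
  shows "small U (Sigma I A)"
proof -
  obtain p :: "'u \<times> 'u \<Rightarrow> 'u" where p: "inj p"
    using U inaccessible_pairing by (auto simp: strongly_inaccessible_def small_def)
  obtain e :: "'i \<Rightarrow> 'u" where e: "inj_on e I"
    using I by (rule small_obtains_inj)
  have "\<exists>k :: 'a \<Rightarrow> 'u. inj_on k (A i)" if "i \<in> I" for i
    using small_obtains_inj[OF A[OF that]] by metis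
  then obtain k :: "'i \<Rightarrow> 'a \<Rightarrow> 'u" where k: "\<And>i. i \<in> I \<Longrightarrow> inj_on (k i) (A i)"
    by metis
  \<comment> \<open>Regularity bounds unions indexed inside \<open>'u\<close>. Hence the index is
    moved to \<open>e i\<close> and the fibre is tagged with it, so that the union contains a
    disjoint copy of \<open>Sigma I A\<close>.\<close>
  define B where "B v = (\<lambda>a. p (v, k (inv_into I e v) a)) ` A (inv_into I e v)" for v
  have "small U (B v)" if "v \<in> e ` I" for v
    unfolding B_def using that by (intro small_image A inv_into_into)
  then have B: "\<forall>v\<in>e ` I. small U (B v)"
    by simp
  have "small U (\<Union>v\<in>e ` I. B v)"
    using U[unfolded strongly_inaccessible_def, THEN conjunct2, THEN conjunct2, THEN spec, THEN spec,
        THEN mp, OF conjI, OF small_image[OF I] B] .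
  moreover have "(\<lambda>(i, a). p (e i, k i a)) ` Sigma I A \<subseteq> (\<Union>v\<in>e ` I. B v)"
    using e by (auto simp: B_def)
  moreover have "inj_on (\<lambda>(i, a). p (e i, k i a)) (Sigma I A)"
  proof (rule inj_onI, clarsimp)
    fix i a j b
    assume *: "i \<in> I" "a \<in> A i" "j \<in> I" "b \<in> A j" "p (e i, k i a) = p (e j, k j b)"
    then have "e i = e j" and "k i a = k j b"
      using p by (auto dest: injD)
    moreover from this(1) have "i = j"
      using e * by (auto dest: inj_onD)
    ultimately show "i = j \<and> a = b"
      using k * by (auto dest: inj_onD)
  qed
  ultimately show ?thesis
    by (meson small_inj_on small_subset)
qed

lemma small_Times:
  "strongly_inaccessible U \<Longrightarrow> small U A \<Longrightarrow> small U B \<Longrightarrow> small U (A \<times> B)"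
  by (rule small_Sigma)

section \<open>Local properties on a site\<close>

context category
begin

lemma comp_in_Ar:
  assumes "f \<in> Ar C" and "g \<in> Ar C" and "Cod C f = Dom C g"
  shows "g \<cdot> f \<in> Ar C" and "Dom C (g \<cdot> f) = Dom C f" and "Cod C (g \<cdot> f) = Cod C g"
  using Comp_in_hom[of f "Dom C f" "Cod C f" g "Cod C g"] assms by (auto simp: hom_def)

lemma Id_in_Ar:
  assumes "X \<in> Ob C"
  shows "Id C X \<in> Ar C" and "Dom C (Id C X) = X" and "Cod C (Id C X) = X"
  using Id_in_hom[OF assms] by (auto simp: hom_def)

lemma assoc_Ar:
  assumes "f \<in> Ar C" and "g \<in> Ar C" and "h \<in> Ar C" and "Cod C f = Dom C g" and "Cod C g = Dom C h"
  shows "h \<cdot> g \<cdot> f = h \<cdot> (g \<cdot> f)"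
  using Comp_assoc assms by (auto simp: hom_def)

lemma unit_Ar:
  assumes "f \<in> Ar C"
  shows "f \<cdot> Id C (Dom C f) = f" and "Id C (Cod C f) \<cdot> f = f"
  using Comp_Id Id_Comp assms by (auto simp: hom_def)

end

locale site = category C for C :: "('c, 'd) cat" (structure) +
  fixes J :: "'c \<Rightarrow> 'd set set"
  assumes topology: "grothendieck_topology C J"
begin

text \<open>The arrows satisfying \<open>P\<close> have to be a covering sieve, not merely to
  contain one. A local property is thus stable under composition, which is why several rules below
  carry a stability premise.\<close>

definition locally :: "'c \<Rightarrow> ('d \<Rightarrow> bool) \<Rightarrow> bool"
  where "locally x P \<longleftrightarrow> {f \<in> Ar C. Cod C f = x \<and> P f} \<in> J x"

text \<open>The empty sieve covers \<open>x\<close>. A sheaf has exactly one section there, so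
  sections over such objects carry no information.\<close>

abbreviation null :: "'c \<Rightarrow> bool"
  where "null x \<equiv> locally x (\<lambda>_. False)"

lemma locally_stable:
  assumes "locally x P" and "x \<in> Ob C" and "f \<in> Ar C" and "Cod C f = x" and "P f"
    and "g \<in> Ar C" and "Cod C g = Dom C f"
  shows "P (f \<cdot> g)"
proof -
  have "sieve C x {f \<in> Ar C. Cod C f = x \<and> P f}"
    using topology assms(1,2) by (auto simp: grothendieck_topology_def locally_def)
  then show ?thesis
    using assms(3-) unfolding sieve_def by blast
qed

lemma locally_all:
  assumes "x \<in> Ob C" and "\<And>f. f \<in> Ar C \<Longrightarrow> Cod C f = x \<Longrightarrow> P f"
  shows "locally x P"
proof -
  have "{f \<in> Ar C. Cod C f = x \<and> P f} = {f \<in> Ar C. Cod C f = x}"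
    using assms by auto
  then show ?thesis
    using topology assms(1) by (simp add: grothendieck_topology_def locally_def)
qed

lemma locally_pull:
  assumes "locally (Cod C h) P" and "h \<in> Ar C"
  shows "locally (Dom C h) (\<lambda>f. P (h \<cdot> f))"
proof -
  have "pullback_sieve C h {f \<in> Ar C. Cod C f = Cod C h \<and> P f} \<in> J (Dom C h)"
    using topology assms by (auto simp: grothendieck_topology_def locally_def)
  also have "pullback_sieve C h {f \<in> Ar C. Cod C f = Cod C h \<and> P f}
      = {f \<in> Ar C. Cod C f = Dom C h \<and> P (h \<cdot> f)}"
    using comp_in_Ar assms by (auto simp: pullback_sieve_def)
  finally show ?thesis
    by (simp add: locally_def)
qed

text \<open>The local character axiom of the topology. The stability premise turns the arrows
  satisfying \<open>Q\<close> into a sieve, to which the axiom applies.\<close>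

lemma locally_trans:
  assumes "locally x P" and x: "x \<in> Ob C"
    and stable: "\<And>f g. f \<in> Ar C \<Longrightarrow> Cod C f = x \<Longrightarrow> Q f \<Longrightarrow> g \<in> Ar C \<Longrightarrow> Cod C g = Dom C f \<Longrightarrow> Q (f \<cdot> g)"
    and "\<And>f. f \<in> Ar C \<Longrightarrow> Cod C f = x \<Longrightarrow> P f \<Longrightarrow> locally (Dom C f) (\<lambda>g. Q (f \<cdot> g))"
  shows "locally x Q"
proof -
  let ?R = "{f \<in> Ar C. Cod C f = x \<and> Q f}"
  let ?S = "{f \<in> Ar C. Cod C f = x \<and> P f}"
  have "sieve C x ?R"
    using stable comp_in_Ar by (auto simp: sieve_def)
  moreover have "pullback_sieve C h ?R \<in> J (Dom C h)" if "h \<in> ?S" for h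
  proof -
    have "pullback_sieve C h ?R = {f \<in> Ar C. Cod C f = Dom C h \<and> Q (h \<cdot> f)}"
      using comp_in_Ar that by (auto simp: pullback_sieve_def)
    then show ?thesis
      using assms(4)[of h] that by (simp add: locally_def)
  qed
  moreover have "?S \<in> J x"
    using assms(1) by (simp add: locally_def)
  ultimately show ?thesis
    using topology x unfolding grothendieck_topology_def locally_def by blast
qed

lemma locally_mono:
  assumes "locally x P" and x: "x \<in> Ob C"
    and "\<And>f g. f \<in> Ar C \<Longrightarrow> Cod C f = x \<Longrightarrow> Q f \<Longrightarrow> g \<in> Ar C \<Longrightarrow> Cod C g = Dom C f \<Longrightarrow> Q (f \<cdot> g)"
    and "\<And>f. f \<in> Ar C \<Longrightarrow> Cod C f = x \<Longrightarrow> P f \<Longrightarrow> Q f"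
  shows "locally x Q"
  using assms(1,2,3) by (rule locally_trans) (use assms(3,4) Dom_in_Ob in \<open>auto intro: locally_all\<close>)

lemma locally_conj:
  assumes P: "locally x P" and Q: "locally x Q" and x: "x \<in> Ob C"
  shows "locally x (\<lambda>f. P f \<and> Q f)"
proof (rule locally_trans[OF P x])
  show "locally (Dom C f) (\<lambda>g. P (f \<cdot> g) \<and> Q (f \<cdot> g))" if f: "f \<in> Ar C" "Cod C f = x" "P f" for f
  proof (rule locally_mono)
    show "locally (Dom C f) (\<lambda>g. Q (f \<cdot> g))"
      using Q f by (auto intro: locally_pull)
  qed (use f x P Q in \<open>auto simp: assoc_Ar[symmetric] Dom_in_Ob comp_in_Ar intro: locally_stable\<close>)
qed (use assms in \<open>auto intro: locally_stable\<close>)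

text \<open>If every arrow satisfying \<open>P\<close> had a null domain, local character would make
  the empty sieve cover \<open>x\<close>. Local existence thus yields one piece that still carries
  information.\<close>

lemma locally_witness:
  assumes "locally x P" and "x \<in> Ob C" and "\<not> null x"
  obtains f where "f \<in> Ar C" and "Cod C f = x" and "P f" and "\<not> null (Dom C f)"
  using locally_trans[OF assms(1,2), of "\<lambda>_. False"] assms(3) by blast

lemma locally_cong:
  assumes "\<And>f. f \<in> Ar C \<Longrightarrow> Cod C f = x \<Longrightarrow> P f = Q f"
  shows "locally x P = locally x Q"
proof -
  have "{f \<in> Ar C. Cod C f = x \<and> P f} = {f \<in> Ar C. Cod C f = x \<and> Q f}"
    using assms by auto
  then show ?thesis
    by (simp add: locally_def)
qed

lemma locally_rewrite:
  assumes "locally x P" and "\<And>f. f \<in> Ar C \<Longrightarrow> Cod C f = x \<Longrightarrow> P f = Q f"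
  shows "locally x Q"
  using assms(1) locally_cong[of x P Q] assms(2) by blast

section \<open>Gluing\<close>

context
  fixes F :: "('c, 'd, 'v) psh"
  assumes F: "sheaf C J F"
begin

lemma res_in_sec: "f \<in> Ar C \<Longrightarrow> s \<in> sec F (Cod C f) \<Longrightarrow> res F f s \<in> sec F (Dom C f)"
  using F by (auto simp: sheaf_def presheaf_def)

lemma res_Id: "x \<in> Ob C \<Longrightarrow> s \<in> sec F x \<Longrightarrow> res F (Id C x) s = s"
  using F by (auto simp: sheaf_def presheaf_def)

lemma res_comp:
  "f \<in> Ar C \<Longrightarrow> g \<in> Ar C \<Longrightarrow> Cod C f = Dom C g \<Longrightarrow> s \<in> sec F (Cod C g) \<Longrightarrow>
    res F (g \<cdot> f) s = res F f (res F g s)"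
  using F by (auto simp: sheaf_def presheaf_def)

lemma sheaf_glue:
  assumes P: "locally x P" and x: "x \<in> Ob C"
    and s: "\<And>f. f \<in> Ar C \<Longrightarrow> Cod C f = x \<Longrightarrow> P f \<Longrightarrow> s f \<in> sec F (Dom C f)"
    and match: "\<And>f g. f \<in> Ar C \<Longrightarrow> Cod C f = x \<Longrightarrow> P f \<Longrightarrow> g \<in> Ar C \<Longrightarrow> Cod C g = Dom C f \<Longrightarrow>
      s (f \<cdot> g) = res F g (s f)"
  shows "\<exists>!a. a \<in> sec F x \<and> (\<forall>f\<in>Ar C. Cod C f = x \<longrightarrow> P f \<longrightarrow> res F f a = s f)"
proof -
  let ?S = "{f \<in> Ar C. Cod C f = x \<and> P f}"
  have "?S \<in> J x"
    using P by (simp add: locally_def)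
  moreover have "matching_family C F ?S s"
    using s match by (auto simp: matching_family_def)
  ultimately have "\<exists>!a. a \<in> sec F x \<and> (\<forall>f\<in>?S. res F f a = s f)"
    using F x unfolding sheaf_def by blast
  then show ?thesis
    by (simp add: Ball_def imp_conjL)
qed

text \<open>Both sections amalgamate the family of restrictions of \<open>b\<close>, taken on the
  sieve where \<open>a\<close> and \<open>b\<close> agree.\<close>

lemma sheaf_separated:
  assumes "locally x (\<lambda>f. res F f a = res F f b)" and "x \<in> Ob C" and "a \<in> sec F x" and "b \<in> sec F x"
  shows "a = b"
proof -
  have "\<exists>!c. c \<in> sec F x \<and>
      (\<forall>f\<in>Ar C. Cod C f = x \<longrightarrow> res F f a = res F f b \<longrightarrow> res F f c = res F f b)"
    using assms(1,2) by (rule sheaf_glue) (use assms in \<open>auto simp: res_comp intro: res_in_sec\<close>)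
  then show ?thesis
    using assms(3,4) by blast
qed

end

text \<open>A morphism of sheaves is often known only through a graph \<open>R\<close> that is
  defined locally. Over a cover the unique partners form a matching family, and the value is its
  amalgamation.\<close>

lemma glue_hom:
  assumes X: "sheaf C J X" and Y: "sheaf C J Y"
    and R: "\<And>x a b. x \<in> Ob C \<Longrightarrow> R x a b \<Longrightarrow> a \<in> sec X x \<and> b \<in> sec Y x"
    and stable: "\<And>f a b. f \<in> Ar C \<Longrightarrow> R (Cod C f) a b \<Longrightarrow> R (Dom C f) (res X f a) (res Y f b)"
    and single: "\<And>x a b b'. x \<in> Ob C \<Longrightarrow> R x a b \<Longrightarrow> R x a b' \<Longrightarrow> b = b'"
    and total: "\<And>x a. x \<in> Ob C \<Longrightarrow> a \<in> sec X x \<Longrightarrow> locally x (\<lambda>f. \<exists>b. R (Dom C f) (res X f a) b)"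
  obtains \<phi> where "presheaf_hom C X Y \<phi>" and "\<And>x a b. x \<in> Ob C \<Longrightarrow> R x a b \<Longrightarrow> \<phi> x a = b"
proof -
  define s where "s a f = (THE b. R (Dom C f) (res X f a) b)" for a f
  have s: "R (Dom C f) (res X f a) b \<Longrightarrow> s a f = b" if "f \<in> Ar C" for a b f
    unfolding s_def using single Dom_in_Ob that by (blast intro: the_equality)
  have ex: "\<exists>!b. b \<in> sec Y x \<and> (\<forall>f\<in>Ar C. Cod C f = x \<longrightarrow> (\<exists>b. R (Dom C f) (res X f a) b) \<longrightarrow> res Y f b = s a f)"
    if "x \<in> Ob C" "a \<in> sec X x" for x a
  proof (rule sheaf_glue[OF Y total[OF that]])
    fix f assume f: "f \<in> Ar C" "Cod C f = x" "\<exists>b. R (Dom C f) (res X f a) b"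
    then obtain b where b: "R (Dom C f) (res X f a) b"
      by blast
    then show "s a f \<in> sec Y (Dom C f)"
      using R f s Dom_in_Ob by auto
    fix g assume g: "g \<in> Ar C" "Cod C g = Dom C f"
    have "R (Dom C g) (res X g (res X f a)) (res Y g b)"
      using b g stable by simp
    moreover have "res X g (res X f a) = res X (f \<cdot> g) a"
      using res_comp[OF X, of g f a] f g that by simp
    ultimately have "s a (f \<cdot> g) = res Y g b"
      using s[of "f \<cdot> g" a] f g comp_in_Ar[of g f] by auto
    then show "s a (f \<cdot> g) = res Y g (s a f)"
      using s[OF f(1) b] by simp
  qed (use that in auto)
  define \<phi> where "\<phi> x a = (if x \<in> Ob C \<and> a \<in> sec X x then
      (THE b. b \<in> sec Y x \<and> (\<forall>f\<in>Ar C. Cod C f = x \<longrightarrow> (\<exists>b. R (Dom C f) (res X f a) b) \<longrightarrow> res Y f b = s a f))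
      else undefined)" for x a
  have \<phi>: "\<phi> x a \<in> sec Y x"
    "\<And>f b. f \<in> Ar C \<Longrightarrow> Cod C f = x \<Longrightarrow> R (Dom C f) (res X f a) b \<Longrightarrow> res Y f (\<phi> x a) = b"
    if "x \<in> Ob C" "a \<in> sec X x" for x a
    using theI'[OF ex[OF that]] that s unfolding \<phi>_def by auto
  have "presheaf_hom C X Y \<phi>"
    unfolding presheaf_hom_def
  proof (intro conjI ballI allI impI)
    fix f a assume f: "f \<in> Ar C" and a: "a \<in> sec X (Cod C f)"
    have D: "Dom C f \<in> Ob C" "Cod C f \<in> Ob C"
      using f Dom_in_Ob Cod_in_Ob by auto
    have ra: "res X f a \<in> sec X (Dom C f)"
      using res_in_sec[OF X f a] .
    \<comment> \<open>Naturality is tested on the cover where \<open>R\<close> has a partner: there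
      both sides restrict to that partner.\<close>
    show "\<phi> (Dom C f) (res X f a) = res Y f (\<phi> (Cod C f) a)"
    proof (rule sheaf_separated[OF Y _ D(1)])
      have L: "locally (Dom C f) (\<lambda>g. \<exists>b. R (Dom C g) (res X g (res X f a)) b)"
        using total[OF D(1) ra] .
      show "locally (Dom C f) (\<lambda>g. res Y g (\<phi> (Dom C f) (res X f a)) = res Y g (res Y f (\<phi> (Cod C f) a)))"
      proof (rule locally_mono[OF L D(1)])
        fix g assume g: "g \<in> Ar C" "Cod C g = Dom C f"
        have ra': "res X g (res X f a) = res X (f \<cdot> g) a"
          using res_comp[OF X, of g f a] f g a by simp
        have rp: "res Y g (res Y f (\<phi> (Cod C f) a)) = res Y (f \<cdot> g) (\<phi> (Cod C f) a)"
          using res_comp[OF Y, of g f "\<phi> (Cod C f) a"] f g a \<phi>(1)[OF D(2)] by simp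
        assume "\<exists>b. R (Dom C g) (res X g (res X f a)) b"
        then obtain b where b: "R (Dom C g) (res X g (res X f a)) b"
          by blast
        have "res Y g (\<phi> (Dom C f) (res X f a)) = b"
          using \<phi>(2)[OF D(1) ra g b] .
        moreover have "res Y (f \<cdot> g) (\<phi> (Cod C f) a) = b"
          using \<phi>(2)[OF D(2) a, of "f \<cdot> g" b] b comp_in_Ar[of g f] f g unfolding ra' by simp
        ultimately show "res Y g (\<phi> (Dom C f) (res X f a)) = res Y g (res Y f (\<phi> (Cod C f) a))"
          by (simp add: rp)
      next
        fix g h assume gh: "g \<in> Ar C" "Cod C g = Dom C f" "h \<in> Ar C" "Cod C h = Dom C g"
          and eq: "res Y g (\<phi> (Dom C f) (res X f a)) = res Y g (res Y f (\<phi> (Cod C f) a))"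
        show "res Y (g \<cdot> h) (\<phi> (Dom C f) (res X f a)) = res Y (g \<cdot> h) (res Y f (\<phi> (Cod C f) a))"
          using res_comp[OF Y gh(3,1,4)] gh(2) eq \<phi>(1)[OF D(1) ra] res_in_sec[OF Y f \<phi>(1)[OF D(2) a]] by simp
      qed
    qed (use \<phi>(1) D a ra res_in_sec[OF Y f] in auto)
  qed (use \<phi> in \<open>auto simp: \<phi>_def\<close>)
  \<comment> \<open>When \<open>R x a b\<close> holds, the identity belongs to the sieve, so the
    amalgamation restricts to \<open>b\<close> along it.\<close>
  moreover have "\<phi> x a = b" if x: "x \<in> Ob C" and r: "R x a b" for x a b
  proof -
    have ab: "a \<in> sec X x" "b \<in> sec Y x"
      using R[OF x r] by auto
    have "res Y (Id C x) (\<phi> x a) = b"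
      using \<phi>(2)[OF x ab(1), of "Id C x" b] r Id_in_Ar[OF x] res_Id[OF X x ab(1)] by simp
    then show ?thesis
      using res_Id[OF Y x \<phi>(1)[OF x ab(1)]] by simp
  qed
  ultimately show thesis
    by (rule that)
qed

text \<open>The last clause, closure under local membership, distinguishes a subsheaf from a
  subpresheaf: amalgamations taken in \<open>F\<close> stay in \<open>K\<close>.\<close>

definition subsheaf :: "('c, 'd, 'v) psh \<Rightarrow> ('c \<Rightarrow> 'v set) \<Rightarrow> bool"
  where "subsheaf F K \<longleftrightarrow>
    (\<forall>x\<in>Ob C. K x \<subseteq> sec F x) \<and>
    (\<forall>f\<in>Ar C. \<forall>a\<in>K (Cod C f). res F f a \<in> K (Dom C f)) \<and>
    (\<forall>x\<in>Ob C. \<forall>a\<in>sec F x. locally x (\<lambda>f. res F f a \<in> K (Dom C f)) \<longrightarrow> a \<in> K x)"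

lemma sheaf_subsheaf:
  fixes F :: "('c, 'd, 'e) psh"
  assumes F: "sheaf C J F" and K: "subsheaf F K"
  shows "sheaf C J (F\<lparr>sec := K\<rparr>)"
proof -
  have sub: "s \<in> sec F x" if "x \<in> Ob C" "s \<in> K x" for x s
    using K that by (auto simp: subsheaf_def)
  show ?thesis
    unfolding sheaf_def
  proof (intro conjI ballI allI impI)
    show "presheaf C (F\<lparr>sec := K\<rparr>)"
      unfolding presheaf_def
    proof (intro conjI ballI impI)
      show "small TYPE('e) (sec (F\<lparr>sec := K\<rparr>) x)" if "x \<in> Ob C" for x
        using F sub that by (auto simp: sheaf_def presheaf_def intro: small_subset)
    qed (use K sub in \<open>auto simp: subsheaf_def res_Id[OF F] res_comp[OF F] Cod_in_Ob\<close>)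
  next
    fix x S s
    assume x: "x \<in> Ob C" and S: "S \<in> J x" and s: "matching_family C (F\<lparr>sec := K\<rparr>) S s"
    have "sieve C x S"
      using topology x S by (simp add: grothendieck_topology_def)
    then have sv: "S \<subseteq> {f \<in> Ar C. Cod C f = x}"
      by (simp add: sieve_def)
    have "matching_family C F S s"
      using s K sv Dom_in_Ob unfolding matching_family_def subsheaf_def by fastforce
    then have ex: "\<exists>!a. a \<in> sec F x \<and> (\<forall>f\<in>S. res F f a = s f)"
      using F x S unfolding sheaf_def by blast
    then obtain a where a: "a \<in> sec F x" "\<forall>f\<in>S. res F f a = s f"
      by blast
    have "{f \<in> Ar C. Cod C f = x \<and> f \<in> S} = S"
      using sv by auto
    then have "locally x (\<lambda>f. f \<in> S)"
      using S by (simp add: locally_def)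
    then have "locally x (\<lambda>f. res F f a \<in> K (Dom C f))"
    proof (rule locally_mono[OF _ x])
      show "res F f a \<in> K (Dom C f)" if "f \<in> S" for f
        using a s that by (auto simp: matching_family_def)
      fix f g assume *: "f \<in> Ar C" "Cod C f = x" "res F f a \<in> K (Dom C f)" "g \<in> Ar C" "Cod C g = Dom C f"
      then have "res F (f \<cdot> g) a = res F g (res F f a)"
        using res_comp[OF F] a by simp
      then show "res F (f \<cdot> g) a \<in> K (Dom C (f \<cdot> g))"
        using * K comp_in_Ar[of g f] unfolding subsheaf_def by simp
    qed
    then have aK: "a \<in> K x"
      using K a x unfolding subsheaf_def by blast
    show "\<exists>!a. a \<in> sec (F\<lparr>sec := K\<rparr>) x \<and> (\<forall>f\<in>S. res (F\<lparr>sec := K\<rparr>) f a = s f)"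
    proof (rule ex1I[of _ a], goal_cases)
      case 1
      then show ?case using a aK by simp
    next
      case (2 b)
      then have "b \<in> sec F x \<and> (\<forall>f\<in>S. res F f b = s f)"
        using sub[OF x] by simp
      then show ?case
        using ex a by blast
    qed
  qed
qed

end

section \<open>The sheaf generated by a presheaf with a local equality\<close>

text \<open>By \<open>E_local\<close> the quotient of \<open>P\<close> by \<open>E\<close> is a
  separated presheaf, so a single plus construction sheafifies it. Representatives and the relation
  \<open>E\<close> replace the quotient. The type of \<open>P\<close> is left free so that pairs of
  a stage and a section fit.\<close>

locale local_equality = site C J for C :: "('c, 'd) cat" (structure) and J +
  fixes P :: "'c \<Rightarrow> 'p set" and r :: "'d \<Rightarrow> 'p \<Rightarrow> 'p" and E :: "'c \<Rightarrow> 'p \<Rightarrow> 'p \<Rightarrow> bool"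
  assumes r_in: "f \<in> Ar C \<Longrightarrow> p \<in> P (Cod C f) \<Longrightarrow> r f p \<in> P (Dom C f)"
    and r_Id: "x \<in> Ob C \<Longrightarrow> p \<in> P x \<Longrightarrow> r (Id C x) p = p"
    and r_comp: "f \<in> Ar C \<Longrightarrow> g \<in> Ar C \<Longrightarrow> Cod C f = Dom C g \<Longrightarrow> p \<in> P (Cod C g) \<Longrightarrow>
      r (g \<cdot> f) p = r f (r g p)"
    and E_refl: "x \<in> Ob C \<Longrightarrow> p \<in> P x \<Longrightarrow> E x p p"
    and E_sym: "x \<in> Ob C \<Longrightarrow> p \<in> P x \<Longrightarrow> q \<in> P x \<Longrightarrow> E x p q \<Longrightarrow> E x q p"
    and E_trans: "x \<in> Ob C \<Longrightarrow> p \<in> P x \<Longrightarrow> q \<in> P x \<Longrightarrow> s \<in> P x \<Longrightarrow> E x p q \<Longrightarrow> E x q s \<Longrightarrow> E x p s"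
    and E_res: "f \<in> Ar C \<Longrightarrow> p \<in> P (Cod C f) \<Longrightarrow> q \<in> P (Cod C f) \<Longrightarrow> E (Cod C f) p q \<Longrightarrow>
      E (Dom C f) (r f p) (r f q)"
    and E_local: "x \<in> Ob C \<Longrightarrow> p \<in> P x \<Longrightarrow> q \<in> P x \<Longrightarrow>
      locally x (\<lambda>f. E (Dom C f) (r f p) (r f q)) \<Longrightarrow> E x p q"
begin

text \<open>
  A section over \<open>x\<close> of the generated sheaf is encoded as the relation \<open>R\<close> consisting of all pairs
  \<open>(f, p)\<close> such that the restriction of the section along \<open>f\<close> is the class of \<open>p\<close>.
\<close>

definition germ :: "'c \<Rightarrow> ('d \<times> 'p) set \<Rightarrow> bool"
  where "germ x R \<longleftrightarrow>
    (\<forall>f p. (f, p) \<in> R \<longrightarrow> f \<in> Ar C \<and> Cod C f = x \<and> p \<in> P (Dom C f)) \<and>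
    (\<forall>f p g. (f, p) \<in> R \<longrightarrow> g \<in> Ar C \<longrightarrow> Cod C g = Dom C f \<longrightarrow> (f \<cdot> g, r g p) \<in> R) \<and>
    (\<forall>f p q. (f, p) \<in> R \<longrightarrow> q \<in> P (Dom C f) \<longrightarrow> ((f, q) \<in> R \<longleftrightarrow> E (Dom C f) p q)) \<and>
    (\<forall>f p. f \<in> Ar C \<longrightarrow> Cod C f = x \<longrightarrow> p \<in> P (Dom C f) \<longrightarrow>
      locally (Dom C f) (\<lambda>g. (f \<cdot> g, r g p) \<in> R) \<longrightarrow> (f, p) \<in> R) \<and>
    locally x (\<lambda>f. \<exists>p. (f, p) \<in> R)"

definition restrict :: "'d \<Rightarrow> ('d \<times> 'p) set \<Rightarrow> ('d \<times> 'p) set"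
  where "restrict h R = {(f, p). f \<in> Ar C \<and> Cod C f = Dom C h \<and> (h \<cdot> f, p) \<in> R}"

definition germ_of :: "'c \<Rightarrow> 'p \<Rightarrow> ('d \<times> 'p) set"
  where "germ_of x p = {(f, q). f \<in> Ar C \<and> Cod C f = x \<and> q \<in> P (Dom C f) \<and> E (Dom C f) (r f p) q}"

lemma
  assumes "germ x R"
  shows germ_valid: "(f, p) \<in> R \<Longrightarrow> f \<in> Ar C \<and> Cod C f = x \<and> p \<in> P (Dom C f)"
    and germ_res: "(f, p) \<in> R \<Longrightarrow> g \<in> Ar C \<Longrightarrow> Cod C g = Dom C f \<Longrightarrow> (f \<cdot> g, r g p) \<in> R"
    and germ_single: "(f, p) \<in> R \<Longrightarrow> q \<in> P (Dom C f) \<Longrightarrow> (f, q) \<in> R \<longleftrightarrow> E (Dom C f) p q"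
    and germ_local: "f \<in> Ar C \<Longrightarrow> Cod C f = x \<Longrightarrow> p \<in> P (Dom C f) \<Longrightarrow>
      locally (Dom C f) (\<lambda>g. (f \<cdot> g, r g p) \<in> R) \<Longrightarrow> (f, p) \<in> R"
    and germ_total: "locally x (\<lambda>f. \<exists>p. (f, p) \<in> R)"
  using assms unfolding germ_def by blast+

lemma germ_restrict:
  assumes R: "germ (Cod C h) R" and h: "h \<in> Ar C"
  shows "germ (Dom C h) (restrict h R)"
  unfolding germ_def
proof (intro conjI allI impI, goal_cases)
  case (4 f p g)
  then show ?case
    using germ_res[OF R, of "h \<cdot> f" p g] h comp_in_Ar[of f h] comp_in_Ar[of g f] assoc_Ar[of g f h]
    by (auto simp: restrict_def)
next
  case (6 f p)
  have hf: "h \<cdot> f \<in> Ar C" "Dom C (h \<cdot> f) = Dom C f" "Cod C (h \<cdot> f) = Cod C h"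
    using comp_in_Ar[of f h] 6 h by auto
  have "locally (Dom C f) (\<lambda>g. (h \<cdot> f \<cdot> g, r g p) \<in> R)"
  proof (subst locally_cong)
    show "(h \<cdot> f \<cdot> g, r g p) \<in> R \<longleftrightarrow> (f \<cdot> g, r g p) \<in> restrict h R" if "g \<in> Ar C" "Cod C g = Dom C f" for g
      using that assoc_Ar[of g f h] comp_in_Ar[of g f] 6 h by (auto simp: restrict_def)
  qed fact
  then show ?case
    using germ_local[OF R, of "h \<cdot> f" p] hf 6 by (auto simp: restrict_def)
next
  case 7
  have "locally (Dom C h) (\<lambda>f. \<exists>p. (h \<cdot> f, p) \<in> R)"
    using locally_pull[OF germ_total[OF R] h] .
  then show ?case
    by (subst locally_cong[of _ _ "\<lambda>f. \<exists>p. (h \<cdot> f, p) \<in> R"]) (auto simp: restrict_def)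
next
  case (5 f p q)
  then show ?case
    using germ_single[OF R, of "h \<cdot> f" p q] h comp_in_Ar[of f h] by (auto simp: restrict_def)
next
  case (3 f p)
  then show ?case
    using germ_valid[OF R, of "h \<cdot> f" p] h comp_in_Ar[of f h] by (auto simp: restrict_def)
qed (auto simp: restrict_def)

lemma restrict_Id:
  assumes "germ x R" and "x \<in> Ob C"
  shows "restrict (Id C x) R = R"
proof -
  have "(f, p) \<in> restrict (Id C x) R \<longleftrightarrow> (f, p) \<in> R" for f p
  proof (cases "f \<in> Ar C \<and> Cod C f = x")
    case True
    then have "Id C x \<cdot> f = f"
      using unit_Ar(2) by blast
    then show ?thesis
      using True Id_in_Ar[OF assms(2)] by (simp add: restrict_def)
  next
    case False
    then show ?thesis
      using germ_valid[OF assms(1)] Id_in_Ar[OF assms(2)] by (auto simp: restrict_def)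
  qed
  then show ?thesis
    by auto
qed

lemma restrict_comp:
  assumes "f \<in> Ar C" and "g \<in> Ar C" and "Cod C f = Dom C g"
  shows "restrict (g \<cdot> f) R = restrict f (restrict g R)"
  using assms comp_in_Ar[of _ f] comp_in_Ar[of f g] assoc_Ar[of _ f g] by (auto simp: restrict_def)

text \<open>Membership may be tested on any cover \<open>Q\<close> of the domain; this is how a germ
  is recovered from its restrictions along a cover.\<close>

lemma germ_iff_locally:
  assumes R: "germ x R" and f: "f \<in> Ar C" "Cod C f = x" "p \<in> P (Dom C f)"
    and Q: "locally (Dom C f) Q"
  shows "(f, p) \<in> R \<longleftrightarrow> locally (Dom C f) (\<lambda>g. Q g \<and> (f \<cdot> g, r g p) \<in> R)"
proof
  assume R': "(f, p) \<in> R"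
  show "locally (Dom C f) (\<lambda>g. Q g \<and> (f \<cdot> g, r g p) \<in> R)"
    using germ_res[OF R R'] f by (intro locally_conj Q locally_all) (auto simp: Dom_in_Ob)
next
  assume L: "locally (Dom C f) (\<lambda>g. Q g \<and> (f \<cdot> g, r g p) \<in> R)"
  have D: "Dom C f \<in> Ob C"
    using f Dom_in_Ob by simp
  have "locally (Dom C f) (\<lambda>g. (f \<cdot> g, r g p) \<in> R)"
  proof (rule locally_mono[OF L D])
    fix g h assume *: "g \<in> Ar C" "Cod C g = Dom C f" "(f \<cdot> g, r g p) \<in> R" "h \<in> Ar C" "Cod C h = Dom C g"
    have "(f \<cdot> g \<cdot> h, r h (r g p)) \<in> R"
      using germ_res[OF R *(3,4)] comp_in_Ar[of g f] * f by simp
    moreover have "r h (r g p) = r (g \<cdot> h) p"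
      using r_comp[of h g p] * f by simp
    ultimately show "(f \<cdot> (g \<cdot> h), r (g \<cdot> h) p) \<in> R"
      using assoc_Ar[of h g f] * f by simp
  qed simp
  then show "(f, p) \<in> R"
    using germ_local[OF R f] by simp
qed

text \<open>Two rounds of locality collapse into one: a pair belongs to the amalgamation when it
  belongs to the pieces after a further covering, and locality of germs absorbs that
  covering.\<close>

lemma germ_glue:
  assumes Q: "locally x Q" and x: "x \<in> Ob C"
    and R: "\<And>f. f \<in> Ar C \<Longrightarrow> Cod C f = x \<Longrightarrow> Q f \<Longrightarrow> germ (Dom C f) (R f)"
    and match: "\<And>f g. f \<in> Ar C \<Longrightarrow> Cod C f = x \<Longrightarrow> Q f \<Longrightarrow> g \<in> Ar C \<Longrightarrow> Cod C g = Dom C f \<Longrightarrow>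
      R (f \<cdot> g) = restrict g (R f)"
  shows "\<exists>!T. germ x T \<and> (\<forall>f\<in>Ar C. Cod C f = x \<longrightarrow> Q f \<longrightarrow> restrict f T = R f)"
proof -
  note Qst = locally_stable[OF Q x]
  \<comment> \<open>\<open>G f p\<close> says that \<open>p\<close> represents the whole piece
    \<open>R f\<close>, read off at the identity. \<open>G_comp\<close> then turns membership in
    \<open>R f\<close> into a statement about \<open>G\<close> at a composite.\<close>
  define G where "G f p \<longleftrightarrow> Q f \<and> (Id C (Dom C f), p) \<in> R f" for f p
  define T where "T = {(f, p). f \<in> Ar C \<and> Cod C f = x \<and> p \<in> P (Dom C f) \<and>
    locally (Dom C f) (\<lambda>g. G (f \<cdot> g) (r g p))}"
  have G_comp: "G (f \<cdot> g) p \<longleftrightarrow> (g, p) \<in> R f"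
    if f: "f \<in> Ar C" "Cod C f = x" "Q f" and g: "g \<in> Ar C" "Cod C g = Dom C f" for f g p
  proof -
    have fg: "Dom C (f \<cdot> g) = Dom C g"
      using comp_in_Ar[of g f] f g by simp
    then have "G (f \<cdot> g) p \<longleftrightarrow> (Id C (Dom C g), p) \<in> restrict g (R f)"
      using Qst[OF f g] match[OF f g] by (simp add: G_def)
    also have "\<dots> \<longleftrightarrow> (g, p) \<in> R f"
      using Id_in_Ar[of "Dom C g"] Dom_in_Ob[OF g(1)] unit_Ar(1)[OF g(1)] by (simp add: restrict_def)
    finally show ?thesis .
  qed
  have G_res: "G (f \<cdot> g) (r g p)"
    if f: "f \<in> Ar C" "Cod C f = x" and G: "G f p" and g: "g \<in> Ar C" "Cod C g = Dom C f" for f g p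
  proof -
    have q: "Q f" and i: "(Id C (Dom C f), p) \<in> R f"
      using G by (auto simp: G_def)
    have "(Id C (Dom C f) \<cdot> g, r g p) \<in> R f"
      using germ_res[OF R[OF f q] i g(1)] g(2) Id_in_Ar[OF Dom_in_Ob[OF f(1)]] by simp
    then show ?thesis
      using G_comp[OF f q g] unit_Ar(2)[OF g(1)] g(2) by simp
  qed
  have G_single: "G f q \<longleftrightarrow> E (Dom C f) p q"
    if f: "f \<in> Ar C" "Cod C f = x" and G: "G f p" and q: "q \<in> P (Dom C f)" for f p q
  proof -
    have Qf: "Q f" and i: "(Id C (Dom C f), p) \<in> R f"
      using G by (auto simp: G_def)
    show ?thesis
      using germ_single[OF R[OF f Qf] i, of q] q Qf Id_in_Ar[OF Dom_in_Ob[OF f(1)]] by (simp add: G_def)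
  qed
  have G_P: "p \<in> P (Dom C f)" if f: "f \<in> Ar C" "Cod C f = x" and G: "G f p" for f p
    using germ_valid[OF R[OF f], of "Id C (Dom C f)" p] G Id_in_Ar[OF Dom_in_Ob[OF f(1)]]
    by (simp add: G_def)
  have GT: "(f, p) \<in> T" if f: "f \<in> Ar C" "Cod C f = x" and G: "G f p" for f p
    unfolding T_def using f G_P[OF f G] G_res[OF f G] by (auto intro: locally_all Dom_in_Ob)
  have G_stable: "G (f \<cdot> (g \<cdot> h)) (r (g \<cdot> h) p)"
    if "f \<in> Ar C" "Cod C f = x" "p \<in> P (Dom C f)" "g \<in> Ar C" "Cod C g = Dom C f" "h \<in> Ar C" "Cod C h = Dom C g"
      "G (f \<cdot> g) (r g p)" for f g h p
    using G_res[of "f \<cdot> g" "r g p" h] that comp_in_Ar[of g f] assoc_Ar[of h g f] r_comp[of h g p] by simp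
  have T_res: "(f \<cdot> g, r g p) \<in> T" if T: "(f, p) \<in> T" and g: "g \<in> Ar C" "Cod C g = Dom C f" for f g p
  proof -
    have f: "f \<in> Ar C" "Cod C f = x" "p \<in> P (Dom C f)"
      and L: "locally (Cod C g) (\<lambda>g. G (f \<cdot> g) (r g p))"
      using T g by (auto simp: T_def)
    have "locally (Dom C g) (\<lambda>h. G (f \<cdot> (g \<cdot> h)) (r (g \<cdot> h) p))"
      using locally_pull[OF L g(1)] .
    then have "locally (Dom C g) (\<lambda>h. G (f \<cdot> g \<cdot> h) (r h (r g p)))"
      using assoc_Ar[of _ g f] r_comp[of _ g p] f g by (subst locally_cong) auto
    then show ?thesis
      using g f comp_in_Ar[of g f] r_in[of g p] by (simp add: T_def)
  qed
  have "germ x T"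
    unfolding germ_def
  proof (intro conjI allI impI, goal_cases)
    case (4 f p g)
    then show ?case
      using T_res by blast
  next
    case (5 f p q)
    then have f: "f \<in> Ar C" "Cod C f = x" "p \<in> P (Dom C f)"
      and L: "locally (Dom C f) (\<lambda>g. G (f \<cdot> g) (r g p))"
      by (auto simp: T_def)
    note D = Dom_in_Ob[OF f(1)]
    have *: "G (f \<cdot> g) (r g q) \<longleftrightarrow> E (Dom C g) (r g p) (r g q)"
      if "g \<in> Ar C" "Cod C g = Dom C f" "G (f \<cdot> g) (r g p)" for g
      using G_single[of "f \<cdot> g" "r g p" "r g q"] comp_in_Ar[of g f] f that r_in[of g q] 5(2) by simp
    show ?case
    proof
      assume "(f, q) \<in> T"
      then have "locally (Dom C f) (\<lambda>g. G (f \<cdot> g) (r g p) \<and> G (f \<cdot> g) (r g q))"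
        using D L by (intro locally_conj) (auto simp: T_def)
      then have "locally (Dom C f) (\<lambda>g. E (Dom C g) (r g p) (r g q))"
      proof (rule locally_mono[OF _ D])
        fix g h assume "g \<in> Ar C" "Cod C g = Dom C f" "E (Dom C g) (r g p) (r g q)"
          "h \<in> Ar C" "Cod C h = Dom C g"
        then show "E (Dom C (g \<cdot> h)) (r (g \<cdot> h) p) (r (g \<cdot> h) q)"
          using E_res[of h "r g p" "r g q"] r_comp[of h g] r_in[of g] f 5(2) comp_in_Ar[of h g] by simp
      qed (use * in auto)
      then show "E (Dom C f) p q"
        using E_local[OF D f(3) 5(2)] by simp
    next
      assume e: "E (Dom C f) p q"
      have "locally (Dom C f) (\<lambda>g. G (f \<cdot> g) (r g q))"
      proof (rule locally_mono[OF L D])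
        fix g assume "g \<in> Ar C" "Cod C g = Dom C f" "G (f \<cdot> g) (r g p)"
        then show "G (f \<cdot> g) (r g q)"
          using * E_res[of g p q] f(3) 5(2) e by simp
      qed (use G_stable f 5(2) in auto)
      then show "(f, q) \<in> T"
        using f 5(2) by (simp add: T_def)
    qed
  next
    case (6 f p)
    note D = Dom_in_Ob[OF 6(1)]
    have "locally (Dom C f) (\<lambda>g. G (f \<cdot> g) (r g p))"
    proof (rule locally_trans[OF 6(4) D])
      fix g assume g: "g \<in> Ar C" "Cod C g = Dom C f" "(f \<cdot> g, r g p) \<in> T"
      then have "locally (Dom C g) (\<lambda>h. G (f \<cdot> g \<cdot> h) (r h (r g p)))"
        using comp_in_Ar[of g f] 6 by (simp add: T_def)
      then show "locally (Dom C g) (\<lambda>h. G (f \<cdot> (g \<cdot> h)) (r (g \<cdot> h) p))"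
        using assoc_Ar[of _ g f] r_comp[of _ g p] 6 g by (subst locally_cong[of _ _ "\<lambda>h. G (f \<cdot> g \<cdot> h) (r h (r g p))"]) auto
    qed (use G_stable 6 in auto)
    then show ?case
      using 6 by (simp add: T_def)
  next
    case 7
    show ?case
    proof (rule locally_trans[OF Q x])
      fix f assume f: "f \<in> Ar C" "Cod C f = x" "Q f"
      have "locally (Dom C f) (\<lambda>g. \<exists>p. (g, p) \<in> R f)"
        using germ_total[OF R[OF f]] .
      then have "locally (Dom C f) (\<lambda>g. \<exists>p. G (f \<cdot> g) p)"
        using G_comp[OF f] by (subst locally_cong) auto
      then show "locally (Dom C f) (\<lambda>g. \<exists>p. (f \<cdot> g, p) \<in> T)"
      proof (rule locally_mono[OF _ Dom_in_Ob[OF f(1)]])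
        fix g h assume g: "g \<in> Ar C" "Cod C g = Dom C f" "h \<in> Ar C" "Cod C h = Dom C g"
          and "\<exists>p. (f \<cdot> g, p) \<in> T"
        then obtain p where "(f \<cdot> g, p) \<in> T"
          by blast
        then have "(f \<cdot> g \<cdot> h, r h p) \<in> T"
          using T_res g comp_in_Ar[of g f] f by simp
        then show "\<exists>p. (f \<cdot> (g \<cdot> h), p) \<in> T"
          using assoc_Ar[of h g f] g f by auto
      next
        fix g assume "g \<in> Ar C" "Cod C g = Dom C f" "\<exists>p. G (f \<cdot> g) p"
        then show "\<exists>p. (f \<cdot> g, p) \<in> T"
          using GT[of "f \<cdot> g"] comp_in_Ar[of g f] f by auto
      qed
    next
      fix f g assume "\<exists>p. (f, p) \<in> T" "g \<in> Ar C" "Cod C g = Dom C f"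
      then show "\<exists>p. (f \<cdot> g, p) \<in> T"
        using T_res by blast
    qed
  qed (auto simp: T_def)
  moreover have "restrict f T = R f" if f: "f \<in> Ar C" "Cod C f = x" "Q f" for f
  proof -
    have "(g, p) \<in> restrict f T \<longleftrightarrow> (g, p) \<in> R f"
      if g: "g \<in> Ar C" "Cod C g = Dom C f" "p \<in> P (Dom C g)" for g p
    proof -
      have fg: "f \<cdot> g \<in> Ar C" "Dom C (f \<cdot> g) = Dom C g" "Cod C (f \<cdot> g) = x"
        using comp_in_Ar[of g f] f g by auto
      have "(g, p) \<in> restrict f T \<longleftrightarrow> locally (Dom C g) (\<lambda>h. G (f \<cdot> g \<cdot> h) (r h p))"
        using f g fg by (simp add: restrict_def T_def)
      also have "\<dots> \<longleftrightarrow> locally (Dom C g) (\<lambda>h. True \<and> (g \<cdot> h, r h p) \<in> R f)"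
        using G_comp[OF f] assoc_Ar[of _ g f] comp_in_Ar[of _ g] f g by (intro locally_cong) simp
      also have "\<dots> \<longleftrightarrow> (g, p) \<in> R f"
        using germ_iff_locally[OF R[OF f] g, of "\<lambda>_. True"] locally_all[OF Dom_in_Ob[OF g(1)], of "\<lambda>_. True"]
        by simp
      finally show ?thesis .
    qed
    moreover have "g \<in> Ar C \<and> Cod C g = Dom C f \<and> p \<in> P (Dom C g)" if "(g, p) \<in> restrict f T" for g p
      using that f comp_in_Ar[of g f] by (auto simp: restrict_def T_def)
    ultimately have "z \<in> restrict f T \<longleftrightarrow> z \<in> R f" for z
      using germ_valid[OF R[OF f]] by (cases z) blast
    then show ?thesis
      by blast
  qed
  \<comment> \<open>On the cover \<open>Q\<close> a competitor \<open>T'\<close> is known through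
    its restrictions. Read at identities they are \<open>G\<close>, and
    \<open>germ_iff_locally\<close> recovers \<open>T'\<close> from them.\<close>
  moreover have "T' = T" if T': "germ x T'"
    and r': "\<forall>f\<in>Ar C. Cod C f = x \<longrightarrow> Q f \<longrightarrow> restrict f T' = R f" for T'
  proof -
    have "(f, p) \<in> T' \<longleftrightarrow> (f, p) \<in> T" if f: "f \<in> Ar C" "Cod C f = x" "p \<in> P (Dom C f)" for f p
    proof -
      have Qf: "locally (Dom C f) (\<lambda>g. Q (f \<cdot> g))"
        using locally_pull[of f Q] Q f by simp
      have "(f, p) \<in> T' \<longleftrightarrow> locally (Dom C f) (\<lambda>g. Q (f \<cdot> g) \<and> (f \<cdot> g, r g p) \<in> T')"
        using germ_iff_locally[OF T' f Qf] .
      also have "\<dots> \<longleftrightarrow> locally (Dom C f) (\<lambda>g. G (f \<cdot> g) (r g p))"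
      proof (rule locally_cong)
        fix g assume g: "g \<in> Ar C" "Cod C g = Dom C f"
        have fg: "f \<cdot> g \<in> Ar C" "Dom C (f \<cdot> g) = Dom C g" "Cod C (f \<cdot> g) = x"
          using comp_in_Ar[of g f] f g by auto
        have "(f \<cdot> g, q) \<in> T' \<longleftrightarrow> (Id C (Dom C g), q) \<in> restrict (f \<cdot> g) T'" for q
          using Id_in_Ar[OF Dom_in_Ob[OF g(1)]] unit_Ar(1)[OF fg(1)] fg by (simp add: restrict_def)
        then show "(Q (f \<cdot> g) \<and> (f \<cdot> g, r g p) \<in> T') = G (f \<cdot> g) (r g p)"
          using r' fg by (auto simp: G_def)
      qed
      finally show ?thesis
        using f by (simp add: T_def)
    qed
    moreover have "f \<in> Ar C \<and> Cod C f = x \<and> p \<in> P (Dom C f)" if "(f, p) \<in> T" for f p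
      using that by (simp add: T_def)
    ultimately have "z \<in> T' \<longleftrightarrow> z \<in> T" for z
      using germ_valid[OF T'] by (cases z) blast
    then show ?thesis
      by blast
  qed
  ultimately show ?thesis
    by (intro ex1I[of _ T] conjI ballI impI) blast+
qed

lemma germ_germ_of:
  assumes x: "x \<in> Ob C" and p: "p \<in> P x"
  shows "germ x (germ_of x p)"
proof -
  have rp: "r f p \<in> P (Dom C f)" if "f \<in> Ar C" "Cod C f = x" for f
    using r_in[of f p] that p by simp
  have rp2: "r (f \<cdot> g) p = r g (r f p)" if "f \<in> Ar C" "Cod C f = x" "g \<in> Ar C" "Cod C g = Dom C f" for f g
    using r_comp[of g f p] that p by simp
  show ?thesis
    unfolding germ_def
  proof (intro conjI allI impI, goal_cases)
    case (4 f q g)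
    then show ?case
      using E_res[of g "r f p" q] rp rp2 r_in[of g q] comp_in_Ar[of g f] by (auto simp: germ_of_def)
  next
    case (5 f q s)
    then show ?case
      using rp E_trans[of "Dom C f" "r f p" q s] E_sym[of "Dom C f" "r f p" q] E_trans[of "Dom C f" q "r f p" s]
      by (auto simp: germ_of_def Dom_in_Ob)
  next
    case (6 f q)
    have "locally (Dom C f) (\<lambda>g. E (Dom C g) (r g (r f p)) (r g q))"
    proof (subst locally_cong)
      fix g assume "g \<in> Ar C" "Cod C g = Dom C f"
      then show "E (Dom C g) (r g (r f p)) (r g q) = ((f \<cdot> g, r g q) \<in> germ_of x p)"
        using 6 rp2 comp_in_Ar[of g f] r_in[of g q] by (simp add: germ_of_def)
    qed fact
    then show ?case
      using 6 E_local[of "Dom C f" "r f p" q] rp by (simp add: germ_of_def Dom_in_Ob)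
  next
    case 7
    show ?case
      using rp E_refl by (intro locally_all x exI[of _ "r _ p"]) (auto simp: germ_of_def Dom_in_Ob)
  qed (auto simp: germ_of_def)
qed

lemma restrict_germ_of:
  assumes "f \<in> Ar C" and "p \<in> P (Cod C f)"
  shows "restrict f (germ_of (Cod C f) p) = germ_of (Dom C f) (r f p)"
  using assms comp_in_Ar[of _ f] r_comp[of _ f p] by (auto simp: restrict_def germ_of_def)

text \<open>For the forward direction both relations are read at the identity of
  \<open>x\<close>.\<close>

lemma germ_of_eq_iff:
  assumes x: "x \<in> Ob C" and p: "p \<in> P x" and q: "q \<in> P x"
  shows "germ_of x p = germ_of x q \<longleftrightarrow> E x p q"
proof
  assume "germ_of x p = germ_of x q"
  moreover have "(Id C x, q) \<in> germ_of x q"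
    using Id_in_Ar[OF x] r_Id[OF x q] q E_refl[OF x q] by (simp add: germ_of_def)
  ultimately have "(Id C x, q) \<in> germ_of x p"
    by simp
  then show "E x p q"
    using Id_in_Ar[OF x] r_Id[OF x p] by (simp add: germ_of_def)
next
  assume e: "E x p q"
  have "E (Dom C f) (r f p) s \<longleftrightarrow> E (Dom C f) (r f q) s"
    if f: "f \<in> Ar C" "Cod C f = x" "s \<in> P (Dom C f)" for f s
  proof -
    have "E (Dom C f) (r f p) (r f q)" "E (Dom C f) (r f q) (r f p)"
      using E_res[of f p q] E_res[of f q p] e p q f E_sym[OF x p q] by auto
    then show ?thesis
      using E_trans[of "Dom C f" "r f p" "r f q" s] E_trans[of "Dom C f" "r f q" "r f p" s]
        r_in[of f] p q f Dom_in_Ob by auto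
  qed
  then show "germ_of x p = germ_of x q"
    by (auto simp: germ_of_def)
qed

lemma restrict_eq_germ_of:
  assumes R: "germ x R" and f: "(f, p) \<in> R"
  shows "restrict f R = germ_of (Dom C f) p"
proof -
  have v: "f \<in> Ar C" "Cod C f = x" "p \<in> P (Dom C f)"
    using germ_valid[OF R f] by auto
  have "(g, q) \<in> restrict f R \<longleftrightarrow> (g, q) \<in> germ_of (Dom C f) p"
    if g: "g \<in> Ar C" "Cod C g = Dom C f" for g q
  proof -
    have "(f \<cdot> g, r g p) \<in> R"
      using germ_res[OF R f g] .
    from germ_single[OF R this, of q] germ_valid[OF R, of "f \<cdot> g" q]
    show ?thesis
      using g v comp_in_Ar[of g f] by (auto simp: restrict_def germ_of_def)
  qed
  then show ?thesis
    by (auto simp: restrict_def germ_of_def)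
qed

text \<open>Later arguments use the generated sheaf through these properties: the unit
  \<open>\<eta>\<close> is natural, identifies exactly along \<open>E\<close>, and is locally
  surjective. Universal properties are derived from them by gluing.\<close>

lemma generated_sheaf:
  assumes U: "strongly_inaccessible TYPE('u)" and Ar: "small TYPE('u) (Ar C)"
    and P: "\<And>x. x \<in> Ob C \<Longrightarrow> small TYPE('u) (P x)"
  obtains L :: "('c, 'd, 'u) psh" and \<eta> :: "'c \<Rightarrow> 'p \<Rightarrow> 'u" where "sheaf C J L"
    and "\<And>x p. x \<in> Ob C \<Longrightarrow> p \<in> P x \<Longrightarrow> \<eta> x p \<in> sec L x"
    and "\<And>f p. f \<in> Ar C \<Longrightarrow> p \<in> P (Cod C f) \<Longrightarrow> res L f (\<eta> (Cod C f) p) = \<eta> (Dom C f) (r f p)"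
    and "\<And>x p q. x \<in> Ob C \<Longrightarrow> p \<in> P x \<Longrightarrow> q \<in> P x \<Longrightarrow> \<eta> x p = \<eta> x q \<longleftrightarrow> E x p q"
    and "\<And>x a. x \<in> Ob C \<Longrightarrow> a \<in> sec L x \<Longrightarrow> locally x (\<lambda>f. \<exists>p\<in>P (Dom C f). res L f a = \<eta> (Dom C f) p)"
proof -
  \<comment> \<open>Every germ is a subset of the one small set \<open>V\<close>, so an injection of
    \<open>Pow V\<close> into \<open>'u\<close> codes all germs over all objects at once.\<close>
  define V where "V = (SIGMA f:Ar C. P (Dom C f))"
  have "small TYPE('u) (Pow V)"
    unfolding V_def using U Ar P by (intro small_Pow small_Sigma) (auto simp: Dom_in_Ob)
  then obtain e :: "('d \<times> 'p) set \<Rightarrow> 'u" where e: "inj_on e (Pow V)"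
    by (rule small_obtains_inj)
  define d where "d = inv_into (Pow V) e"
  have dV: "d (e R) = R" if "R \<subseteq> V" for R
    using e that by (simp add: d_def)
  have V: "germ x R \<Longrightarrow> R \<subseteq> V" for x R
    using germ_valid by (auto simp: V_def)
  have de: "d (e R) = R" if "germ x R" for x R
    using dV V that by blast
  define L :: "('c, 'd, 'u) psh"
    where "L = \<lparr>sec = \<lambda>x. e ` {R. germ x R}, res = \<lambda>f u. e (restrict f (d u))\<rparr>"
  have secI: "germ x R \<Longrightarrow> e R \<in> sec L x" for x R
    by (simp add: L_def)
  have secE: "germ x (d a)" "e (d a) = a" if "a \<in> sec L x" for a x
    using that de by (auto simp: L_def)
  have resL: "res L f (e R) = e (restrict f R)" if "germ x R" for f x R
    using de[OF that] by (simp add: L_def)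
  have "presheaf C L"
    unfolding presheaf_def
  proof (intro conjI ballI impI, goal_cases)
    case (1 x)
    have "sec L x \<subseteq> e ` Pow V"
      using V by (auto simp: L_def)
    then show ?case
      using small_image[OF \<open>small TYPE('u) (Pow V)\<close>] small_subset by blast
  next
    case (2 f s)
    then show ?case
      using secE[OF 2(2)] secI germ_restrict[OF _ 2(1)] resL by metis
  next
    case (3 x s)
    then show ?case
      using secE[OF 3(2)] restrict_Id resL by metis
  next
    case (4 f g s)
    have "res L (g \<cdot> f) s = e (restrict f (restrict g (d s)))"
      using 4 by (simp add: L_def restrict_comp)
    also have "\<dots> = res L f (res L g s)"
      using resL[OF germ_restrict[OF secE(1)[OF 4(4)] 4(2)], of f] by (simp add: L_def)
    finally show ?case .
  qed
  moreover have "\<exists>!a. a \<in> sec L x \<and> (\<forall>f\<in>S. res L f a = s f)"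
    if x: "x \<in> Ob C" and S: "S \<in> J x" and s: "matching_family C L S s" for x S s
  proof -
    have "sieve C x S"
      using topology x S by (simp add: grothendieck_topology_def)
    then have sv: "S \<subseteq> {f \<in> Ar C. Cod C f = x}"
      by (simp add: sieve_def)
    then have S': "{f \<in> Ar C. Cod C f = x \<and> f \<in> S} = S"
      by auto
    then have "locally x (\<lambda>f. f \<in> S)"
      using S by (simp add: locally_def)
    have ss: "f \<in> S \<Longrightarrow> s f \<in> sec L (Dom C f)" for f
      using s by (simp add: matching_family_def)
    have "\<exists>!T. germ x T \<and> (\<forall>f\<in>Ar C. Cod C f = x \<longrightarrow> f \<in> S \<longrightarrow> restrict f T = d (s f))"
    proof (rule germ_glue[OF \<open>locally x (\<lambda>f. f \<in> S)\<close> x])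
      fix f g assume f: "f \<in> Ar C" "Cod C f = x" "f \<in> S" and g: "g \<in> Ar C" "Cod C g = Dom C f"
      have "s (f \<cdot> g) = res L g (s f)"
        using s f g by (simp add: matching_family_def)
      also have "\<dots> = e (restrict g (d (s f)))"
        by (simp add: L_def)
      finally show "d (s (f \<cdot> g)) = restrict g (d (s f))"
        using de[OF germ_restrict[of g "d (s f)"]] secE(1)[OF ss[OF f(3)]] g by simp
    qed (use secE(1) ss in auto)
    moreover have "(\<forall>f\<in>Ar C. Cod C f = x \<longrightarrow> f \<in> S \<longrightarrow> A f) \<longleftrightarrow> (\<forall>f\<in>S. A f)" for A
      using sv by blast
    ultimately have ex: "\<exists>!T. germ x T \<and> (\<forall>f\<in>S. restrict f T = d (s f))"
      by simp
    then obtain T where T: "germ x T" "\<forall>f\<in>S. restrict f T = d (s f)"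
      by blast
    show ?thesis
    proof (rule ex1I[of _ "e T"])
      show "e T \<in> sec L x \<and> (\<forall>f\<in>S. res L f (e T) = s f)"
        using T secI resL secE(2)[OF ss] by simp
      fix a assume a: "a \<in> sec L x \<and> (\<forall>f\<in>S. res L f a = s f)"
      have "restrict f (d a) = d (s f)" if "f \<in> S" for f
      proof -
        have f: "f \<in> Ar C" "Cod C f = x"
          using sv that by auto
        have "e (restrict f (d a)) = s f"
          using a that by (simp add: L_def)
        then show ?thesis
          using de[OF germ_restrict[of f "d a"]] secE(1)[of a x] a f by simp
      qed
      then have "d a = T"
        using ex T secE(1)[of a x] a by blast
      then show "a = e T"
        using secE(2)[of a x] a by simp
    qed
  qed
  ultimately have "sheaf C J L"
    unfolding sheaf_def by blast
  moreover have "res L f (e (germ_of (Cod C f) p)) = e (germ_of (Dom C f) (r f p))"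
    if "f \<in> Ar C" "p \<in> P (Cod C f)" for f p
    using resL[OF germ_germ_of] restrict_germ_of that Cod_in_Ob by simp
  moreover have "e (germ_of x p) = e (germ_of x q) \<longleftrightarrow> E x p q"
    if "x \<in> Ob C" "p \<in> P x" "q \<in> P x" for x p q
    using de[OF germ_germ_of[OF that(1,2)]] de[OF germ_germ_of[OF that(1,3)]] germ_of_eq_iff[OF that] by metis
  moreover have "locally x (\<lambda>f. \<exists>p\<in>P (Dom C f). res L f a = e (germ_of (Dom C f) p))"
    if x: "x \<in> Ob C" and a: "a \<in> sec L x" for x a
  proof (rule locally_mono[OF germ_total[OF secE(1)[OF a]] x])
    fix f assume f: "f \<in> Ar C" "Cod C f = x"
    {
      assume "\<exists>p. (f, p) \<in> d a"
      then obtain p where p: "(f, p) \<in> d a"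
        by blast
      show "\<exists>p\<in>P (Dom C f). res L f a = e (germ_of (Dom C f) p)"
        using restrict_eq_germ_of[OF secE(1)[OF a] p] germ_valid[OF secE(1)[OF a] p]
        by (auto simp: L_def)
    }
    fix g assume g: "g \<in> Ar C" "Cod C g = Dom C f" and "\<exists>p\<in>P (Dom C f). res L f a = e (germ_of (Dom C f) p)"
    then obtain p where p: "p \<in> P (Dom C f)" "res L f a = e (germ_of (Dom C f) p)"
      by blast
    have "res L (f \<cdot> g) a = res L g (res L f a)"
      using \<open>presheaf C L\<close> f g a by (simp add: presheaf_def)
    also have "\<dots> = e (germ_of (Dom C g) (r g p))"
      using resL[OF germ_germ_of[OF Dom_in_Ob[OF f(1)] p(1)], of g] restrict_germ_of[of g p] g p by simp
    finally show "\<exists>p\<in>P (Dom C (f \<cdot> g)). res L (f \<cdot> g) a = e (germ_of (Dom C (f \<cdot> g)) p)"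
      using r_in[of g p] p g comp_in_Ar[of g f] f by auto
  qed
  ultimately show thesis
    using secI germ_germ_of by (intro that[of L "\<lambda>x p. e (germ_of x p)"]) auto
qed

end

section \<open>Sections of the objects of a topos\<close>

context category
begin

lemma hom_Ob: "f \<in> hom C X Y \<Longrightarrow> X \<in> Ob C \<and> Y \<in> Ob C"
  using Dom_in_Ob Cod_in_Ob by (auto simp: hom_def)

lemma iso_inverse:
  assumes "iso C f" and "f \<in> hom C X Y"
  obtains g where "g \<in> hom C Y X" and "g \<cdot> f = Id C X" and "f \<cdot> g = Id C Y"
  using assms by (auto simp: iso_def hom_def)

lemma isoI:
  assumes "f \<in> hom C X Y" and "g \<in> hom C Y X" and "g \<cdot> f = Id C X" and "f \<cdot> g = Id C Y"
  shows "iso C f"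
  using assms by (auto simp: iso_def hom_def)

lemma iso_cancel_left:
  assumes e: "iso C e" "e \<in> hom C Y Z" and f: "f \<in> hom C X Y" and g: "g \<in> hom C X Y" and eq: "e \<cdot> f = e \<cdot> g"
  shows "f = g"
proof -
  obtain d where d: "d \<in> hom C Z Y" "d \<cdot> e = Id C Y"
    using iso_inverse[OF e] by blast
  have "d \<cdot> e \<cdot> f = d \<cdot> e \<cdot> g"
    using Comp_assoc[OF f e(2) d(1)] Comp_assoc[OF g e(2) d(1)] eq by simp
  then show ?thesis
    using d Id_Comp[OF f] Id_Comp[OF g] by simp
qed

lemma iso_cancel_right:
  assumes e: "iso C e" "e \<in> hom C X Y" and f: "f \<in> hom C Y Z" and g: "g \<in> hom C Y Z" and eq: "f \<cdot> e = g \<cdot> e"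
  shows "f = g"
proof -
  obtain d where d: "d \<in> hom C Y X" "e \<cdot> d = Id C Y"
    using iso_inverse[OF e] by blast
  have "f \<cdot> (e \<cdot> d) = g \<cdot> (e \<cdot> d)"
    using Comp_assoc[OF d(1) e(2) f] Comp_assoc[OF d(1) e(2) g] eq by simp
  then show ?thesis
    using d Comp_Id[OF f] Comp_Id[OF g] by simp
qed

end

lemma functor_hom:
  assumes "functor C D F" and "f \<in> hom C X Y"
  shows "amap F f \<in> hom D (omap F X) (omap F Y)"
  using assms by (auto simp: functor_def hom_def)

lemma functor_comp:
  assumes "functor C D F" and "f \<in> hom C X Y" and "g \<in> hom C Y Z"
  shows "amap F (g \<cdot>\<^bsub>C\<^esub> f) = amap F g \<cdot>\<^bsub>D\<^esub> amap F f"
  using assms by (auto simp: functor_def hom_def)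

text \<open>\<open>\<eta>\<close> makes \<open>F\<close> faithful and \<open>\<epsilon>\<close>
  makes \<open>G\<close> faithful. Fullness of \<open>F\<close> rests on the latter: a candidate
  preimage is compared with \<open>a\<close> after applying \<open>G\<close>.\<close>

lemma equivalence_fully_faithful:
  assumes "category C" and "category D" and "equivalent_categories C D"
  obtains F where "functor C D F"
    and "\<And>X Y f g. f \<in> hom C X Y \<Longrightarrow> g \<in> hom C X Y \<Longrightarrow> amap F f = amap F g \<Longrightarrow> f = g"
    and "\<And>X Y a. X \<in> Ob C \<Longrightarrow> Y \<in> Ob C \<Longrightarrow> a \<in> hom D (omap F X) (omap F Y) \<Longrightarrow>
      \<exists>f\<in>hom C X Y. amap F f = a"
    and "\<And>Z. Z \<in> Ob D \<Longrightarrow> \<exists>X\<in>Ob C. \<exists>e\<in>hom D (omap F X) Z. iso D e"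
proof -
  interpret C: category C by fact
  interpret D: category D by fact
  obtain F G \<eta> \<epsilon> where F: "functor C D F" and G: "functor D C G"
    and \<eta>: "\<And>X. X \<in> Ob C \<Longrightarrow> \<eta> X \<in> hom C X (omap G (omap F X)) \<and> iso C (\<eta> X)"
    and \<eta>n: "\<And>f. f \<in> Ar C \<Longrightarrow> \<eta> (Cod C f) \<cdot>\<^bsub>C\<^esub> f = amap G (amap F f) \<cdot>\<^bsub>C\<^esub> \<eta> (Dom C f)"
    and \<epsilon>: "\<And>Z. Z \<in> Ob D \<Longrightarrow> \<epsilon> Z \<in> hom D (omap F (omap G Z)) Z \<and> iso D (\<epsilon> Z)"
    and \<epsilon>n: "\<And>a. a \<in> Ar D \<Longrightarrow> \<epsilon> (Cod D a) \<cdot>\<^bsub>D\<^esub> amap F (amap G a) = a \<cdot>\<^bsub>D\<^esub> \<epsilon> (Dom D a)"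
    using assms(3) unfolding equivalent_categories_def naturally_isomorphic_def id_functor_def comp_functor_def
    by (elim exE conjE, intro that) auto
  have faithful: "f = g" if f: "f \<in> hom C X Y" and g: "g \<in> hom C X Y"
    and eq: "amap G (amap F f) = amap G (amap F g)" for X Y f g
  proof -
    have "X \<in> Ob C" "Y \<in> Ob C"
      using C.hom_Ob[OF f] by auto
    moreover have "\<eta> Y \<cdot>\<^bsub>C\<^esub> f = \<eta> Y \<cdot>\<^bsub>C\<^esub> g"
      using \<eta>n[of f] \<eta>n[of g] f g eq by (auto simp: hom_def)
    ultimately show ?thesis
      using C.iso_cancel_left[of "\<eta> Y"] \<eta> f g by blast
  qed
  have G_faithful: "a = b" if a: "a \<in> hom D X Y" and b: "b \<in> hom D X Y" and eq: "amap G a = amap G b" for X Y a b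
  proof -
    have "X \<in> Ob D" "Y \<in> Ob D"
      using D.hom_Ob[OF a] by auto
    moreover have "a \<cdot>\<^bsub>D\<^esub> \<epsilon> X = b \<cdot>\<^bsub>D\<^esub> \<epsilon> X"
      using \<epsilon>n[of a] \<epsilon>n[of b] a b eq by (auto simp: hom_def)
    ultimately show ?thesis
      using D.iso_cancel_right[of "\<epsilon> X"] \<epsilon> a b by blast
  qed
  have full: "\<exists>f\<in>hom C X Y. amap F f = a"
    if X: "X \<in> Ob C" and Y: "Y \<in> Ob C" and a: "a \<in> hom D (omap F X) (omap F Y)" for X Y a
  proof -
    obtain k where k: "k \<in> hom C (omap G (omap F Y)) Y" "\<eta> Y \<cdot>\<^bsub>C\<^esub> k = Id C (omap G (omap F Y))"
      using C.iso_inverse[of "\<eta> Y"] \<eta>[OF Y] by blast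
    have Ga: "amap G a \<in> hom C (omap G (omap F X)) (omap G (omap F Y))"
      using functor_hom[OF G a] .
    have GX: "amap G a \<cdot>\<^bsub>C\<^esub> \<eta> X \<in> hom C X (omap G (omap F Y))"
      using C.Comp_in_hom[OF _ Ga] \<eta>[OF X] by blast
    \<comment> \<open>Here \<open>k\<close> inverts \<open>\<eta> Y\<close>, so \<open>f\<close> is
      \<open>G a\<close> conjugated by \<open>\<eta>\<close>: the only choice compatible with
      naturality of \<open>\<eta>\<close>.\<close>
    define f where "f = k \<cdot>\<^bsub>C\<^esub> (amap G a \<cdot>\<^bsub>C\<^esub> \<eta> X)"
    have f: "f \<in> hom C X Y"
      using C.Comp_in_hom[OF GX k(1)] by (simp add: f_def)
    have "\<eta> Y \<cdot>\<^bsub>C\<^esub> f = amap G a \<cdot>\<^bsub>C\<^esub> \<eta> X"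
      using C.Comp_assoc[OF GX k(1), of "\<eta> Y" "omap G (omap F Y)"] \<eta>[OF Y] k(2) C.Id_Comp[OF GX] by (simp add: f_def)
    moreover have "\<eta> Y \<cdot>\<^bsub>C\<^esub> f = amap G (amap F f) \<cdot>\<^bsub>C\<^esub> \<eta> X"
      using \<eta>n[of f] f by (auto simp: hom_def)
    ultimately have "amap G (amap F f) = amap G a"
      using C.iso_cancel_right[of "\<eta> X" _ _ "amap G (amap F f)"] \<eta>[OF X] functor_hom[OF G functor_hom[OF F f]] Ga
      by metis
    then have "amap F f = a"
      using G_faithful functor_hom[OF F f] a by blast
    with f show ?thesis
      by blast
  qed
  have ess: "\<exists>X\<in>Ob C. \<exists>e\<in>hom D (omap F X) Z. iso D e" if "Z \<in> Ob D" for Z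
    using \<epsilon>[OF that] G that by (auto simp: functor_def)
  show thesis
  proof (rule that[OF F])
    show "f = g" if "f \<in> hom C X Y" "g \<in> hom C X Y" "amap F f = amap F g" for X Y f g
      using faithful that by simp
  qed (use full ess in blast)+
qed

text \<open>
  A topos presented by a fully faithful and essentially surjective functor to sheaves on a site:
  \<open>Sec X\<close> is the sheaf of sections of the object \<open>X\<close> and \<open>act f\<close> the action of the arrow \<open>f\<close>.
\<close>

locale presented_topos = site C J + E: category E
  for C :: "('c, 'd) cat" and J :: "'c \<Rightarrow> 'd set set" and E :: "('o, 'a) cat" (structure) +
  fixes Sec :: "'o \<Rightarrow> ('c, 'd, 'u) psh" and act :: "'a \<Rightarrow> 'c \<Rightarrow> 'u \<Rightarrow> 'u"
  assumes inaccessible: "strongly_inaccessible TYPE('u)"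
    and small_Ob: "small TYPE('u) (Ob C)"
    and small_Ar: "small TYPE('u) (Ar C)"
    and Sec_sheaf: "X \<in> Ob E \<Longrightarrow> sheaf C J (Sec X)"
    and act_hom: "f \<in> hom E X Y \<Longrightarrow> presheaf_hom C (Sec X) (Sec Y) (act f)"
    and act_Id: "X \<in> Ob E \<Longrightarrow> x \<in> Ob C \<Longrightarrow> s \<in> sec (Sec X) x \<Longrightarrow> act (Id E X) x s = s"
    and act_comp: "f \<in> hom E X Y \<Longrightarrow> g \<in> hom E Y Z \<Longrightarrow> x \<in> Ob C \<Longrightarrow> s \<in> sec (Sec X) x \<Longrightarrow>
      act (g \<cdot> f) x s = act g x (act f x s)"
    and faithful: "f \<in> hom E X Y \<Longrightarrow> g \<in> hom E X Y \<Longrightarrow>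
      (\<And>x s. x \<in> Ob C \<Longrightarrow> s \<in> sec (Sec X) x \<Longrightarrow> act f x s = act g x s) \<Longrightarrow> f = g"
    and full: "X \<in> Ob E \<Longrightarrow> Y \<in> Ob E \<Longrightarrow> presheaf_hom C (Sec X) (Sec Y) \<phi> \<Longrightarrow> \<exists>f\<in>hom E X Y. act f = \<phi>"
    and essentially_surjective: "sheaf C J L \<Longrightarrow> \<exists>X\<in>Ob E. \<exists>\<phi> \<psi>.
      presheaf_hom C L (Sec X) \<phi> \<and> presheaf_hom C (Sec X) L \<psi> \<and>
      (\<forall>x\<in>Ob C. (\<forall>s\<in>sec L x. \<psi> x (\<phi> x s) = s) \<and> (\<forall>s\<in>sec (Sec X) x. \<phi> x (\<psi> x s) = s))"

lemma presheaf_hom_ext: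
  assumes "presheaf_hom C F G \<phi>" and "presheaf_hom C F G \<psi>"
    and "\<And>x s. x \<in> Ob C \<Longrightarrow> s \<in> sec F x \<Longrightarrow> \<phi> x s = \<psi> x s"
  shows "\<phi> = \<psi>"
proof (intro ext)
  fix x s
  show "\<phi> x s = \<psi> x s"
    using assms unfolding presheaf_hom_def by (cases "x \<in> Ob C \<and> s \<in> sec F x") auto
qed

lemma sheaf_cat_hom:
  "a \<in> hom (sheaf_cat C J) F G \<longleftrightarrow>
    (\<exists>\<phi>. a = (F, G, \<phi>) \<and> sheaf C J F \<and> sheaf C J G \<and> presheaf_hom C F G \<phi>)"
  by (auto simp: sheaf_cat_def hom_def)

lemma grothendieck_topos_presented:
  fixes E :: "('o, 'a) cat"
  assumes U: "strongly_inaccessible TYPE('u)" and E: "grothendieck_topos TYPE('u) E"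
  obtains C :: "('u, 'u) cat" and J and Sec :: "'o \<Rightarrow> ('u, 'u, 'u) psh" and act
  where "presented_topos C J E Sec act"
proof -
  obtain C :: "('u, 'u) cat" and J where C: "small_category TYPE('u) C" and J: "grothendieck_topology C J"
    and eq: "equivalent_categories E (sheaf_cat C J :: (('u, 'u, 'u) psh, ('u, 'u, 'u) psh_arrow) cat)"
    and catE: "category E"
    using E unfolding grothendieck_topos_def by auto
  let ?S = "sheaf_cat C J :: (('u, 'u, 'u) psh, ('u, 'u, 'u) psh_arrow) cat"
  have catC: "category C"
    using C by (simp add: small_category_def)
  interpret E: category E by fact
  interpret C: category C by fact
  interpret S: category ?S
    using catC by (rule category_sheaf_cat)
  obtain F where F: "functor E ?S F"
    and faithful: "\<And>X Y f g. f \<in> hom E X Y \<Longrightarrow> g \<in> hom E X Y \<Longrightarrow> amap F f = amap F g \<Longrightarrow> f = g"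
    and full: "\<And>X Y a. X \<in> Ob E \<Longrightarrow> Y \<in> Ob E \<Longrightarrow> a \<in> hom ?S (omap F X) (omap F Y) \<Longrightarrow>
      \<exists>f\<in>hom E X Y. amap F f = a"
    and ess: "\<And>Z. Z \<in> Ob ?S \<Longrightarrow> \<exists>X\<in>Ob E. \<exists>e\<in>hom ?S (omap F X) Z. iso ?S e"
    by (rule equivalence_fully_faithful[OF catE S.category_axioms eq]) (rule that)
  define act where "act f = snd (snd (amap F f))" for f
  have sh: "sheaf C J (omap F X)" if "X \<in> Ob E" for X
  proof -
    have "omap F X \<in> Ob ?S"
      using F that unfolding functor_def by blast
    then show ?thesis
      by (simp add: sheaf_cat_def)
  qed
  have amap: "amap F f = (omap F X, omap F Y, act f) \<and> presheaf_hom C (omap F X) (omap F Y) (act f)"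
    if "f \<in> hom E X Y" for f X Y
    using functor_hom[OF F that] by (auto simp: act_def sheaf_cat_hom)
  have "presented_topos C J E (omap F) act"
  proof (unfold_locales, goal_cases)
    case (6 f X Y)
    then show ?case
      using amap by blast
  next
    case (7 X x s)
    have "amap F (Id E X) = Id ?S (omap F X)"
      using F 7 by (simp add: functor_def)
    then show ?case
      using 7 by (simp add: act_def sheaf_cat_def)
  next
    case (8 f X Y g Z x s)
    have "amap F (g \<cdot>\<^bsub>E\<^esub> f) = amap F g \<cdot>\<^bsub>?S\<^esub> amap F f"
      using functor_comp[OF F 8(1,2)] .
    also have "\<dots> = (omap F X, omap F Z,
        \<lambda>x s. if x \<in> Ob C \<and> s \<in> sec (omap F X) x then act g x (act f x s) else undefined)"
      using amap[OF 8(1)] amap[OF 8(2)] by (simp add: sheaf_cat_def)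
    finally show ?case
      using 8 by (simp add: act_def)
  next
    case (9 f X Y g)
    have "act f = act g"
      using amap[OF 9(1)] amap[OF 9(2)] 9(3) by (blast intro: presheaf_hom_ext)
    then show ?case
      using faithful[OF 9(1,2)] amap[OF 9(1)] amap[OF 9(2)] by simp
  next
    case (10 X Y \<phi>)
    have "(omap F X, omap F Y, \<phi>) \<in> hom ?S (omap F X) (omap F Y)"
      using 10 sh by (simp add: sheaf_cat_hom)
    then obtain f where "f \<in> hom E X Y" "amap F f = (omap F X, omap F Y, \<phi>)"
      using full 10 by blast
    then show ?case
      by (intro bexI[of _ f]) (simp_all add: act_def)
  next
    case (11 L)
    obtain X e where X: "X \<in> Ob E" and e: "e \<in> hom ?S (omap F X) L" "iso ?S e"
      using ess[of L] 11 by (auto simp: sheaf_cat_def)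
    obtain d where d: "d \<in> hom ?S L (omap F X)" "d \<cdot>\<^bsub>?S\<^esub> e = Id ?S (omap F X)" "e \<cdot>\<^bsub>?S\<^esub> d = Id ?S L"
      using S.iso_inverse[OF e(2,1)] by blast
    obtain \<phi> \<psi> where \<phi>: "d = (L, omap F X, \<phi>)" "presheaf_hom C L (omap F X) \<phi>"
      and \<psi>: "e = (omap F X, L, \<psi>)" "presheaf_hom C (omap F X) L \<psi>"
      using d(1) e(1) by (auto simp: sheaf_cat_hom)
    have "\<psi> x (\<phi> x s) = s" if "x \<in> Ob C" "s \<in> sec L x" for x s
      using d(3) that unfolding \<phi> \<psi> by (simp add: sheaf_cat_def fun_eq_iff) metis
    moreover have "\<phi> x (\<psi> x s) = s" if "x \<in> Ob C" "s \<in> sec (omap F X) x" for x s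
      using d(2) that unfolding \<phi> \<psi> by (simp add: sheaf_cat_def fun_eq_iff) metis
    ultimately show ?case
      using X \<phi> \<psi> by blast
  qed (use C J U sh in \<open>auto simp: small_category_def\<close>)
  then show thesis
    by (rule that)
qed

section \<open>Colimits computed on sections\<close>

lemma set_colimit_rel_refl: "(a, a) \<in> set_colimit_rel S T t"
  by (simp add: set_colimit_rel_def Let_def)

lemma set_colimit_rel_sym:
  assumes "(a, b) \<in> set_colimit_rel S T t"
  shows "(b, a) \<in> set_colimit_rel S T t"
proof -
  have "sym (set_colimit_rel S T t)"
    unfolding set_colimit_rel_def Let_def by (intro sym_rtrancl) (simp add: sym_Un_converse)
  then show ?thesis
    using assms by (rule symD)
qed

lemma set_colimit_rel_trans:
  "(a, b) \<in> set_colimit_rel S T t \<Longrightarrow> (b, c) \<in> set_colimit_rel S T t \<Longrightarrow> (a, c) \<in> set_colimit_rel S T t"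
  unfolding set_colimit_rel_def Let_def by (rule rtrancl_trans)

lemma set_colimit_rel_step:
  "u \<in> Ar S \<Longrightarrow> x \<in> T (Dom S u) \<Longrightarrow> ((Dom S u, x), (Cod S u, t u x)) \<in> set_colimit_rel S T t"
  unfolding set_colimit_rel_def Let_def by blast

text \<open>Symmetry is a separate case, so a generating step has to be checked in one direction
  only. The \<open>refl\<close> case ranges over all pairs, also those outside the diagram.\<close>

lemma set_colimit_rel_induct [consumes 1, case_names refl step trans sym]:
  assumes "(a, b) \<in> set_colimit_rel S T t"
    and refl: "\<And>a. Q a a"
    and step: "\<And>u x. u \<in> Ar S \<Longrightarrow> x \<in> T (Dom S u) \<Longrightarrow> Q (Dom S u, x) (Cod S u, t u x)"
    and trans: "\<And>a b c. Q a b \<Longrightarrow> Q b c \<Longrightarrow> Q a c"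
    and sym: "\<And>a b. Q a b \<Longrightarrow> Q b a"
  shows "Q a b"
  using assms(1) unfolding set_colimit_rel_def Let_def
proof (induction rule: rtrancl_induct)
  case (step b c)
  then have "Q b c"
    by (auto intro: assms(3) assms(3)[THEN sym])
  with step show ?case
    using trans by blast
qed (rule refl)

lemma (in category) colimit_unique:
  assumes c: "colimit S C D X c" and c': "colimit S C D X' c'"
  obtains h k where "h \<in> hom C X X'" and "k \<in> hom C X' X" and "k \<cdot> h = Id C X" and "h \<cdot> k = Id C X'"
    and "\<And>i. i \<in> Ob S \<Longrightarrow> h \<cdot> c i = c' i" and "\<And>i. i \<in> Ob S \<Longrightarrow> k \<cdot> c' i = c i"
proof -
  have cc: "cocone S C D X c" "cocone S C D X' c'"
    using assms by (auto simp: colimit_def)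
  obtain h where h: "h \<in> hom C X X'" "\<And>i. i \<in> Ob S \<Longrightarrow> h \<cdot> c i = c' i"
    using c cc unfolding colimit_def by blast
  obtain k where k: "k \<in> hom C X' X" "\<And>i. i \<in> Ob S \<Longrightarrow> k \<cdot> c' i = c i"
    using c' cc unfolding colimit_def by blast
  have X: "X \<in> Ob C" "X' \<in> Ob C"
    using cc by (auto simp: cocone_def)
  have ci: "i \<in> Ob S \<Longrightarrow> c i \<in> hom C (omap D i) X" "i \<in> Ob S \<Longrightarrow> c' i \<in> hom C (omap D i) X'" for i
    using cc by (auto simp: cocone_def)
  have "k \<cdot> h \<in> hom C X X \<and> (\<forall>i\<in>Ob S. k \<cdot> h \<cdot> c i = c i)"
    using Comp_in_hom[OF h(1) k(1)] Comp_assoc[OF ci(1) h(1) k(1)] h k by auto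
  moreover have "Id C X \<in> hom C X X \<and> (\<forall>i\<in>Ob S. Id C X \<cdot> c i = c i)"
    using Id_in_hom X Id_Comp[OF ci(1)] by auto
  ultimately have 1: "k \<cdot> h = Id C X"
    using c cc(1) unfolding colimit_def by blast
  have "h \<cdot> k \<in> hom C X' X' \<and> (\<forall>i\<in>Ob S. h \<cdot> k \<cdot> c' i = c' i)"
    using Comp_in_hom[OF k(1) h(1)] Comp_assoc[OF ci(2) k(1) h(1)] h k by auto
  moreover have "Id C X' \<in> hom C X' X' \<and> (\<forall>i\<in>Ob S. Id C X' \<cdot> c' i = c' i)"
    using Id_in_hom X Id_Comp[OF ci(2)] by auto
  ultimately have "h \<cdot> k = Id C X'"
    using c' cc(2) unfolding colimit_def by blast
  with 1 show thesis
    using that h k by blast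
qed

lemma
  assumes "presheaf_hom C F G \<phi>"
  shows presheaf_hom_sec: "x \<in> Ob C \<Longrightarrow> s \<in> sec F x \<Longrightarrow> \<phi> x s \<in> sec G x"
    and presheaf_hom_res: "h \<in> Ar C \<Longrightarrow> s \<in> sec F (Cod C h) \<Longrightarrow> \<phi> (Dom C h) (res F h s) = res G h (\<phi> (Cod C h) s)"
  using assms by (simp_all add: presheaf_hom_def)

context presented_topos
begin

abbreviation sect :: "'o \<Rightarrow> 'c \<Rightarrow> 'u set"
  where "sect X \<equiv> sec (Sec X)"

abbreviation rest :: "'o \<Rightarrow> 'd \<Rightarrow> 'u \<Rightarrow> 'u"
  where "rest X \<equiv> res (Sec X)"

lemma act_sect: "f \<in> hom E X Y \<Longrightarrow> x \<in> Ob C \<Longrightarrow> s \<in> sect X x \<Longrightarrow> act f x s \<in> sect Y x"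
  by (rule presheaf_hom_sec[OF act_hom])

lemma act_rest:
  "f \<in> hom E X Y \<Longrightarrow> h \<in> Ar C \<Longrightarrow> s \<in> sect X (Cod C h) \<Longrightarrow>
    act f (Dom C h) (rest X h s) = rest Y h (act f (Cod C h) s)"
  by (rule presheaf_hom_res[OF act_hom])

lemma rest_sect: "X \<in> Ob E \<Longrightarrow> h \<in> Ar C \<Longrightarrow> s \<in> sect X (Cod C h) \<Longrightarrow> rest X h s \<in> sect X (Dom C h)"
  by (rule res_in_sec[OF Sec_sheaf])

lemma rest_comp:
  "X \<in> Ob E \<Longrightarrow> h \<in> Ar C \<Longrightarrow> k \<in> Ar C \<Longrightarrow> Cod C h = Dom C k \<Longrightarrow> s \<in> sect X (Cod C k) \<Longrightarrow>
    rest X (k \<cdot>\<^bsub>C\<^esub> h) s = rest X h (rest X k s)"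
  by (rule res_comp[OF Sec_sheaf])

lemma rest_Id: "X \<in> Ob E \<Longrightarrow> x \<in> Ob C \<Longrightarrow> s \<in> sect X x \<Longrightarrow> rest X (Id C x) s = s"
  by (rule res_Id[OF Sec_sheaf])

lemma sect_separated:
  "X \<in> Ob E \<Longrightarrow> locally x (\<lambda>h. rest X h s = rest X h t) \<Longrightarrow> x \<in> Ob C \<Longrightarrow> s \<in> sect X x \<Longrightarrow> t \<in> sect X x \<Longrightarrow>
    s = t"
  by (rule sheaf_separated[OF Sec_sheaf])

text \<open>Fullness turns the glued morphism of sheaves into an arrow of \<open>E\<close>.
  Comparison arrows out of colimits, lifts, and arrows between atoms are all obtained from such a
  locally defined graph on sections.\<close>

lemma glue_arrow:
  assumes "X \<in> Ob E" and "Y \<in> Ob E"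
    and "\<And>x a b. x \<in> Ob C \<Longrightarrow> R x a b \<Longrightarrow> a \<in> sect X x \<and> b \<in> sect Y x"
    and "\<And>h a b. h \<in> Ar C \<Longrightarrow> R (Cod C h) a b \<Longrightarrow> R (Dom C h) (rest X h a) (rest Y h b)"
    and "\<And>x a b b'. x \<in> Ob C \<Longrightarrow> R x a b \<Longrightarrow> R x a b' \<Longrightarrow> b = b'"
    and "\<And>x a. x \<in> Ob C \<Longrightarrow> a \<in> sect X x \<Longrightarrow> locally x (\<lambda>h. \<exists>b. R (Dom C h) (rest X h a) b)"
  obtains f where "f \<in> hom E X Y" and "\<And>x a b. x \<in> Ob C \<Longrightarrow> R x a b \<Longrightarrow> act f x a = b"
proof -
  obtain \<phi> where \<phi>: "presheaf_hom C (Sec X) (Sec Y) \<phi>" "\<And>x a b. x \<in> Ob C \<Longrightarrow> R x a b \<Longrightarrow> \<phi> x a = b"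
    by (rule glue_hom[OF Sec_sheaf[OF assms(1)] Sec_sheaf[OF assms(2)], of R]) ((rule assms(3-6), assumption+)+, rule that)
  then show thesis
    using full[OF assms(1,2) \<phi>(1)] that by blast
qed

lemma arrow_of_sections:
  assumes "X \<in> Ob E" and "Y \<in> Ob E"
    and "\<And>x s. x \<in> Ob C \<Longrightarrow> s \<in> sect X x \<Longrightarrow> m x s \<in> sect Y x"
    and "\<And>h s. h \<in> Ar C \<Longrightarrow> s \<in> sect X (Cod C h) \<Longrightarrow> m (Dom C h) (rest X h s) = rest Y h (m (Cod C h) s)"
  obtains f where "f \<in> hom E X Y" and "\<And>x s. x \<in> Ob C \<Longrightarrow> s \<in> sect X x \<Longrightarrow> act f x s = m x s"
proof -
  define \<phi> where "\<phi> x s = (if x \<in> Ob C \<and> s \<in> sect X x then m x s else undefined)" for x s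
  have "presheaf_hom C (Sec X) (Sec Y) \<phi>"
    using assms rest_sect Dom_in_Ob Cod_in_Ob by (auto simp: presheaf_hom_def \<phi>_def)
  then obtain f where "f \<in> hom E X Y" "act f = \<phi>"
    using full assms by blast
  then show thesis
    using that by (auto simp: \<phi>_def)
qed

lemma arrow_eq_locally:
  assumes f: "f \<in> hom E X Y" and g: "g \<in> hom E X Y"
    and l: "\<And>x s. x \<in> Ob C \<Longrightarrow> s \<in> sect X x \<Longrightarrow>
      locally x (\<lambda>h. act f (Dom C h) (rest X h s) = act g (Dom C h) (rest X h s))"
  shows "f = g"
proof (rule faithful[OF f g])
  fix x s assume x: "x \<in> Ob C" and s: "s \<in> sect X x"
  have "locally x (\<lambda>h. rest Y h (act f x s) = rest Y h (act g x s))"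
    using l[OF x s] act_rest[OF f] act_rest[OF g] s
    by (subst locally_cong[of _ _ "\<lambda>h. act f (Dom C h) (rest X h s) = act g (Dom C h) (rest X h s)"]) auto
  then show "act f x s = act g x s"
    using sect_separated[of Y x] E.hom_Ob[OF f] act_sect[OF f x s] act_sect[OF g x s] x by blast
qed

abbreviation stage_eq :: "('i, 'm) cat \<Rightarrow> ('i, 'm, 'o, 'a) ftor \<Rightarrow> 'c \<Rightarrow> ('i \<times> 'u) rel"
  where "stage_eq S D x \<equiv> set_colimit_rel S (\<lambda>i. sect (omap D i) x) (\<lambda>u. act (amap D u) x)"

text \<open>\<open>stage_eq\<close> is equality in the colimit of presheaves; requiring it only on a
  cover gives equality in the colimit of sheaves. \<open>apsnd\<close> restricts the section and
  keeps its stage.\<close>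

definition colim_eq :: "('i, 'm) cat \<Rightarrow> ('i, 'm, 'o, 'a) ftor \<Rightarrow> 'c \<Rightarrow> 'i \<times> 'u \<Rightarrow> 'i \<times> 'u \<Rightarrow> bool"
  where "colim_eq S D x a b \<longleftrightarrow>
    locally x (\<lambda>h. (apsnd (rest (omap D (fst a)) h) a, apsnd (rest (omap D (fst b)) h) b) \<in> stage_eq S D (Dom C h))"

text \<open>A recognition criterion in place of the universal property: the legs identify sections
  only where the diagram forces it locally, and they are jointly surjective locally. For small
  diagrams it is equivalent to being a colimit.\<close>

definition sectionwise_colimit ::
    "('i, 'm) cat \<Rightarrow> ('i, 'm, 'o, 'a) ftor \<Rightarrow> 'o \<Rightarrow> ('i \<Rightarrow> 'a) \<Rightarrow> bool"
  where "sectionwise_colimit S D X c \<longleftrightarrow> cocone S E D X c \<and>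
    (\<forall>x\<in>Ob C. \<forall>i\<in>Ob S. \<forall>j\<in>Ob S. \<forall>p\<in>sect (omap D i) x. \<forall>q\<in>sect (omap D j) x.
      act (c i) x p = act (c j) x q \<longrightarrow> colim_eq S D x (i, p) (j, q)) \<and>
    (\<forall>x\<in>Ob C. \<forall>a\<in>sect X x. locally x (\<lambda>h. \<exists>i\<in>Ob S. \<exists>p\<in>sect (omap D i) (Dom C h).
      rest X h a = act (c i) (Dom C h) p))"

lemma
  assumes "sectionwise_colimit S D X c" and "x \<in> Ob C"
  shows sectionwise_colimit_eq: "i \<in> Ob S \<Longrightarrow> p \<in> sect (omap D i) x \<Longrightarrow> j \<in> Ob S \<Longrightarrow> q \<in> sect (omap D j) x \<Longrightarrow>
      act (c i) x p = act (c j) x q \<Longrightarrow> colim_eq S D x (i, p) (j, q)"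
    and sectionwise_colimit_cover: "a \<in> sect X x \<Longrightarrow>
      locally x (\<lambda>h. \<exists>i\<in>Ob S. \<exists>p\<in>sect (omap D i) (Dom C h). rest X h a = act (c i) (Dom C h) p)"
  using assms by (simp_all add: sectionwise_colimit_def)

context
  fixes S :: "('i, 'm) cat" and D :: "('i, 'm, 'o, 'a) ftor"
  assumes S: "category S" and D: "functor S E D"
begin

lemma D_Ob: "i \<in> Ob S \<Longrightarrow> omap D i \<in> Ob E"
  using D by (simp add: functor_def)

lemma D_Ar: "u \<in> Ar S \<Longrightarrow> amap D u \<in> hom E (omap D (Dom S u)) (omap D (Cod S u))"
  using D by (simp add: functor_def)

lemma S_Ob: "u \<in> Ar S \<Longrightarrow> Dom S u \<in> Ob S" "u \<in> Ar S \<Longrightarrow> Cod S u \<in> Ob S"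
  by (erule category.Dom_in_Ob[OF S] category.Cod_in_Ob[OF S])+

lemma stage_eq_rest:
  assumes ab: "(a, b) \<in> stage_eq S D (Cod C h)" and h: "h \<in> Ar C"
  shows "(apsnd (rest (omap D (fst a)) h) a, apsnd (rest (omap D (fst b)) h) b) \<in> stage_eq S D (Dom C h)"
  using ab
proof (induction rule: set_colimit_rel_induct)
  case (step u x)
  have "rest (omap D (Dom S u)) h x \<in> sect (omap D (Dom S u)) (Dom C h)"
    using rest_sect[OF D_Ob[OF S_Ob(1)]] h step by blast
  from set_colimit_rel_step[where T = "\<lambda>i. sect (omap D i) (Dom C h)" and t = "\<lambda>u. act (amap D u) (Dom C h)",
      OF step(1) this] show ?case
    using act_rest[OF D_Ar[OF step(1)] h] step by simp
qed (auto intro: set_colimit_rel_refl set_colimit_rel_sym set_colimit_rel_trans)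

lemma cocone_stage_eq:
  assumes c: "cocone S E D Y d" and x: "x \<in> Ob C" and eq: "((i, p), (j, q)) \<in> stage_eq S D x"
  shows "act (d i) x p = act (d j) x q"
proof -
  have "act (d (fst a)) x (snd a) = act (d (fst b)) x (snd b)" if "(a, b) \<in> stage_eq S D x" for a b
    using that
  proof (induction rule: set_colimit_rel_induct)
    case (step u s)
    have du: "d (Cod S u) \<in> hom E (omap D (Cod S u)) Y" "d (Cod S u) \<cdot> amap D u = d (Dom S u)"
      using c S_Ob step by (auto simp: cocone_def)
    then show ?case
      using act_comp[OF D_Ar[OF step(1)] du(1) x step(2)] du(2) by simp
  qed auto
  from this[OF eq] show ?thesis
    by simp
qed

text \<open>Equality on a cover of a cover is equality on a cover, which gives
  \<open>E_local\<close>. Stability of \<open>stage_eq\<close> under restriction comes from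
  naturality of the transition arrows.\<close>

lemma local_equality_colim:
  "local_equality C J (\<lambda>x. SIGMA i:Ob S. sect (omap D i) x) (\<lambda>h a. apsnd (rest (omap D (fst a)) h) a)
    (colim_eq S D)"
proof (unfold_locales, goal_cases)
  case (1 h a)
  then show ?case
    using rest_sect D_Ob by fastforce
next
  case (2 x a)
  then show ?case
    using rest_Id D_Ob by (auto simp: apsnd_def map_prod_def)
next
  case (3 f g a)
  then show ?case
    using rest_comp D_Ob by (auto simp: apsnd_def map_prod_def)
next
  case (4 x a)
  then show ?case
    unfolding colim_eq_def by (intro locally_all set_colimit_rel_refl) auto
next
  case (5 x a b)
  have *: "(apsnd (rest (omap D (fst b)) h) b, apsnd (rest (omap D (fst a)) h) a) \<in> stage_eq S D (Dom C h) \<longleftrightarrow>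
      (apsnd (rest (omap D (fst a)) h) a, apsnd (rest (omap D (fst b)) h) b) \<in> stage_eq S D (Dom C h)" for h
    using set_colimit_rel_sym by metis
  show ?case
    using 5 unfolding colim_eq_def * by simp
next
  case (6 x a b s)
  let ?r = "\<lambda>h a. apsnd (rest (omap D (fst a)) h) a"
  have "locally x (\<lambda>h. (?r h a, ?r h b) \<in> stage_eq S D (Dom C h) \<and> (?r h b, ?r h s) \<in> stage_eq S D (Dom C h))"
    using 6 unfolding colim_eq_def by (intro locally_conj) auto
  then show ?case
    unfolding colim_eq_def
  proof (rule locally_mono)
    fix f g assume f: "f \<in> Ar C" "Cod C f = x" "(?r f a, ?r f s) \<in> stage_eq S D (Dom C f)" and g: "g \<in> Ar C" "Cod C g = Dom C f"
    then have "(?r g (?r f a), ?r g (?r f s)) \<in> stage_eq S D (Dom C g)"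
      using stage_eq_rest[of "?r f a" "?r f s" g] by simp
    moreover have "?r g (?r f a) = ?r (f \<cdot>\<^bsub>C\<^esub> g) a" "?r g (?r f s) = ?r (f \<cdot>\<^bsub>C\<^esub> g) s"
      using 6 f g rest_comp[OF D_Ob g(1) f(1)] by (auto simp: apsnd_def map_prod_def)
    ultimately show "(?r (f \<cdot>\<^bsub>C\<^esub> g) a, ?r (f \<cdot>\<^bsub>C\<^esub> g) s) \<in> stage_eq S D (Dom C (f \<cdot>\<^bsub>C\<^esub> g))"
      using comp_in_Ar[of g f] f g by simp
  qed (use 6 set_colimit_rel_trans in \<open>blast+\<close>)
next
  case (7 f a b)
  let ?r = "\<lambda>h a. apsnd (rest (omap D (fst a)) h) a"
  have "locally (Dom C f) (\<lambda>g. (?r (f \<cdot>\<^bsub>C\<^esub> g) a, ?r (f \<cdot>\<^bsub>C\<^esub> g) b) \<in> stage_eq S D (Dom C (f \<cdot>\<^bsub>C\<^esub> g)))"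
    using 7 unfolding colim_eq_def by (intro locally_pull) auto
  then show ?case
    unfolding colim_eq_def
  proof (rule locally_rewrite, goal_cases)
    case (1 g)
    have "?r g (?r f a) = ?r (f \<cdot>\<^bsub>C\<^esub> g) a" "?r g (?r f b) = ?r (f \<cdot>\<^bsub>C\<^esub> g) b"
      using 7 1 rest_comp[OF D_Ob 1(1) 7(1)] by (auto simp: apsnd_def map_prod_def)
    then show ?case
      using comp_in_Ar[of g f] 7 1 by simp
  qed
next
  case (8 x a b)
  let ?r = "\<lambda>h a. apsnd (rest (omap D (fst a)) h) a"
  have *: "?r g (?r f a) = ?r (f \<cdot>\<^bsub>C\<^esub> g) a" "?r g (?r f b) = ?r (f \<cdot>\<^bsub>C\<^esub> g) b"
    if "f \<in> Ar C" "Cod C f = x" "g \<in> Ar C" "Cod C g = Dom C f" for f g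
    using 8 that rest_comp[OF D_Ob that(3,1)] by (auto simp: apsnd_def map_prod_def)
  show ?case
    unfolding colim_eq_def
  proof (rule locally_trans[OF 8(4) 8(1)])
    fix f g assume f: "f \<in> Ar C" "Cod C f = x" "(?r f a, ?r f b) \<in> stage_eq S D (Dom C f)" and g: "g \<in> Ar C" "Cod C g = Dom C f"
    then have "(?r g (?r f a), ?r g (?r f b)) \<in> stage_eq S D (Dom C g)"
      using stage_eq_rest[of "?r f a" "?r f b" g] by simp
    then show "(?r (f \<cdot>\<^bsub>C\<^esub> g) a, ?r (f \<cdot>\<^bsub>C\<^esub> g) b) \<in> stage_eq S D (Dom C (f \<cdot>\<^bsub>C\<^esub> g))"
      unfolding *[OF f(1,2) g] using comp_in_Ar[of g f] f g by simp
  next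
    fix f assume f: "f \<in> Ar C" "Cod C f = x" "colim_eq S D (Dom C f) (?r f a) (?r f b)"
    then have "locally (Dom C f) (\<lambda>g. (?r g (?r f a), ?r g (?r f b)) \<in> stage_eq S D (Dom C g))"
      by (simp add: colim_eq_def)
    then show "locally (Dom C f) (\<lambda>g. (?r (f \<cdot>\<^bsub>C\<^esub> g) a, ?r (f \<cdot>\<^bsub>C\<^esub> g) b) \<in> stage_eq S D (Dom C (f \<cdot>\<^bsub>C\<^esub> g)))"
    proof (rule locally_rewrite, goal_cases)
      case (1 g)
      show ?case
        using *[OF f(1,2) 1] comp_in_Ar[of g f] f 1 by simp
    qed
  qed
qed

text \<open>The arrows of a cocone send stage-equal sections to the same section, and the vertex is
  separated, so stage equality on a cover suffices.\<close>

lemma cocone_colim_eq: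
  assumes c: "cocone S E D Y d" and x: "x \<in> Ob C" and i: "i \<in> Ob S" "p \<in> sect (omap D i) x"
    and j: "j \<in> Ob S" "q \<in> sect (omap D j) x" and eq: "colim_eq S D x (i, p) (j, q)"
  shows "act (d i) x p = act (d j) x q"
proof (rule sect_separated)
  show Y: "Y \<in> Ob E"
    using c by (simp add: cocone_def)
  have d: "d i \<in> hom E (omap D i) Y" "d j \<in> hom E (omap D j) Y"
    using c i j by (auto simp: cocone_def)
  show "act (d i) x p \<in> sect Y x" "act (d j) x q \<in> sect Y x"
    using act_sect d x i j by blast+
  have "locally x (\<lambda>h. ((i, rest (omap D i) h p), (j, rest (omap D j) h q)) \<in> stage_eq S D (Dom C h))"
    using eq by (simp add: colim_eq_def)
  then show "locally x (\<lambda>h. rest Y h (act (d i) x p) = rest Y h (act (d j) x q))"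
  proof (rule locally_mono[OF _ x])
    fix h assume h: "h \<in> Ar C" "Cod C h = x"
    {
      assume "((i, rest (omap D i) h p), (j, rest (omap D j) h q)) \<in> stage_eq S D (Dom C h)"
      from cocone_stage_eq[OF c Dom_in_Ob[OF h(1)] this]
      show "rest Y h (act (d i) x p) = rest Y h (act (d j) x q)"
        using act_rest[OF d(1) h(1)] act_rest[OF d(2) h(1)] h(2) i j by simp
    }
    fix g assume "rest Y h (act (d i) x p) = rest Y h (act (d j) x q)" "g \<in> Ar C" "Cod C g = Dom C h"
    then show "rest Y (h \<cdot>\<^bsub>C\<^esub> g) (act (d i) x p) = rest Y (h \<cdot>\<^bsub>C\<^esub> g) (act (d j) x q)"
      using rest_comp[OF Y _ h(1)] act_sect[OF d(1) x i(2)] act_sect[OF d(2) x j(2)] h(2) by simp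
  qed
qed fact

text \<open>The colimit is the sheaf generated by all pairs of a stage and a section there, with
  \<open>colim_eq\<close> as local equality.\<close>

lemma sectionwise_colimit_exists:
  assumes "small TYPE('u) (Ob S)"
  obtains X c where "sectionwise_colimit S D X c"
proof -
  let ?P = "\<lambda>x. SIGMA i:Ob S. sect (omap D i) x"
  let ?r = "\<lambda>h a. apsnd (rest (omap D (fst a)) h) a"
  interpret G: local_equality C J ?P ?r "colim_eq S D"
    by (rule local_equality_colim)
  have sm: "small TYPE('u) (?P x)" if "x \<in> Ob C" for x
    using that D_Ob Sec_sheaf by (intro small_Sigma inaccessible assms) (auto simp: sheaf_def presheaf_def)
  obtain L :: "('c, 'd, 'u) psh" and \<eta> :: "'c \<Rightarrow> 'i \<times> 'u \<Rightarrow> 'u" where L: "sheaf C J L"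
    and \<eta>: "\<And>x a. x \<in> Ob C \<Longrightarrow> a \<in> ?P x \<Longrightarrow> \<eta> x a \<in> sec L x"
    and \<eta>r: "\<And>h a. h \<in> Ar C \<Longrightarrow> a \<in> ?P (Cod C h) \<Longrightarrow> res L h (\<eta> (Cod C h) a) = \<eta> (Dom C h) (?r h a)"
    and \<eta>eq: "\<And>x a b. x \<in> Ob C \<Longrightarrow> a \<in> ?P x \<Longrightarrow> b \<in> ?P x \<Longrightarrow> \<eta> x a = \<eta> x b \<longleftrightarrow> colim_eq S D x a b"
    and \<eta>loc: "\<And>x s. x \<in> Ob C \<Longrightarrow> s \<in> sec L x \<Longrightarrow> locally x (\<lambda>h. \<exists>a\<in>?P (Dom C h). res L h s = \<eta> (Dom C h) a)"
    by (rule G.generated_sheaf[OF inaccessible small_Ar]) (erule sm, rule that)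
  \<comment> \<open>The generated sheaf need not be of the form \<open>Sec X\<close>; it is replaced
    by an isomorphic one, and \<open>\<phi>\<close> and \<open>\<psi>\<close> translate sections
    back and forth.\<close>
  obtain X \<phi> \<psi> where X: "X \<in> Ob E" and \<phi>: "presheaf_hom C L (Sec X) \<phi>" and \<psi>: "presheaf_hom C (Sec X) L \<psi>"
    and inv: "\<And>x s. x \<in> Ob C \<Longrightarrow> s \<in> sec L x \<Longrightarrow> \<psi> x (\<phi> x s) = s"
      "\<And>x s. x \<in> Ob C \<Longrightarrow> s \<in> sect X x \<Longrightarrow> \<phi> x (\<psi> x s) = s"
    using essentially_surjective[OF L] by metis
  have "\<exists>f. f \<in> hom E (omap D i) X \<and> (\<forall>x\<in>Ob C. \<forall>s\<in>sect (omap D i) x. act f x s = \<phi> x (\<eta> x (i, s)))"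
    if i: "i \<in> Ob S" for i
  proof -
    obtain f where "f \<in> hom E (omap D i) X"
      "\<And>x s. x \<in> Ob C \<Longrightarrow> s \<in> sect (omap D i) x \<Longrightarrow> act f x s = \<phi> x (\<eta> x (i, s))"
    proof (rule arrow_of_sections[OF D_Ob[OF i] X, of "\<lambda>x s. \<phi> x (\<eta> x (i, s))"])
      show "\<phi> x (\<eta> x (i, s)) \<in> sect X x" if "x \<in> Ob C" "s \<in> sect (omap D i) x" for x s
        using \<phi> \<eta>[OF that(1), of "(i, s)"] i that by (simp add: presheaf_hom_def)
      show "\<phi> (Dom C h) (\<eta> (Dom C h) (i, rest (omap D i) h s)) = rest X h (\<phi> (Cod C h) (\<eta> (Cod C h) (i, s)))"
        if "h \<in> Ar C" "s \<in> sect (omap D i) (Cod C h)" for h s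
        using presheaf_hom_res[OF \<phi> that(1) \<eta>[OF Cod_in_Ob[OF that(1)]], of "(i, s)"] \<eta>r[OF that(1), of "(i, s)"]
          i that by simp
    qed (rule that)
    then show ?thesis
      by blast
  qed
  then obtain c where c: "\<And>i. i \<in> Ob S \<Longrightarrow> c i \<in> hom E (omap D i) X"
    and act_c: "\<And>i x s. i \<in> Ob S \<Longrightarrow> x \<in> Ob C \<Longrightarrow> s \<in> sect (omap D i) x \<Longrightarrow> act (c i) x s = \<phi> x (\<eta> x (i, s))"
    by metis
  have "cocone S E D X c"
    unfolding cocone_def
  proof (intro conjI ballI)
    fix u assume u: "u \<in> Ar S"
    note cu = E.Comp_in_hom[OF D_Ar[OF u] c[OF S_Ob(2)[OF u]]]
    show "c (Cod S u) \<cdot> amap D u = c (Dom S u)"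
    proof (rule faithful[OF cu c[OF S_Ob(1)[OF u]]])
      fix x s assume x: "x \<in> Ob C" and s: "s \<in> sect (omap D (Dom S u)) x"
      have s': "act (amap D u) x s \<in> sect (omap D (Cod S u)) x"
        using act_sect[OF D_Ar[OF u] x s] .
      have "((Dom S u, s), (Cod S u, act (amap D u) x s)) \<in> stage_eq S D x"
        using u s by (rule set_colimit_rel_step)
      then have "colim_eq S D x (Dom S u, s) (Cod S u, act (amap D u) x s)"
        unfolding colim_eq_def using x stage_eq_rest by (intro locally_all) auto
      then have "\<eta> x (Dom S u, s) = \<eta> x (Cod S u, act (amap D u) x s)"
        using \<eta>eq[OF x] s s' S_Ob[OF u] by simp
      then show "act (c (Cod S u) \<cdot> amap D u) x s = act (c (Dom S u)) x s"
        using act_comp[OF D_Ar[OF u] c[OF S_Ob(2)[OF u]] x s] act_c[OF S_Ob(2)[OF u] x s'] act_c[OF S_Ob(1)[OF u] x s]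
        by simp
    qed
  qed (use X c in auto)
  moreover have "colim_eq S D x (i, p) (j, q)"
    if "x \<in> Ob C" "i \<in> Ob S" "j \<in> Ob S" "p \<in> sect (omap D i) x" "q \<in> sect (omap D j) x"
      "act (c i) x p = act (c j) x q" for x i j p q
  proof -
    have "\<phi> x (\<eta> x (i, p)) = \<phi> x (\<eta> x (j, q))"
      using act_c that by simp
    then have "\<eta> x (i, p) = \<eta> x (j, q)"
      using inv(1)[OF that(1)] \<eta>[OF that(1)] that by (metis SigmaI)
    then show ?thesis
      using \<eta>eq that by simp
  qed
  moreover have "locally x (\<lambda>h. \<exists>i\<in>Ob S. \<exists>p\<in>sect (omap D i) (Dom C h). rest X h a = act (c i) (Dom C h) p)"
    if x: "x \<in> Ob C" and a: "a \<in> sect X x" for x a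
  proof -
    have \<psi>a: "\<psi> x a \<in> sec L x"
      using \<psi> x a by (simp add: presheaf_hom_def)
    have "(\<exists>i\<in>Ob S. \<exists>p\<in>sect (omap D i) (Dom C h). rest X h a = act (c i) (Dom C h) p) \<longleftrightarrow>
        (\<exists>b\<in>?P (Dom C h). res L h (\<psi> x a) = \<eta> (Dom C h) b)" if h: "h \<in> Ar C" "Cod C h = x" for h
    proof -
      have D: "Dom C h \<in> Ob C"
        using Dom_in_Ob h by blast
      have r: "rest X h a \<in> sect X (Dom C h)"
        using rest_sect X h a by blast
      have \<psi>r: "res L h (\<psi> x a) = \<psi> (Dom C h) (rest X h a)"
        using \<psi> h a by (simp add: presheaf_hom_def)
      have "rest X h a = act (c i) (Dom C h) p \<longleftrightarrow> res L h (\<psi> x a) = \<eta> (Dom C h) (i, p)"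
        if "i \<in> Ob S" "p \<in> sect (omap D i) (Dom C h)" for i p
        unfolding \<psi>r act_c[OF that(1) D that(2)]
        using inv(2)[OF D r] inv(1)[OF D \<eta>[OF D, of "(i, p)"]] that by auto
      then show ?thesis
        by auto
    qed
    then show ?thesis
      using \<eta>loc[OF x \<psi>a] by (subst locally_cong) auto
  qed
  ultimately have "sectionwise_colimit S D X c"
    unfolding sectionwise_colimit_def by blast
  then show thesis
    by (rule that)
qed

lemma sectionwise_colimit_imp_colimit:
  assumes X: "sectionwise_colimit S D X c"
  shows "colimit S E D X c"
  unfolding colimit_def
proof (intro conjI allI impI)
  show cc: "cocone S E D X c"
    using X by (simp add: sectionwise_colimit_def)
  have eq: "colim_eq S D x (i, p) (j, q)"
    if "x \<in> Ob C" "i \<in> Ob S" "j \<in> Ob S" "p \<in> sect (omap D i) x" "q \<in> sect (omap D j) x"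
      "act (c i) x p = act (c j) x q" for x i j p q
    using that by (intro sectionwise_colimit_eq[OF X])
  have loc: "locally x (\<lambda>h. \<exists>i\<in>Ob S. \<exists>p\<in>sect (omap D i) (Dom C h). rest X h a = act (c i) (Dom C h) p)"
    if "x \<in> Ob C" "a \<in> sect X x" for x a
    by (rule sectionwise_colimit_cover[OF X that])
  have XO: "X \<in> Ob E" and c: "\<And>i. i \<in> Ob S \<Longrightarrow> c i \<in> hom E (omap D i) X"
    using cc by (auto simp: cocone_def)
  fix Y d assume dd: "cocone S E D Y d"
  have YO: "Y \<in> Ob E" and d: "\<And>i. i \<in> Ob S \<Longrightarrow> d i \<in> hom E (omap D i) Y"
    using dd by (auto simp: cocone_def)
  \<comment> \<open>The graph that any comparison arrow must have on sections coming from a stage.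
    It is total locally because the legs cover \<open>X\<close>, and single-valued because whatever
    the legs \<open>c\<close> identify is also identified by \<open>d\<close>.\<close>
  define R where "R x a b \<longleftrightarrow> (\<exists>i\<in>Ob S. \<exists>p\<in>sect (omap D i) x. a = act (c i) x p \<and> b = act (d i) x p)" for x a b
  obtain h where h: "h \<in> hom E X Y" and hR: "\<And>x a b. x \<in> Ob C \<Longrightarrow> R x a b \<Longrightarrow> act h x a = b"
  proof (rule glue_arrow[OF XO YO, of R])
    show "a \<in> sect X x \<and> b \<in> sect Y x" if "x \<in> Ob C" "R x a b" for x a b
      using that act_sect[OF c] act_sect[OF d] by (auto simp: R_def)
    show "R (Dom C k) (rest X k a) (rest Y k b)" if k: "k \<in> Ar C" and r: "R (Cod C k) a b" for k a b
    proof -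
      obtain i p where ip: "i \<in> Ob S" "p \<in> sect (omap D i) (Cod C k)" "a = act (c i) (Cod C k) p" "b = act (d i) (Cod C k) p"
        using r by (auto simp: R_def)
      then show ?thesis
        unfolding R_def using act_rest[OF c[OF ip(1)] k ip(2)] act_rest[OF d[OF ip(1)] k ip(2)] rest_sect[OF D_Ob[OF ip(1)] k ip(2)]
        by metis
    qed
    show "b = b'" if "x \<in> Ob C" "R x a b" "R x a b'" for x a b b'
      using that eq cocone_colim_eq[OF dd] unfolding R_def by metis
    show "locally x (\<lambda>h. \<exists>b. R (Dom C h) (rest X h a) b)" if "x \<in> Ob C" "a \<in> sect X x" for x a
      using loc[OF that] unfolding R_def by (rule back_subst[of "locally x"]) blast
  qed (rule that)
  show "\<exists>!h. h \<in> hom E X Y \<and> (\<forall>i\<in>Ob S. h \<cdot> c i = d i)"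
  proof (rule ex1I[of _ h], intro conjI ballI)
    show "h \<cdot> c i = d i" if i: "i \<in> Ob S" for i
    proof (rule faithful[OF E.Comp_in_hom[OF c[OF i] h] d[OF i]])
      fix x s assume x: "x \<in> Ob C" and s: "s \<in> sect (omap D i) x"
      then have "R x (act (c i) x s) (act (d i) x s)"
        using i by (auto simp: R_def)
      then show "act (h \<cdot> c i) x s = act (d i) x s"
        using act_comp[OF c[OF i] h x s] hR[OF x] by simp
    qed
  next
    fix k assume k: "k \<in> hom E X Y \<and> (\<forall>i\<in>Ob S. k \<cdot> c i = d i)"
    then have kh: "k \<in> hom E X Y"
      by blast
    show "k = h"
    proof (rule arrow_eq_locally[OF kh h])
      fix x s assume x: "x \<in> Ob C" and s: "s \<in> sect X x"
      show "locally x (\<lambda>f. act k (Dom C f) (rest X f s) = act h (Dom C f) (rest X f s))"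
      proof (rule locally_mono[OF loc[OF x s] x])
        fix f assume f: "f \<in> Ar C" "Cod C f = x"
        {
          assume "\<exists>i\<in>Ob S. \<exists>p\<in>sect (omap D i) (Dom C f). rest X f s = act (c i) (Dom C f) p"
          then obtain i p where i: "i \<in> Ob S" "p \<in> sect (omap D i) (Dom C f)" "rest X f s = act (c i) (Dom C f) p"
            by blast
          have "R (Dom C f) (rest X f s) (act (d i) (Dom C f) p)"
            using i by (auto simp: R_def)
          then have "act h (Dom C f) (rest X f s) = act (d i) (Dom C f) p"
            using hR Dom_in_Ob f by blast
          moreover have "act k (Dom C f) (rest X f s) = act (d i) (Dom C f) p"
            using act_comp[OF c[OF i(1)] kh Dom_in_Ob[OF f(1)] i(2)] k i by simp
          ultimately show "act k (Dom C f) (rest X f s) = act h (Dom C f) (rest X f s)"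
            by simp
        }
        fix g assume *: "act k (Dom C f) (rest X f s) = act h (Dom C f) (rest X f s)" and g: "g \<in> Ar C" "Cod C g = Dom C f"
        have r: "rest X f s \<in> sect X (Cod C g)"
          using rest_sect[OF XO f(1)] f g s by simp
        show "act k (Dom C (f \<cdot>\<^bsub>C\<^esub> g)) (rest X (f \<cdot>\<^bsub>C\<^esub> g) s) = act h (Dom C (f \<cdot>\<^bsub>C\<^esub> g)) (rest X (f \<cdot>\<^bsub>C\<^esub> g) s)"
          using act_rest[OF kh g(1) r] act_rest[OF h g(1) r] * g comp_in_Ar[of g f] f rest_comp[OF XO g(1) f(1) g(2)] s by simp
      qed
    qed
  qed (rule h)
qed

text \<open>A sectionwise colimit exists, and colimits are unique up to isomorphism; both local
  conditions are transported along that isomorphism.\<close>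

lemma colimit_imp_sectionwise:
  assumes X: "colimit S E D X c" and "small TYPE('u) (Ob S)"
  shows "sectionwise_colimit S D X c"
proof -
  obtain X' c' where X': "sectionwise_colimit S D X' c'"
    using sectionwise_colimit_exists[OF assms(2)] .
  obtain h k where h: "h \<in> hom E X X'" and k: "k \<in> hom E X' X" and kh: "k \<cdot> h = Id E X"
    and hc: "\<And>i. i \<in> Ob S \<Longrightarrow> h \<cdot> c i = c' i" and kc: "\<And>i. i \<in> Ob S \<Longrightarrow> k \<cdot> c' i = c i"
    using E.colimit_unique[OF X sectionwise_colimit_imp_colimit[OF X']] by metis
  have cc: "cocone S E D X c" "cocone S E D X' c'"
    using X X' by (auto simp: colimit_def sectionwise_colimit_def)
  have XO: "X \<in> Ob E" and c: "\<And>i. i \<in> Ob S \<Longrightarrow> c i \<in> hom E (omap D i) X"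
    and c': "\<And>i. i \<in> Ob S \<Longrightarrow> c' i \<in> hom E (omap D i) X'"
    using cc by (auto simp: cocone_def)
  have act_c': "act (c' i) x p = act h x (act (c i) x p)" if "i \<in> Ob S" "x \<in> Ob C" "p \<in> sect (omap D i) x" for i x p
    using act_comp[OF c[OF that(1)] h that(2,3)] hc[OF that(1)] by simp
  have act_c: "act (c i) x p = act k x (act (c' i) x p)" if "i \<in> Ob S" "x \<in> Ob C" "p \<in> sect (omap D i) x" for i x p
    using act_comp[OF c'[OF that(1)] k that(2,3)] kc[OF that(1)] by simp
  have "colim_eq S D x (i, p) (j, q)"
    if "x \<in> Ob C" "i \<in> Ob S" "j \<in> Ob S" "p \<in> sect (omap D i) x" "q \<in> sect (omap D j) x"
      "act (c i) x p = act (c j) x q" for x i j p q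
    using that by (intro sectionwise_colimit_eq[OF X']) (simp_all add: act_c')
  moreover have "locally x (\<lambda>f. \<exists>i\<in>Ob S. \<exists>p\<in>sect (omap D i) (Dom C f). rest X f a = act (c i) (Dom C f) p)"
    if x: "x \<in> Ob C" and a: "a \<in> sect X x" for x a
  proof -
    have ha: "act h x a \<in> sect X' x"
      using act_sect[OF h x a] .
    have L: "locally x (\<lambda>f. \<exists>i\<in>Ob S. \<exists>p\<in>sect (omap D i) (Dom C f). rest X' f (act h x a) = act (c' i) (Dom C f) p)"
      by (rule sectionwise_colimit_cover[OF X' x ha])
    show ?thesis
    proof (rule locally_rewrite[OF L])
      fix f assume f: "f \<in> Ar C" "Cod C f = x"
      note D' = Dom_in_Ob[OF f(1)]
      have r: "rest X f a \<in> sect X (Dom C f)" and hr: "rest X' f (act h x a) = act h (Dom C f) (rest X f a)"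
        using rest_sect[OF XO f(1)] act_rest[OF h f(1)] f a by auto
      have "act k (Dom C f) (act h (Dom C f) (rest X f a)) = rest X f a"
        using act_comp[OF h k D' r] kh act_Id[OF XO D' r] by simp
      then have "rest X' f (act h x a) = act (c' i) (Dom C f) p \<longleftrightarrow> rest X f a = act (c i) (Dom C f) p"
        if "i \<in> Ob S" "p \<in> sect (omap D i) (Dom C f)" for i p
        using act_c'[OF that(1) D' that(2)] act_c[OF that(1) D' that(2)] hr by metis
      then show "(\<exists>i\<in>Ob S. \<exists>p\<in>sect (omap D i) (Dom C f). rest X' f (act h x a) = act (c' i) (Dom C f) p) \<longleftrightarrow>
          (\<exists>i\<in>Ob S. \<exists>p\<in>sect (omap D i) (Dom C f). rest X f a = act (c i) (Dom C f) p)"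
        by blast
    qed
  qed
  ultimately show ?thesis
    unfolding sectionwise_colimit_def using cc(1) by blast
qed

end

end

section \<open>Atoms and coproducts\<close>

lemma (in category) coproduct_iff:
  assumes A: "\<forall>i\<in>I. A i \<in> Ob C"
  shows "coproduct I C A X c \<longleftrightarrow> X \<in> Ob C \<and> (\<forall>i\<in>I. c i \<in> hom C (A i) X) \<and>
    (\<forall>Y d. Y \<in> Ob C \<and> (\<forall>i\<in>I. d i \<in> hom C (A i) Y) \<longrightarrow> (\<exists>!h. h \<in> hom C X Y \<and> (\<forall>i\<in>I. h \<cdot> c i = d i)))"
proof -
  have "cocone (discrete_cat I) C \<lparr>omap = A, amap = \<lambda>i. Id C (A i)\<rparr> Y d \<longleftrightarrow>
      Y \<in> Ob C \<and> (\<forall>i\<in>I. d i \<in> hom C (A i) Y)" for Y d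
    using Comp_Id by (auto simp: cocone_def discrete_cat_def)
  then show ?thesis
    unfolding coproduct_def colimit_def by (simp add: discrete_cat_def)
qed

lemma (in category)
  assumes "coproduct I C A X c" and A: "\<forall>i\<in>I. A i \<in> Ob C"
  shows coproduct_Ob: "X \<in> Ob C"
    and coprojection_hom: "i \<in> I \<Longrightarrow> c i \<in> hom C (A i) X"
    and coproduct_universal: "Y \<in> Ob C \<Longrightarrow> (\<And>i. i \<in> I \<Longrightarrow> d i \<in> hom C (A i) Y) \<Longrightarrow>
      \<exists>!h. h \<in> hom C X Y \<and> (\<forall>i\<in>I. h \<cdot> c i = d i)"
  using assms(1) coproduct_iff[of I A X c] A by simp_all

lemma (in category) coproduct_arrow_eq:
  assumes "coproduct I C A X c" and A: "\<forall>i\<in>I. A i \<in> Ob C"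
    and f: "f \<in> hom C X Y" and g: "g \<in> hom C X Y" and eq: "\<And>i. i \<in> I \<Longrightarrow> f \<cdot> c i = g \<cdot> c i"
  shows "f = g"
proof -
  have "\<exists>!h. h \<in> hom C X Y \<and> (\<forall>i\<in>I. h \<cdot> c i = g \<cdot> c i)"
    using hom_Ob[OF f] Comp_in_hom[OF coprojection_hom[OF assms(1) A] g]
    by (intro coproduct_universal[OF assms(1) A]) auto
  then show ?thesis
    using f g eq by blast
qed

lemma (in category) functor_discrete:
  assumes "\<forall>i\<in>I. A i \<in> Ob C"
  shows "functor (discrete_cat I) C \<lparr>omap = A, amap = \<lambda>i. Id C (A i)\<rparr>"
  using assms Id_in_hom Comp_Id[OF Id_in_hom] by (auto simp: functor_def discrete_cat_def)

section \<open>Atoms, subobjects and coproducts in terms of sections\<close>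

context presented_topos
begin

text \<open>The sectionwise form of being a monomorphism; lifting arguments use it because they
  compare individual sections.\<close>

definition injective :: "'o \<Rightarrow> 'a \<Rightarrow> bool"
  where "injective X m \<longleftrightarrow> (\<forall>x\<in>Ob C. inj_on (act m x) (sect X x))"

lemma injectiveD:
  "injective X m \<Longrightarrow> x \<in> Ob C \<Longrightarrow> s \<in> sect X x \<Longrightarrow> t \<in> sect X x \<Longrightarrow> act m x s = act m x t \<Longrightarrow> s = t"
  unfolding injective_def by (blast dest: inj_onD)

lemma injective_imp_mono:
  assumes m: "m \<in> hom E X Y" and inj: "injective X m"
  shows "mono E m"
  unfolding mono_def
proof (intro conjI ballI impI)
  show "m \<in> Ar E"
    using m by (simp add: hom_def)
  fix f g assume "f \<in> Ar E" "g \<in> Ar E"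
    and *: "Dom E f = Dom E g \<and> Cod E f = Dom E m \<and> Cod E g = Dom E m \<and> m \<cdot> f = m \<cdot> g"
  then have f: "f \<in> hom E (Dom E g) X" and g: "g \<in> hom E (Dom E g) X"
    using m by (auto simp: hom_def)
  show "f = g"
  proof (rule faithful[OF f g])
    fix x s assume x: "x \<in> Ob C" "s \<in> sect (Dom E g) x"
    have "act m x (act f x s) = act m x (act g x s)"
      using act_comp[OF f m x] act_comp[OF g m x] * by simp
    then show "act f x s = act g x s"
      using injectiveD[OF inj x(1)] act_sect[OF f x] act_sect[OF g x] by blast
  qed
qed

text \<open>Over a null object the empty sieve already covers, so local agreement is vacuous, and
  sheaves are separated.\<close>

lemma null_unique:
  assumes "null x" and "x \<in> Ob C" and "X \<in> Ob E" and "s \<in> sect X x" and "t \<in> sect X x"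
  shows "s = t"
proof -
  have "locally x (\<lambda>h. rest X h s = rest X h t)"
    using assms(1,2) by (rule locally_mono) (use assms in \<open>simp_all add: rest_comp\<close>)
  then show ?thesis
    using assms by (blast intro: sect_separated)
qed

text \<open>An initial object maps to the colimit of the empty diagram, where a section comes
  locally from no stage at all; that leaves the empty sieve as a cover.\<close>

lemma initial_imp_null:
  assumes Z: "initial E Z" and x: "x \<in> Ob C" and s: "s \<in> sect Z x"
  shows "null x"
proof -
  \<comment> \<open>The index type and the values are arbitrary, since the index set will be
    empty.\<close>
  let ?D = "\<lparr>omap = \<lambda>i :: nat. undefined, amap = \<lambda>i. Id E undefined\<rparr>"
  have "functor (discrete_cat {}) E ?D"
    using E.functor_discrete[of "{}" "\<lambda>_. undefined"] by simp
  moreover have "small TYPE('u) (Ob (discrete_cat ({} :: nat set)))"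
    by (rule small_nat[OF inaccessible])
  ultimately obtain X c where X: "sectionwise_colimit (discrete_cat {}) ?D X c"
    using sectionwise_colimit_exists[OF category_discrete_cat] by blast
  then have "X \<in> Ob E"
    by (simp add: sectionwise_colimit_def cocone_def)
  then obtain f where f: "f \<in> hom E Z X"
    using Z unfolding initial_def by blast
  show ?thesis
    using sectionwise_colimit_cover[OF X x act_sect[OF f x s]] by (simp add: discrete_cat_def)
qed

text \<open>If sections existed over null objects only, the empty relation would glue to an arrow
  into any object, and any two arrows would agree by \<open>null_unique\<close>; so \<open>X\<close>
  would be initial.\<close>

lemma noninitial_section:
  assumes X: "X \<in> Ob E" and ni: "\<not> initial E X"
  obtains x s where "x \<in> Ob C" and "\<not> null x" and "s \<in> sect X x"
proof -
  have "\<exists>x s. x \<in> Ob C \<and> \<not> null x \<and> s \<in> sect X x"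
  proof (rule ccontr)
    assume "\<not> ?thesis"
    then have null: "\<And>x s. x \<in> Ob C \<Longrightarrow> s \<in> sect X x \<Longrightarrow> null x"
      by blast
    have "\<exists>!f. f \<in> hom E X Y" if Y: "Y \<in> Ob E" for Y
    proof -
      obtain f where f: "f \<in> hom E X Y"
        by (rule glue_arrow[OF X Y, of "\<lambda>_ _ _. False"]) (use null in auto)
      moreover have "g = f" if g: "g \<in> hom E X Y" for g
        using act_sect[OF f] act_sect[OF g] by (intro faithful[OF g f] null_unique[OF null _ Y]) auto
      ultimately show ?thesis
        by blast
    qed
    then show False
      using ni X by (simp add: initial_def)
  qed
  then show thesis
    using that by blast
qed

text \<open>Essential surjectivity provides \<open>M\<close> only up to isomorphism; what is kept is
  that the image of \<open>m\<close> on sections is exactly \<open>K\<close>.\<close>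

lemma subobject_of_subsheaf:
  assumes X: "X \<in> Ob E" and K: "subsheaf (Sec X) K"
  obtains M m where "M \<in> Ob E" and "m \<in> hom E M X" and "injective M m"
    and "\<And>x. x \<in> Ob C \<Longrightarrow> act m x ` sect M x = K x"
proof -
  let ?L = "Sec X\<lparr>sec := K\<rparr>"
  have "sheaf C J ?L"
    using sheaf_subsheaf[OF Sec_sheaf[OF X] K] .
  then obtain M \<phi> \<psi> where M: "M \<in> Ob E" and \<phi>: "presheaf_hom C ?L (Sec M) \<phi>" and \<psi>: "presheaf_hom C (Sec M) ?L \<psi>"
    and inv: "\<And>x s. x \<in> Ob C \<Longrightarrow> s \<in> K x \<Longrightarrow> \<psi> x (\<phi> x s) = s"
      "\<And>x s. x \<in> Ob C \<Longrightarrow> s \<in> sect M x \<Longrightarrow> \<phi> x (\<psi> x s) = s"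
    using essentially_surjective[of ?L] by auto
  have \<psi>K: "\<psi> x s \<in> K x" if "x \<in> Ob C" "s \<in> sect M x" for x s
    using presheaf_hom_sec[OF \<psi> that] by simp
  obtain m where m: "m \<in> hom E M X" and act: "\<And>x s. x \<in> Ob C \<Longrightarrow> s \<in> sect M x \<Longrightarrow> act m x s = \<psi> x s"
  proof (rule arrow_of_sections[OF M X, of \<psi>])
    show "\<psi> x s \<in> sect X x" if "x \<in> Ob C" "s \<in> sect M x" for x s
      using \<psi>K[OF that] K that unfolding subsheaf_def by blast
    show "\<psi> (Dom C h) (rest M h s) = rest X h (\<psi> (Cod C h) s)" if "h \<in> Ar C" "s \<in> sect M (Cod C h)" for h s
      using presheaf_hom_res[OF \<psi> that] by simp
  qed (rule that)
  have "inj_on (act m x) (sect M x)" if "x \<in> Ob C" for x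
    using act inv(2) that by (metis inj_onI)
  moreover have "act m x ` sect M x = K x" if x: "x \<in> Ob C" for x
  proof
    show "act m x ` sect M x \<subseteq> K x"
      using act \<psi>K x by auto
    show "K x \<subseteq> act m x ` sect M x"
    proof
      fix s assume s: "s \<in> K x"
      then have "\<phi> x s \<in> sect M x"
        using presheaf_hom_sec[OF \<phi> x] by simp
      then show "s \<in> act m x ` sect M x"
        using act inv(1)[OF x s] x by (metis image_eqI)
    qed
  qed
  ultimately show thesis
    using that M m by (auto simp: injective_def)
qed

lemma atom_Ob: "atom E A \<Longrightarrow> A \<in> Ob E"
  by (simp add: atom_def)

lemma atom_section:
  assumes "atom E A"
  obtains x s where "x \<in> Ob C" and "\<not> null x" and "s \<in> sect A x"
  using assms noninitial_section by (auto simp: atom_def)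

text \<open>The sections satisfying \<open>Q\<close> are stable under restriction. Admitting those
  that satisfy it on a cover closes them under local membership, because a cover of a cover is a
  cover.\<close>

lemma subsheaf_local_closure:
  assumes X: "X \<in> Ob E"
    and Q: "\<And>h s. h \<in> Ar C \<Longrightarrow> s \<in> sect X (Cod C h) \<Longrightarrow> Q (Cod C h) s \<Longrightarrow> Q (Dom C h) (rest X h s)"
  shows "subsheaf (Sec X) (\<lambda>x. {s \<in> sect X x. locally x (\<lambda>h. Q (Dom C h) (rest X h s))})"
proof -
  have comp: "Q (Dom C (f \<cdot>\<^bsub>C\<^esub> g)) (rest X (f \<cdot>\<^bsub>C\<^esub> g) s) \<longleftrightarrow> Q (Dom C g) (rest X g (rest X f s))"
    if "f \<in> Ar C" "g \<in> Ar C" "Cod C g = Dom C f" "s \<in> sect X (Cod C f)" for f g s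
    using rest_comp[OF X that(2,1,3,4)] comp_in_Ar[of g f] that by simp
  show ?thesis
    unfolding subsheaf_def
  proof (intro conjI ballI impI, goal_cases)
    case (2 f s)
    then have s: "s \<in> sect X (Cod C f)" and L: "locally (Cod C f) (\<lambda>h. Q (Dom C h) (rest X h s))"
      by auto
    have "locally (Dom C f) (\<lambda>g. Q (Dom C g) (rest X g (rest X f s)))"
      by (rule locally_rewrite[OF locally_pull[OF L 2(1)]]) (use comp 2 s in blast)
    then show ?case
      using rest_sect[OF X 2(1) s] by simp
  next
    case (3 x s)
    have "locally x (\<lambda>h. Q (Dom C h) (rest X h s))"
    proof (rule locally_trans[OF 3(3,1)])
      fix f g assume f: "f \<in> Ar C" "Cod C f = x" "Q (Dom C f) (rest X f s)" and g: "g \<in> Ar C" "Cod C g = Dom C f"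
      show "Q (Dom C (f \<cdot>\<^bsub>C\<^esub> g)) (rest X (f \<cdot>\<^bsub>C\<^esub> g) s)"
        using comp[OF f(1) g] Q[OF g(1), of "rest X f s"] rest_sect[OF X f(1)] f g 3 by simp
    next
      fix f assume f: "f \<in> Ar C" "Cod C f = x"
        "rest X f s \<in> {s \<in> sect X (Dom C f). locally (Dom C f) (\<lambda>h. Q (Dom C h) (rest X h s))}"
      then have "locally (Dom C f) (\<lambda>g. Q (Dom C g) (rest X g (rest X f s)))"
        by simp
      then show "locally (Dom C f) (\<lambda>g. Q (Dom C (f \<cdot>\<^bsub>C\<^esub> g)) (rest X (f \<cdot>\<^bsub>C\<^esub> g) s))"
        by (rule locally_rewrite) (use comp 3 f in blast)
    qed
    then show ?case
      using 3 by simp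
  qed auto
qed

text \<open>An atom has no proper nonempty subsheaf, so a property of one section spreads to all of them.\<close>

lemma atom_locally:
  assumes A: "atom E A"
    and Q: "\<And>h s. h \<in> Ar C \<Longrightarrow> s \<in> sect A (Cod C h) \<Longrightarrow> Q (Cod C h) s \<Longrightarrow> Q (Dom C h) (rest A h s)"
    and x: "x \<in> Ob C" "\<not> null x" and s: "s \<in> sect A x" "Q x s"
    and y: "y \<in> Ob C" and t: "t \<in> sect A y"
  shows "locally y (\<lambda>h. Q (Dom C h) (rest A h t))"
proof -
  let ?K = "\<lambda>x. {s \<in> sect A x. locally x (\<lambda>h. Q (Dom C h) (rest A h s))}"
  note AO = atom_Ob[OF A]
  have sub: "subsheaf (Sec A) ?K"
    using AO by (rule subsheaf_local_closure) (rule Q)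
  obtain M m where M: "M \<in> Ob E" and m: "m \<in> hom E M A" "injective M m"
    and K: "\<And>x. x \<in> Ob C \<Longrightarrow> act m x ` sect M x = ?K x"
    by (rule subobject_of_subsheaf[OF AO sub]) (rule that)
  \<comment> \<open>This section over a non-null object prevents the subobject \<open>M\<close> from
    being initial, so atomicity of \<open>A\<close> forces \<open>m\<close> to be an isomorphism and
    \<open>?K\<close> to contain every section.\<close>
  have "s \<in> ?K x"
    using Q s x by (auto intro: locally_all)
  then obtain p where "p \<in> sect M x"
    using K[OF x(1)] by blast
  then have "\<not> initial E M"
    using initial_imp_null x by blast
  moreover have "m \<in> monos_into E A"
    using m injective_imp_mono by (auto simp: monos_into_def hom_def)
  moreover have "Dom E m = M"
    using m by (simp add: hom_def)
  ultimately have "iso E m"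
    using A unfolding atom_def by blast
  then obtain k where k: "k \<in> hom E A M" "m \<cdot> k = Id E A"
    using E.iso_inverse[OF _ m(1)] by blast
  have "act m y (act k y t) = t"
    using act_comp[OF k(1) m(1) y t] k(2) act_Id[OF AO y t] by simp
  moreover have "act m y (act k y t) \<in> ?K y"
    unfolding K[OF y, symmetric] using act_sect[OF k(1) y t] by (rule imageI)
  ultimately show ?thesis
    by simp
qed

text \<open>The equalizer of \<open>f\<close> and \<open>g\<close> contains a section over a
  non-null object; inside an atom it is therefore everything.\<close>

lemma atom_arrow_eq:
  assumes A: "atom E A" and f: "f \<in> hom E A Y" and g: "g \<in> hom E A Y"
    and x: "x \<in> Ob C" "\<not> null x" and s: "s \<in> sect A x" "act f x s = act g x s"
  shows "f = g"
proof (rule arrow_eq_locally[OF f g])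
  fix y t assume "y \<in> Ob C" "t \<in> sect A y"
  from atom_locally[OF A, of "\<lambda>x s. act f x s = act g x s", OF _ x s this]
  show "locally y (\<lambda>h. act f (Dom C h) (rest A h t) = act g (Dom C h) (rest A h t))"
    using act_rest[OF f] act_rest[OF g] by simp
qed

text \<open>The pullback of \<open>N\<close> along \<open>g\<close> contains \<open>s\<close>, hence
  is all of \<open>A\<close>; the lift is glued from preimages under \<open>n\<close>.\<close>

lemma atom_lift:
  assumes A: "atom E A" and g: "g \<in> hom E A X" and n: "n \<in> hom E N X" "injective N n"
    and x: "x \<in> Ob C" "\<not> null x" and s: "s \<in> sect A x" and p: "p \<in> sect N x" and eq: "act g x s = act n x p"
  obtains h where "h \<in> hom E A N" and "n \<cdot> h = g"
proof -
  \<comment> \<open>The graph of the lift: \<open>q\<close> is unique because \<open>n\<close> is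
    injective on sections, and it exists locally for every section because it exists for
    one.\<close>
  define R where "R x s q \<longleftrightarrow> s \<in> sect A x \<and> q \<in> sect N x \<and> act g x s = act n x q" for x s q
  have NO: "N \<in> Ob E"
    using E.hom_Ob[OF n(1)] by blast
  note AO = atom_Ob[OF A]
  have R: "R (Dom C h) (rest A h s) (rest N h q)" if "h \<in> Ar C" "R (Cod C h) s q" for h s q
    using that rest_sect[OF AO] rest_sect[OF NO] act_rest[OF g] act_rest[OF n(1)] by (auto simp: R_def)
  have total: "locally y (\<lambda>h. \<exists>q. R (Dom C h) (rest A h t) q)" if "y \<in> Ob C" "t \<in> sect A y" for y t
  proof (rule atom_locally[OF A, of "\<lambda>x s. \<exists>q. R x s q"])
    show "\<exists>q. R x s q"
      using s p eq by (auto simp: R_def)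
  qed (use R x s that in blast)+
  obtain h where h: "h \<in> hom E A N" "\<And>x s q. x \<in> Ob C \<Longrightarrow> R x s q \<Longrightarrow> act h x s = q"
  proof (rule glue_arrow[OF AO NO, of R])
    show "q = q'" if "x \<in> Ob C" "R x s q" "R x s q'" for x s q q'
      using injectiveD[OF n(2) that(1), of q q'] that(2,3) by (simp add: R_def)
    show "a \<in> sect A x \<and> b \<in> sect N x" if "R x a b" for x a b
      using that by (simp add: R_def)
  qed (rule R total that; assumption)+
  note nh = E.Comp_in_hom[OF h(1) n(1)]
  have "n \<cdot> h = g"
  proof (rule atom_arrow_eq[OF A nh g x s])
    have "R x s p"
      using s p eq by (simp add: R_def)
    then show "act (n \<cdot> h) x s = act g x s"
      using act_comp[OF h(1) n(1) x(1) s] h(2)[OF x(1)] eq by simp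
  qed
  with h that show thesis
    by blast
qed

lemma coproduct_exists:
  assumes "small TYPE('u) I" and A: "\<forall>i\<in>I. A i \<in> Ob E"
  obtains X c where "coproduct I E A X c"
proof -
  let ?D = "\<lparr>omap = A, amap = \<lambda>i. Id E (A i)\<rparr>"
  have "small TYPE('u) (Ob (discrete_cat I))"
    using assms by (simp add: discrete_cat_def)
  moreover have D: "functor (discrete_cat I) E ?D"
    using A by (rule E.functor_discrete)
  ultimately obtain X c where "sectionwise_colimit (discrete_cat I) ?D X c"
    using sectionwise_colimit_exists[OF category_discrete_cat] by blast
  then have "colimit (discrete_cat I) E ?D X c"
    using sectionwise_colimit_imp_colimit[OF category_discrete_cat D] by blast
  then show thesis
    using that unfolding coproduct_def by blast
qed

context
  fixes I :: "'i set" and A X c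
  assumes I: "small TYPE('u) I" and A: "\<forall>i\<in>I. A i \<in> Ob E" and X: "coproduct I E A X c"
begin

lemma coproduct_sectionwise:
  "sectionwise_colimit (discrete_cat I) \<lparr>omap = A, amap = \<lambda>i. Id E (A i)\<rparr> X c"
  using colimit_imp_sectionwise[OF category_discrete_cat E.functor_discrete[OF A]] X I
  by (simp add: coproduct_def discrete_cat_def)

lemma coprojection: "i \<in> I \<Longrightarrow> c i \<in> hom E (A i) X"
  using E.coprojection_hom[OF X A] .

text \<open>In a discrete diagram the generating steps are identities, so stage equality is plain
  equality of pairs; only the passage to a cover remains.\<close>

lemma coproduct_sections_eq:
  assumes x: "x \<in> Ob C" and i: "i \<in> I" "p \<in> sect (A i) x" and j: "j \<in> I" "q \<in> sect (A j) x"
    and eq: "act (c i) x p = act (c j) x q"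
  shows "locally x (\<lambda>h. i = j \<and> rest (A i) h p = rest (A j) h q)"
proof -
  let ?D = "\<lparr>omap = A, amap = \<lambda>i. Id E (A i)\<rparr>"
  have "a = b" if "(a, b) \<in> stage_eq (discrete_cat I) ?D x" "x \<in> Ob C" for a b x
    using that(1)
    by (induction rule: set_colimit_rel_induct) (use A act_Id that(2) in \<open>auto simp: discrete_cat_def\<close>)
  moreover have "colim_eq (discrete_cat I) ?D x (i, p) (j, q)"
    using sectionwise_colimit_eq[OF coproduct_sectionwise x, of i p j q] assms by (simp add: discrete_cat_def)
  ultimately show ?thesis
    unfolding colim_eq_def by (elim locally_mono[OF _ x])
      (use A i j x Dom_in_Ob in \<open>fastforce simp: rest_comp\<close>)+
qed

lemma coprojection_injective:
  assumes i: "i \<in> I"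
  shows "injective (A i) (c i)"
  unfolding injective_def
proof (intro ballI inj_onI)
  fix x p q assume x: "x \<in> Ob C" and p: "p \<in> sect (A i) x" "q \<in> sect (A i) x" "act (c i) x p = act (c i) x q"
  then have "locally x (\<lambda>h. i = i \<and> rest (A i) h p = rest (A i) h q)"
    using coproduct_sections_eq[OF x i _ i] by blast
  then show "p = q"
    using sect_separated[OF bspec[OF A i] _ x] p by simp
qed

text \<open>Over a non-null object the local conclusion \<open>i = j\<close> is attained by some
  arrow, and it does not depend on that arrow.\<close>

lemma coproduct_sections_disjoint:
  assumes "x \<in> Ob C" "\<not> null x" and "i \<in> I" "p \<in> sect (A i) x" and "j \<in> I" "q \<in> sect (A j) x"
    and "act (c i) x p = act (c j) x q"
  shows "i = j"
  using locally_witness[OF coproduct_sections_eq] assms by blast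

lemma coproduct_disjoint:
  assumes T: "atom E T" and i: "i \<in> I" "u \<in> hom E T (A i)" and j: "j \<in> I" "v \<in> hom E T (A j)"
    and eq: "c i \<cdot> u = c j \<cdot> v"
  shows "i = j"
proof -
  obtain x s where x: "x \<in> Ob C" "\<not> null x" and s: "s \<in> sect T x"
    using atom_section[OF T] .
  have "act (c i) x (act u x s) = act (c j) x (act v x s)"
    using act_comp[OF i(2) coprojection[OF i(1)] x(1) s] act_comp[OF j(2) coprojection[OF j(1)] x(1) s] eq by simp
  then show ?thesis
    using coproduct_sections_disjoint[OF x i(1) _ j(1)] act_sect[OF i(2) x(1) s] act_sect[OF j(2) x(1) s] by blast
qed

lemma coproduct_section:
  assumes x: "x \<in> Ob C" "\<not> null x" and a: "a \<in> sect X x"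
  obtains h i p where "h \<in> Ar C" and "Cod C h = x" and "\<not> null (Dom C h)" and "i \<in> I"
    and "p \<in> sect (A i) (Dom C h)" and "rest X h a = act (c i) (Dom C h) p"
  using locally_witness[OF sectionwise_colimit_cover[OF coproduct_sectionwise x(1) a] x] that
  by (auto simp: discrete_cat_def)

text \<open>One section of \<open>T\<close> comes, on a non-null piece, from a single summand; since
  the coprojection is injective, the whole arrow lifts.\<close>

lemma coproduct_factor:
  assumes T: "atom E T" and t: "t \<in> hom E T X"
  obtains i h where "i \<in> I" and "h \<in> hom E T (A i)" and "c i \<cdot> h = t"
proof -
  obtain x s where x: "x \<in> Ob C" "\<not> null x" and s: "s \<in> sect T x"
    using atom_section[OF T] .
  obtain h i p where h: "h \<in> Ar C" "Cod C h = x" "\<not> null (Dom C h)" and i: "i \<in> I" "p \<in> sect (A i) (Dom C h)"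
    and eq: "rest X h (act t x s) = act (c i) (Dom C h) p"
    using coproduct_section[OF x act_sect[OF t x(1) s]] .
  have "act t (Dom C h) (rest T h s) = act (c i) (Dom C h) p"
    using act_rest[OF t h(1)] h(2) s eq by simp
  moreover have "rest T h s \<in> sect T (Dom C h)"
    using rest_sect[OF atom_Ob[OF T] h(1)] h(2) s by simp
  ultimately show thesis
    using atom_lift[OF T t coprojection[OF i(1)] coprojection_injective[OF i(1)] Dom_in_Ob[OF h(1)] h(3) _ i(2)]
      that[OF i(1)] by blast
qed

end

end

section \<open>Finite objects\<close>

context category
begin

lemma monoD:
  assumes "mono C m" and "m \<in> hom C Y Z" and "f \<in> hom C X Y" and "g \<in> hom C X Y" and "m \<cdot> f = m \<cdot> g"
  shows "f = g"
  using assms by (auto simp: mono_def hom_def)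

lemma monoI:
  assumes m: "m \<in> hom C Y Z"
    and "\<And>X f g. f \<in> hom C X Y \<Longrightarrow> g \<in> hom C X Y \<Longrightarrow> m \<cdot> f = m \<cdot> g \<Longrightarrow> f = g"
  shows "mono C m"
  using assms by (auto simp: mono_def hom_def)

lemma mono_comp:
  assumes m: "mono C m" "m \<in> hom C Y Z" and n: "mono C n" "n \<in> hom C X Y"
  shows "mono C (m \<cdot> n)"
proof (rule monoI[OF Comp_in_hom[OF n(2) m(2)]])
  fix W f g assume f: "f \<in> hom C W X" and g: "g \<in> hom C W X" and "m \<cdot> n \<cdot> f = m \<cdot> n \<cdot> g"
  then have "m \<cdot> (n \<cdot> f) = m \<cdot> (n \<cdot> g)"
    using Comp_assoc[OF f n(2) m(2)] Comp_assoc[OF g n(2) m(2)] by simp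
  then have "n \<cdot> f = n \<cdot> g"
    using monoD[OF m] Comp_in_hom[OF f n(2)] Comp_in_hom[OF g n(2)] by blast
  then show "f = g"
    using monoD[OF n] f g by blast
qed

lemma mono_right_factor:
  assumes mn: "mono C (m \<cdot> n)" and m: "m \<in> hom C Y Z" and n: "n \<in> hom C X Y"
  shows "mono C n"
proof (rule monoI[OF n])
  fix W f g assume f: "f \<in> hom C W X" and g: "g \<in> hom C W X" and "n \<cdot> f = n \<cdot> g"
  then have "m \<cdot> n \<cdot> f = m \<cdot> n \<cdot> g"
    using Comp_assoc[OF f n m] Comp_assoc[OF g n m] by simp
  then show "f = g"
    using monoD[OF mn Comp_in_hom[OF n m]] f g by blast
qed

lemma factors_through_iff:
  assumes "m \<in> hom C X Z" and "n \<in> hom C Y Z"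
  shows "factors_through C m n \<longleftrightarrow> (\<exists>h\<in>hom C X Y. n \<cdot> h = m)"
  using assms by (simp add: factors_through_def hom_def)

lemma factors_through_trans:
  assumes "m \<in> hom C X V" and "n \<in> hom C Y V" and "p \<in> hom C Z V"
    and "factors_through C m n" and "factors_through C n p"
  shows "factors_through C m p"
proof -
  obtain h k where h: "h \<in> hom C X Y" "n \<cdot> h = m" and k: "k \<in> hom C Y Z" "p \<cdot> k = n"
    using assms factors_through_iff by metis
  then have "p \<cdot> (k \<cdot> h) = m"
    using Comp_assoc[OF h(1) k(1) assms(3)] by simp
  then show ?thesis
    using Comp_in_hom[OF h(1) k(1)] factors_through_iff[OF assms(1,3)] by blast
qed

lemma factors_through_refl: "m \<in> Ar C \<Longrightarrow> factors_through C m m"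
  unfolding factors_through_def using Comp_Id Id_in_hom Dom_in_Ob by (auto simp: hom_def)

abbreviation mono_equiv :: "'o \<Rightarrow> 'a rel"
  where "mono_equiv X \<equiv> {(m, n). m \<in> monos_into C X \<and> n \<in> monos_into C X \<and>
    factors_through C m n \<and> factors_through C n m}"

lemma monos_into_hom: "m \<in> monos_into C X \<Longrightarrow> m \<in> hom C (Dom C m) X"
  by (auto simp: monos_into_def mono_def hom_def)

lemma equiv_mono_equiv: "equiv (monos_into C X) (mono_equiv X)"
proof (rule equivI)
  show "refl_on (monos_into C X) (mono_equiv X)"
    using factors_through_refl monos_into_hom by (auto simp: refl_on_def hom_def)
  show "trans (mono_equiv X)"
    using factors_through_trans monos_into_hom by (auto simp: trans_def) blast+
qed (auto simp: sym_def)

lemma in_subobject_iff: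
  assumes "m \<in> monos_into C X"
  shows "n \<in> mono_equiv X `` {m} \<longleftrightarrow> n \<in> monos_into C X \<and> factors_through C m n \<and> factors_through C n m"
  using assms by auto

lemma subobjectsE:
  assumes "B \<in> subobjects C X"
  obtains m where "m \<in> monos_into C X" and "B = mono_equiv X `` {m}"
  using assms unfolding subobjects_def by (rule quotientE)

lemma subobjectI: "m \<in> monos_into C X \<Longrightarrow> mono_equiv X `` {m} \<in> subobjects C X"
  unfolding subobjects_def by (rule quotientI)

lemma subobject_self: "m \<in> monos_into C X \<Longrightarrow> m \<in> mono_equiv X `` {m}"
  using in_subobject_iff factors_through_refl monos_into_hom by (auto simp: hom_def)

lemma subobject_eqI:
  assumes "m \<in> monos_into C X" and "n \<in> monos_into C X" and "factors_through C m n" and "factors_through C n m"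
  shows "mono_equiv X `` {m} = mono_equiv X `` {n}"
  using assms by (intro equiv_class_eq[OF equiv_mono_equiv]) auto

lemma subobject_le_iff:
  assumes m: "m \<in> monos_into C X" and n: "n \<in> monos_into C X"
  shows "subobject_le C (mono_equiv X `` {m}) (mono_equiv X `` {n}) \<longleftrightarrow> factors_through C m n"
proof
  assume "subobject_le C (mono_equiv X `` {m}) (mono_equiv X `` {n})"
  then obtain m' n' where *: "m' \<in> mono_equiv X `` {m}" "n' \<in> mono_equiv X `` {n}" "factors_through C m' n'"
    by (auto simp: subobject_le_def)
  then have "m' \<in> monos_into C X" "factors_through C m m'" "n' \<in> monos_into C X" "factors_through C n' n"
    using in_subobject_iff m n by auto
  then show "factors_through C m n"
    using * m n monos_into_hom factors_through_trans by meson
next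
  assume "factors_through C m n"
  then show "subobject_le C (mono_equiv X `` {m}) (mono_equiv X `` {n})"
    using subobject_self m n by (auto simp: subobject_le_def)
qed

end

section \<open>The atoms of a coproduct of atoms\<close>

locale presented_atomic_topos = presented_topos C J E Sec act
  for C :: "('c, 'd) cat" and J :: "'c \<Rightarrow> 'd set set" and E :: "('o, 'a) cat" (structure)
    and Sec :: "'o \<Rightarrow> ('c, 'd, 'u) psh" and act :: "'a \<Rightarrow> 'c \<Rightarrow> 'u \<Rightarrow> 'u" +
  assumes atomic: "X \<in> Ob E \<Longrightarrow> \<exists>(I :: 'u set) A c. small TYPE('u) I \<and> (\<forall>i\<in>I. atom E (A i)) \<and> coproduct I E A X c"
begin

text \<open>Strictness of the initial object, seen on a section over a non-null object. It makes
  non-emptiness of a subobject independent of the representing mono.\<close>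

lemma noninitial_hom:
  assumes h: "h \<in> hom E X Y" and X: "\<not> initial E X"
  shows "\<not> initial E Y"
proof -
  have "X \<in> Ob E"
    using E.hom_Ob[OF h] by blast
  then obtain x s where "x \<in> Ob C" "\<not> null x" "s \<in> sect X x"
    using noninitial_section[OF _ X] by blast
  then show ?thesis
    using initial_imp_null act_sect[OF h] by blast
qed

lemma nonempty_subobject_iff:
  assumes m: "m \<in> monos_into E X"
  shows "nonempty_subobject E (E.mono_equiv X `` {m}) \<longleftrightarrow> \<not> initial E (Dom E m)"
proof
  assume "nonempty_subobject E (E.mono_equiv X `` {m})"
  then obtain n where "n \<in> E.mono_equiv X `` {m}" "\<not> initial E (Dom E n)"
    by (auto simp: nonempty_subobject_def)
  then show "\<not> initial E (Dom E m)"
    using noninitial_hom by (auto simp: factors_through_def)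
next
  assume "\<not> initial E (Dom E m)"
  then show "nonempty_subobject E (E.mono_equiv X `` {m})"
    using E.subobject_self[OF m] unfolding nonempty_subobject_def by blast
qed

lemma atom_mono_iso:
  assumes A: "atom E A" and h: "h \<in> hom E M A" "mono E h" and M: "\<not> initial E M"
  shows "iso E h"
proof -
  have "h \<in> monos_into E A" "Dom E h = M"
    using h by (auto simp: monos_into_def hom_def)
  then show ?thesis
    using A M unfolding atom_def by blast
qed

text \<open>The atoms of a coproduct of atoms are exactly its summands, so counting atoms means
  counting indices.\<close>

lemma finite_object_iff:
  assumes I: "small TYPE('u) I" and A: "\<And>i. i \<in> I \<Longrightarrow> atom E (A i)" and X: "coproduct I E A X c"
  shows "finite_object E X \<longleftrightarrow> finite I"
proof -
  have AO: "\<forall>i\<in>I. A i \<in> Ob E"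
    using atom_Ob A by blast
  note c = coprojection[OF I AO X]
  have XO: "X \<in> Ob E"
    using E.coproduct_Ob[OF X AO] .
  have cm: "c i \<in> monos_into E X" if "i \<in> I" for i
    using injective_imp_mono[OF c[OF that] coprojection_injective[OF I AO X that]] c[OF that]
    by (simp add: monos_into_def hom_def)
  have cD: "Dom E (c i) = A i" if "i \<in> I" for i
    using c[OF that] by (simp add: hom_def)
  let ?cl = "\<lambda>m. E.mono_equiv X `` {m}"
  \<comment> \<open>A non-empty subobject below a summand equals it, since the induced mono into the
    atom \<open>A i\<close> is an isomorphism. This gives minimality of the summands and is reused
    for surjectivity.\<close>
  have below: "factors_through E (c i) n"
    if i: "i \<in> I" and n: "n \<in> monos_into E X" "\<not> initial E (Dom E n)" and le: "factors_through E n (c i)" for i n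
  proof -
    note nX = E.monos_into_hom[OF n(1)]
    obtain h where h: "h \<in> hom E (Dom E n) (A i)" "c i \<cdot> h = n"
      using le E.factors_through_iff[OF nX c[OF i]] by blast
    have "mono E n"
      using n by (simp add: monos_into_def)
    then have "mono E h"
      using E.mono_right_factor[OF _ c[OF i] h(1)] h(2) by simp
    then have "iso E h"
      using atom_mono_iso[OF A[OF i] h(1)] n(2) by blast
    then obtain k where k: "k \<in> hom E (A i) (Dom E n)" "h \<cdot> k = Id E (A i)"
      using E.iso_inverse[OF _ h(1)] by blast
    have "n \<cdot> k = c i"
      using E.Comp_assoc[OF k(1) h(1) c[OF i]] k(2) h(2) E.Comp_Id[OF c[OF i]] by simp
    then show ?thesis
      using k(1) E.factors_through_iff[OF c[OF i] nX] by blast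
  qed
  have cl_atom: "?cl (c i) \<in> atoms_of E X" if i: "i \<in> I" for i
    unfolding atoms_of_def
  proof (intro CollectI conjI ballI impI)
    show "?cl (c i) \<in> subobjects E X"
      using E.subobjectI[OF cm[OF i]] .
    show "nonempty_subobject E (?cl (c i))"
      using nonempty_subobject_iff[OF cm[OF i]] cD[OF i] A[OF i] by (simp add: atom_def)
    fix B assume "B \<in> subobjects E X" and B: "nonempty_subobject E B \<and> subobject_le E B (?cl (c i))"
    then obtain n where n: "n \<in> monos_into E X" "B = ?cl n"
      by (auto elim: E.subobjectsE)
    have "\<not> initial E (Dom E n)" and le: "factors_through E n (c i)"
      using B nonempty_subobject_iff[OF n(1)] E.subobject_le_iff[OF n(1) cm[OF i]] n(2) by auto
    then have "factors_through E (c i) n"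
      using below[OF i n(1)] by blast
    then show "B = ?cl (c i)"
      unfolding n(2) using E.subobject_eqI[OF n(1) cm[OF i] le] by blast
  qed
  have inj: "inj_on (\<lambda>i. ?cl (c i)) I"
  proof (rule inj_onI)
    fix i j assume i: "i \<in> I" and j: "j \<in> I" and eq: "?cl (c i) = ?cl (c j)"
    then have "factors_through E (c i) (c j)"
      using E.subobject_self[OF cm[OF i]] E.in_subobject_iff[OF cm[OF j]] by blast
    then obtain h where h: "h \<in> hom E (A i) (A j)" "c j \<cdot> h = c i"
      using E.factors_through_iff[OF c[OF i] c[OF j]] by blast
    then have "c i \<cdot> Id E (A i) = c j \<cdot> h"
      using E.Comp_Id[OF c[OF i]] by simp
    then show "i = j"
      using coproduct_disjoint[OF I AO X A[OF i] i E.Id_in_hom[OF bspec[OF AO i]] j h(1)] by blast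
  qed
  \<comment> \<open>The subobject \<open>m\<close> contains an atom \<open>B' k\<close> of the
    decomposition of its domain. This atom lands in some summand and, by \<open>below\<close>,
    equals it; so the summand lies below \<open>m\<close>, and minimality of \<open>m\<close> makes
    them equal.\<close>
  have surj: "\<exists>i\<in>I. B = ?cl (c i)" if B: "B \<in> atoms_of E X" for B
  proof -
    obtain m where m: "m \<in> monos_into E X" "B = ?cl m"
      using B unfolding atoms_of_def by (auto elim: E.subobjectsE)
    have M: "\<not> initial E (Dom E m)"
      using B nonempty_subobject_iff[OF m(1)] m(2) by (auto simp: atoms_of_def)
    note mX = E.monos_into_hom[OF m(1)]
    have MO: "Dom E m \<in> Ob E"
      using E.hom_Ob[OF mX] by blast
    obtain K :: "'u set" and B' b where K: "small TYPE('u) K" and B': "\<And>k. k \<in> K \<Longrightarrow> atom E (B' k)"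
      and b: "coproduct K E B' (Dom E m) b"
      using atomic[OF MO] by blast
    have B'O: "\<forall>k\<in>K. B' k \<in> Ob E"
      using atom_Ob B' by blast
    obtain x s where "x \<in> Ob C" "\<not> null x" "s \<in> sect (Dom E m) x"
      using noninitial_section[OF MO M] .
    then obtain k where k: "k \<in> K"
      using coproduct_section[OF K B'O b] by blast
    note bk = coprojection[OF K B'O b k]
    note mb = E.Comp_in_hom[OF bk mX]
    obtain i h where i: "i \<in> I" and h: "h \<in> hom E (B' k) (A i)" and ch: "c i \<cdot> h = m \<cdot> b k"
      using coproduct_factor[OF I AO X B'[OF k] mb] .
    have "mono E (m \<cdot> b k)"
      using m mX bk injective_imp_mono[OF bk coprojection_injective[OF K B'O b k]]
      by (intro E.mono_comp) (auto simp: monos_into_def)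
    then have "m \<cdot> b k \<in> monos_into E X" and D: "Dom E (m \<cdot> b k) = B' k"
      using mb by (auto simp: monos_into_def hom_def)
    moreover have "\<not> initial E (B' k)"
      using B'[OF k] by (simp add: atom_def)
    moreover have "factors_through E (m \<cdot> b k) (c i)"
      using E.factors_through_iff[OF mb c[OF i]] h ch by blast
    ultimately have "factors_through E (c i) (m \<cdot> b k)"
      using below[OF i] by simp
    moreover have "factors_through E (m \<cdot> b k) m"
      using E.factors_through_iff[OF mb mX] bk by blast
    ultimately have "factors_through E (c i) m"
      using E.factors_through_trans[OF c[OF i] mb mX] by blast
    then have "?cl (c i) = ?cl m"
      using B cl_atom[OF i] E.subobject_le_iff[OF cm[OF i] m(1)] unfolding m(2) atoms_of_def by blast
    then show ?thesis
      using i m(2) by blast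
  qed
  have "bij_betw (\<lambda>i. ?cl (c i)) I (atoms_of E X)"
    using inj cl_atom surj unfolding bij_betw_def by blast
  then show ?thesis
    unfolding finite_object_def using XO bij_betw_finite by blast
qed

end

section \<open>Directed colimits\<close>

lemma iso_full_subcategory:
  assumes "iso (full_subcategory C P) f"
  shows "iso C f"
  using assms by (auto simp: iso_def full_subcategory_def hom_def)

lemma (in category) functor_poset:
  assumes "partial_order_on I r" and "functor (poset_cat I r) C D"
  shows "i \<in> I \<Longrightarrow> omap D i \<in> Ob C"
    and "(i, j) \<in> r \<Longrightarrow> i \<in> I \<and> j \<in> I"
    and "(i, j) \<in> r \<Longrightarrow> amap D (i, j) \<in> hom C (omap D i) (omap D j)"
    and "i \<in> I \<Longrightarrow> amap D (i, i) = Id C (omap D i)"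
    and "(i, j) \<in> r \<Longrightarrow> (j, k) \<in> r \<Longrightarrow> amap D (i, k) = amap D (j, k) \<cdot> amap D (i, j)"
proof -
  show "(i, j) \<in> r \<Longrightarrow> i \<in> I \<and> j \<in> I"
    using category.Dom_in_Ob[OF category_poset_cat[OF assms(1)], of "(i, j)"]
      category.Cod_in_Ob[OF category_poset_cat[OF assms(1)], of "(i, j)"] by (simp add: poset_cat_def)
qed (use assms(2) in \<open>force simp: functor_def poset_cat_def\<close>)+

text \<open>Arrows between atoms of a topos are epimorphisms, hence the name. Targets come first in
  the pairs, so well-foundedness forbids infinite sequences of composable non-isomorphisms.\<close>

definition (in category) proper_quotients :: "'o rel"
  where "proper_quotients = {(B', B). atom C B \<and> atom C B' \<and> (\<exists>f\<in>hom C B B'. \<not> iso C f)}"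

text \<open>Every infinite sequence of arrows between atoms is a chain indexed by a copy of \<open>\<omega>\<close> inside the universe.\<close>

lemma (in category) wf_atoms:
  assumes U: "strongly_inaccessible TYPE('u)" and cwf: "co_well_founded TYPE('u) (category_of_atoms C)"
  shows "wf proper_quotients"
  unfolding proper_quotients_def wf_iff_no_infinite_down_chain
proof
  let ?A = "category_of_atoms C"
  assume "\<exists>B. \<forall>n. (B (Suc n), B n) \<in> {(B', B). atom C B \<and> atom C B' \<and> (\<exists>f\<in>hom C B B'. \<not> iso C f)}"
  then obtain B where "\<forall>n. atom C (B n) \<and> (\<exists>f\<in>hom C (B n) (B (Suc n)). \<not> iso C f)"
    by auto
  then obtain f where B: "\<And>n. atom C (B n)" and f: "\<And>n. f n \<in> hom C (B n) (B (Suc n))" and ni: "\<And>n. \<not> iso C (f n)"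
    by metis
  have BO: "B n \<in> Ob C" for n
    using B by (simp add: atom_def)
  \<comment> \<open>The composite of the \<open>k\<close> arrows that start at \<open>B m\<close>;
    counting by length instead of by endpoint gives a plain recursion.\<close>
  define g where "g m k = rec_nat (Id C (B m)) (\<lambda>k h. f (m + k) \<cdot> h) k" for m k
  have g0: "g m 0 = Id C (B m)" and gS: "g m (Suc k) = f (m + k) \<cdot> g m k" for m k
    by (simp_all add: g_def)
  have g: "g m k \<in> hom C (B m) (B (m + k))" for m k
    by (induction k) (use g0 gS Id_in_hom[OF BO] Comp_in_hom f in auto)
  have g_add: "g m (k + l) = g (m + k) l \<cdot> g m k" for m k l
  proof (induction l)
    case 0
    then show ?case
      using g0 Id_Comp[OF g] by simp
  next
    case (Suc l)
    then show ?case
      using gS[of m "k + l"] gS[of "m + k" l] Comp_assoc[OF g[of m k] g[of "m + k" l] f] by (simp add: add.assoc)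
  qed
  obtain e :: "nat \<Rightarrow> 'u" where e: "inj e"
    using small_nat[OF U, of UNIV] by (rule small_obtains_inj)
  define r where "r = {(e m, e n) |m n. m \<le> n}"
  define D where "D = \<lparr>omap = \<lambda>u. B (inv e u), amap = \<lambda>(u, v). g (inv e u) (inv e v - inv e u)\<rparr>"
  have ie: "inv e (e n) = n" for n
    using e by simp
  have re: "(e m, e n) \<in> r \<longleftrightarrow> m \<le> n" for m n
    using e by (auto simp: r_def inj_eq)
  have "well_order_on (range e) r"
    unfolding well_order_on_def linear_order_on_def partial_order_on_def preorder_on_def
  proof (intro conjI)
    have "wf (inv_image {(m :: nat, n). m < n} (inv e))"
      by (intro wf_inv_image wf)
    then show "wf (r - Relation.Id)"
      by (rule wf_subset) (auto simp: r_def ie)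
  qed (auto simp: refl_on_def trans_def antisym_def total_on_def re r_def inj_eq[OF e])
  moreover have "functor (poset_cat (range e) r) ?A D"
    unfolding functor_def
  proof (intro conjI ballI impI)
    fix p assume "p \<in> Ar (poset_cat (range e) r)"
    then obtain m n where p: "p = (e m, e n)" "m \<le> n"
      by (auto simp: poset_cat_def r_def)
    have "g m (n - m) \<in> hom C (B m) (B n)"
      using g[of m "n - m"] p(2) by simp
    then show "amap D p \<in> hom ?A (omap D (Dom (poset_cat (range e) r) p)) (omap D (Cod (poset_cat (range e) r) p))"
      using B by (auto simp: p D_def poset_cat_def ie category_of_atoms_def full_subcategory_def hom_def)
    fix q assume "q \<in> Ar (poset_cat (range e) r)" "Cod (poset_cat (range e) r) p = Dom (poset_cat (range e) r) q"
    then obtain l where q: "q = (e n, e l)" "n \<le> l"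
      using e by (auto simp: poset_cat_def r_def p inj_eq)
    have "g m (l - m) = g n (l - n) \<cdot> g m (n - m)"
      using g_add[of m "n - m" "l - n"] p q by simp
    then show "amap D (q \<cdot>\<^bsub>poset_cat (range e) r\<^esub> p) = amap D q \<cdot>\<^bsub>?A\<^esub> amap D p"
      by (simp add: p q D_def poset_cat_def ie category_of_atoms_def full_subcategory_def)
  qed (use B BO g0 in \<open>auto simp: D_def poset_cat_def ie category_of_atoms_def full_subcategory_def\<close>)
  ultimately have "chain ?A (range e) r D"
    by (simp add: chain_def)
  moreover have "small TYPE('u) (range e)"
    using small_image[OF small_nat[OF U]] .
  ultimately obtain n where "stabilizes_at ?A r D (e n)"
    using cwf unfolding co_well_founded_def by blast
  \<comment> \<open>Stabilization at \<open>n\<close> is applied to the very next stage, where the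
    transition arrow is \<open>f n\<close> itself.\<close>
  then have "iso ?A (amap D (e n, e (Suc n)))"
    using re[of n "Suc n"] e by (simp add: stabilizes_at_def inj_eq)
  moreover have "amap D (e n, e (Suc n)) = f n"
    using gS[of n 0] g0 Comp_Id[OF f] by (simp add: D_def ie)
  ultimately show False
    using ni[of n] iso_full_subcategory[of C "atom C" "f n"] by (simp add: category_of_atoms_def)
qed

lemma directed_upper_bound:
  assumes "directed_poset I r" and "finite F" and "F \<subseteq> I"
  shows "\<exists>k\<in>I. \<forall>i\<in>F. (i, k) \<in> r"
  using assms(2,3)
proof (induction F)
  case empty
  then show ?case
    using assms(1) by (auto simp: directed_poset_def)
next
  case (insert j F)
  then obtain k where k: "k \<in> I" "\<forall>i\<in>F. (i, k) \<in> r"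
    by blast
  then obtain l where l: "l \<in> I" "(j, l) \<in> r" "(k, l) \<in> r"
    using assms(1) insert unfolding directed_poset_def by blast
  moreover have "(i, l) \<in> r" if "i \<in> F" for i
    using assms(1) k l that unfolding directed_poset_def order_on_defs by (blast dest: transD)
  ultimately show ?case
    by blast
qed

section \<open>Directed diagrams and the comparison map on hom-sets\<close>

context category
begin

context
  fixes I :: "'i set" and r D X c
  assumes dir: "directed_poset I r" and D: "functor (poset_cat I r) C D"
    and cc: "cocone (poset_cat I r) C D X c"
begin

lemma directed_partial_order: "partial_order_on I r"
  using dir by (simp add: directed_poset_def)

lemmas diagram = functor_poset[OF directed_partial_order D]

lemma cocone_hom: "i \<in> I \<Longrightarrow> c i \<in> hom C (omap D i) X"
  using cc by (simp add: cocone_def poset_cat_def)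

lemma cocone_eq: "(i, j) \<in> r \<Longrightarrow> c j \<cdot> amap D (i, j) = c i"
  using cc by (force simp: cocone_def poset_cat_def)

lemma cocone_push:
  assumes "(i, j) \<in> r" and f: "f \<in> hom C K (omap D i)"
  shows "c j \<cdot> (amap D (i, j) \<cdot> f) = c i \<cdot> f"
  using Comp_assoc[OF f diagram(3)[OF assms(1)] cocone_hom] cocone_eq[OF assms(1)] diagram(2)[OF assms(1)] by simp

lemma set_colimit_cocone:
  assumes "((i, f), (j, g)) \<in> set_colimit_rel (poset_cat I r) (\<lambda>i. hom C K (omap D i)) (\<lambda>u g. amap D u \<cdot> g)"
  shows "c i \<cdot> f = c j \<cdot> g"
proof -
  have "c (fst a) \<cdot> snd a = c (fst b) \<cdot> snd b"
    if "(a, b) \<in> set_colimit_rel (poset_cat I r) (\<lambda>i. hom C K (omap D i)) (\<lambda>u g. amap D u \<cdot> g)" for a b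
    using that
  proof (induction rule: set_colimit_rel_induct)
    case (step u f)
    then show ?case
      using cocone_push[of "fst u" "snd u" f K] by (simp add: poset_cat_def)
  qed auto
  from this[OF assms] show ?thesis
    by simp
qed

text \<open>Composition with the legs is constant on each class, so the image is a singleton and
  \<open>the_elem\<close> returns its element.\<close>

lemma the_elem_set_colimit:
  fixes K
  defines "R \<equiv> set_colimit_rel (poset_cat I r) (\<lambda>i. hom C K (omap D i)) (\<lambda>u g. amap D u \<cdot> g)"
  shows "the_elem ((\<lambda>(i, g). c i \<cdot> g) ` (R `` {(i, f)})) = c i \<cdot> f"
proof -
  have "(\<lambda>(i, g). c i \<cdot> g) b = c i \<cdot> f" if "b \<in> R `` {(i, f)}" for b
    using that set_colimit_cocone[of i f _ _ K] unfolding R_def by (cases b) auto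
  then have "(\<lambda>(i, g). c i \<cdot> g) ` (R `` {(i, f)}) = (\<lambda>_. c i \<cdot> f) ` (R `` {(i, f)})"
    by (intro image_cong refl)
  also have "\<dots> = {c i \<cdot> f}"
    by (rule image_constant[of "(i, f)"]) (use set_colimit_rel_refl in \<open>auto simp: R_def\<close>)
  finally show ?thesis
    by simp
qed

text \<open>In a directed diagram any two representatives move to a common stage, so it suffices to
  check injectivity for two arrows into the same stage.\<close>

lemma hom_preserves_colimitI:
  assumes surj: "\<And>g. g \<in> hom C K X \<Longrightarrow> \<exists>i\<in>I. \<exists>f\<in>hom C K (omap D i). c i \<cdot> f = g"
    and inj: "\<And>i f g. i \<in> I \<Longrightarrow> f \<in> hom C K (omap D i) \<Longrightarrow> g \<in> hom C K (omap D i) \<Longrightarrow> c i \<cdot> f = c i \<cdot> g \<Longrightarrow>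
      \<exists>k. (i, k) \<in> r \<and> amap D (i, k) \<cdot> f = amap D (i, k) \<cdot> g"
  shows "hom_preserves_colimit C K (poset_cat I r) D X c"
proof -
  let ?T = "\<lambda>i. hom C K (omap D i)" and ?t = "\<lambda>u g. amap D u \<cdot> g"
  let ?R = "set_colimit_rel (poset_cat I r) ?T ?t"
  let ?v = "\<lambda>q. the_elem ((\<lambda>(i, g). c i \<cdot> g) ` q)"
  have step: "((i, f), (j, amap D (i, j) \<cdot> f)) \<in> ?R" if "(i, j) \<in> r" "f \<in> ?T i" for i j f
    using set_colimit_rel_step[where S = "poset_cat I r" and T = ?T and t = ?t and u = "(i, j)" and x = f] that
    by (simp add: poset_cat_def)
  have rel: "((i, f), (j, g)) \<in> ?R"
    if i: "i \<in> I" "f \<in> ?T i" and j: "j \<in> I" "g \<in> ?T j" and eq: "c i \<cdot> f = c j \<cdot> g" for i j f g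
  proof -
    \<comment> \<open>First a stage \<open>k\<close> common to both, then a stage \<open>l\<close>
      at which the two arrows become equal.\<close>
    obtain k where k: "(i, k) \<in> r" "(j, k) \<in> r"
      using dir i j unfolding directed_poset_def by blast
    have fk: "amap D (i, k) \<cdot> f \<in> ?T k" "amap D (j, k) \<cdot> g \<in> ?T k"
      using Comp_in_hom diagram(3) k i j by blast+
    have "c k \<cdot> (amap D (i, k) \<cdot> f) = c k \<cdot> (amap D (j, k) \<cdot> g)"
      using cocone_push k i j eq by simp
    then obtain l where l: "(k, l) \<in> r" "amap D (k, l) \<cdot> (amap D (i, k) \<cdot> f) = amap D (k, l) \<cdot> (amap D (j, k) \<cdot> g)"
      using inj fk diagram(2)[OF k(1)] by blast
    have "((i, f), (l, amap D (k, l) \<cdot> (amap D (i, k) \<cdot> f))) \<in> ?R"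
      using step[OF k(1) i(2)] step[OF l(1) fk(1)] by (rule set_colimit_rel_trans)
    moreover have "((j, g), (l, amap D (k, l) \<cdot> (amap D (j, k) \<cdot> g))) \<in> ?R"
      using step[OF k(2) j(2)] step[OF l(1) fk(2)] by (rule set_colimit_rel_trans)
    ultimately show ?thesis
      unfolding l(2) by (blast intro: set_colimit_rel_sym set_colimit_rel_trans)
  qed
  show ?thesis
    unfolding hom_preserves_colimit_def bij_betw_def set_colimit_def
  proof (rule conjI)
    show "inj_on ?v ((SIGMA i:Ob (poset_cat I r). ?T i) // ?R)"
    proof (rule inj_onI)
      fix q q' assume "q \<in> (SIGMA i:Ob (poset_cat I r). ?T i) // ?R" "q' \<in> (SIGMA i:Ob (poset_cat I r). ?T i) // ?R"
        and eq: "?v q = ?v q'"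
      then obtain i f j g where q: "i \<in> I" "f \<in> ?T i" "q = ?R `` {(i, f)}" and q': "j \<in> I" "g \<in> ?T j" "q' = ?R `` {(j, g)}"
        by (auto elim!: quotientE simp: poset_cat_def)
      have "((i, f), (j, g)) \<in> ?R"
        using rel[OF q(1,2) q'(1,2)] eq the_elem_set_colimit unfolding q(3) q'(3) by simp
      then show "q = q'"
        unfolding q(3) q'(3) by (blast intro: set_colimit_rel_sym set_colimit_rel_trans)
    qed
    show "?v ` ((SIGMA i:Ob (poset_cat I r). ?T i) // ?R) = hom C K X"
    proof (intro equalityI subsetI)
      fix h assume "h \<in> ?v ` ((SIGMA i:Ob (poset_cat I r). ?T i) // ?R)"
      then obtain i f where "i \<in> I" "f \<in> ?T i" "h = ?v (?R `` {(i, f)})"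
        by (auto elim!: quotientE simp: poset_cat_def)
      then show "h \<in> hom C K X"
        using the_elem_set_colimit Comp_in_hom cocone_hom by simp
    next
      fix h assume "h \<in> hom C K X"
      then obtain i f where i: "i \<in> I" "f \<in> ?T i" "c i \<cdot> f = h"
        using surj by blast
      then have "?R `` {(i, f)} \<in> (SIGMA i:Ob (poset_cat I r). ?T i) // ?R"
        by (intro quotientI) (simp add: poset_cat_def)
      moreover have "h = ?v (?R `` {(i, f)})"
        using the_elem_set_colimit i by simp
      ultimately show "h \<in> ?v ` ((SIGMA i:Ob (poset_cat I r). ?T i) // ?R)"
        by blast
    qed
  qed
qed

lemma hom_preserves_colimit_factor:
  assumes "hom_preserves_colimit C K (poset_cat I r) D X c" and g: "g \<in> hom C K X"
  obtains i f where "i \<in> I" and "f \<in> hom C K (omap D i)" and "c i \<cdot> f = g"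
proof -
  let ?T = "\<lambda>i. hom C K (omap D i)" and ?t = "\<lambda>u g. amap D u \<cdot> g"
  let ?R = "set_colimit_rel (poset_cat I r) ?T ?t"
  have "g \<in> (\<lambda>q. the_elem ((\<lambda>(i, g). c i \<cdot> g) ` q)) ` ((SIGMA i:Ob (poset_cat I r). ?T i) // ?R)"
    using assms unfolding hom_preserves_colimit_def bij_betw_def set_colimit_def by simp
  then obtain i f where "i \<in> I" "f \<in> ?T i" "g = the_elem ((\<lambda>(i, g). c i \<cdot> g) ` (?R `` {(i, f)}))"
    by (auto elim!: quotientE simp: poset_cat_def)
  then show thesis
    using that the_elem_set_colimit by simp
qed

end

end

section \<open>Directed colimits in an atomic topos\<close>

context presented_atomic_topos
begin

lemma injective_iso:
  assumes f: "f \<in> hom E X Y" and iso: "iso E f"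
  shows "injective X f"
  unfolding injective_def
proof (intro ballI inj_onI)
  obtain g where g: "g \<in> hom E Y X" "g \<cdot> f = Id E X"
    using E.iso_inverse[OF iso f] by blast
  have X: "X \<in> Ob E"
    using E.hom_Ob[OF f] by blast
  fix x s t assume x: "x \<in> Ob C" and s: "s \<in> sect X x" and t: "t \<in> sect X x" and eq: "act f x s = act f x t"
  have "act g x (act f x s) = act g x (act f x t)"
    using eq by simp
  then show "s = t"
    using act_comp[OF f g(1) x s] act_comp[OF f g(1) x t] g(2) act_Id[OF X x s] act_Id[OF X x t] by simp
qed

lemma injective_comp:
  assumes f: "f \<in> hom E X Y" "injective X f" and g: "g \<in> hom E Y Z" "injective Y g"
  shows "injective X (g \<cdot> f)"
  unfolding injective_def
proof (intro ballI inj_onI)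
  fix x s t assume x: "x \<in> Ob C" and s: "s \<in> sect X x" and t: "t \<in> sect X x" and eq: "act (g \<cdot> f) x s = act (g \<cdot> f) x t"
  have "act g x (act f x s) = act g x (act f x t)"
    using act_comp[OF f(1) g(1) x s] act_comp[OF f(1) g(1) x t] eq by simp
  then have "act f x s = act f x t"
    using injectiveD[OF g(2) x] act_sect[OF f(1) x] s t by blast
  then show "s = t"
    using injectiveD[OF f(2) x s t] by blast
qed

text \<open>The image of an atom in \<open>Y\<close> is one of the atoms of which \<open>Y\<close> is the coproduct.\<close>

lemma atom_image:
  assumes B: "atom E B" and b: "b \<in> hom E B Y"
  obtains B' q m where "atom E B'" and "q \<in> hom E B B'" and "m \<in> hom E B' Y" and "injective B' m" and "m \<cdot> q = b"
proof -
  have "Y \<in> Ob E"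
    using E.hom_Ob[OF b] by blast
  then obtain I :: "'u set" and A c where I: "small TYPE('u) I" and A: "\<forall>i\<in>I. atom E (A i)" and Y: "coproduct I E A Y c"
    using atomic by blast
  have AO: "\<forall>i\<in>I. A i \<in> Ob E"
    using A atom_Ob by blast
  obtain i h where "i \<in> I" "h \<in> hom E B (A i)" "c i \<cdot> h = b"
    using coproduct_factor[OF I AO Y B b] .
  then show thesis
    using that A coprojection[OF I AO Y] coprojection_injective[OF I AO Y] by blast
qed

context
  fixes I :: "'i set" and r D X c
  assumes dir: "directed_poset I r" and D: "functor (poset_cat I r) E D"
    and X: "colimit (poset_cat I r) E D X c" and I: "small TYPE('u) I"
begin

lemma colimit_cocone: "cocone (poset_cat I r) E D X c"
  using X by (simp add: colimit_def)

lemma directed_po: "partial_order_on I r"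
  using dir by (simp add: directed_poset_def)

lemmas diag = E.functor_poset[OF directed_po D]
lemmas leg = E.cocone_hom[OF dir D colimit_cocone]
lemmas leg_push = E.cocone_push[OF dir D colimit_cocone]

lemma directed_colimit_sectionwise: "sectionwise_colimit (poset_cat I r) D X c"
  using colimit_imp_sectionwise[OF category_poset_cat[OF directed_po] D X] I
  by (simp add: poset_cat_def)

text \<open>Zigzags of generating steps straighten out in a directed diagram: two partial
  comparisons are moved to a common upper bound, so related sections become equal at one later
  stage.\<close>

lemma directed_stage_eq:
  assumes eq: "((i, p), (j, q)) \<in> stage_eq (poset_cat I r) D x" and x: "x \<in> Ob C"
    and i: "i \<in> I" "p \<in> sect (omap D i) x"
  shows "\<exists>k. (i, k) \<in> r \<and> (j, k) \<in> r \<and> act (amap D (i, k)) x p = act (amap D (j, k)) x q"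
proof -
  \<comment> \<open>The disjunct \<open>a = b\<close> serves the reflexive case of the induction,
    which also concerns pairs that are not sections of any stage.\<close>
  define Q where "Q a b \<longleftrightarrow> a = b \<or> (snd a \<in> sect (omap D (fst a)) x \<and> snd b \<in> sect (omap D (fst b)) x \<and>
      (\<exists>k. (fst a, k) \<in> r \<and> (fst b, k) \<in> r \<and> act (amap D (fst a, k)) x (snd a) = act (amap D (fst b, k)) x (snd b)))" for a b
  have move: "act (amap D (i, l)) x p = act (amap D (k, l)) x (act (amap D (i, k)) x p)"
    if "(i, k) \<in> r" "(k, l) \<in> r" "p \<in> sect (omap D i) x" for i k l p
    using act_comp[OF diag(3)[OF that(1)] diag(3)[OF that(2)] x that(3)] diag(5)[OF that(1,2)] by simp
  have refl: "(i, i) \<in> r" if "i \<in> I" for i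
    using directed_po that by (auto simp: order_on_defs refl_on_def)
  have trans: "(i, k) \<in> r" if "(i, j) \<in> r" "(j, k) \<in> r" for i j k
    using directed_po that unfolding order_on_defs by (blast dest: transD)
  have "Q (i, p) (j, q)"
    using eq
  proof (induction rule: set_colimit_rel_induct)
    case (step u s)
    obtain i j where u: "u = (i, j)" "(i, j) \<in> r" and s: "s \<in> sect (omap D i) x"
      using step by (cases u) (auto simp: poset_cat_def)
    have j: "j \<in> I"
      using diag(2)[OF u(2)] by blast
    have s': "act (amap D (i, j)) x s \<in> sect (omap D j) x"
      using act_sect[OF diag(3)[OF u(2)] x s] .
    have "act (amap D (j, j)) x (act (amap D (i, j)) x s) = act (amap D (i, j)) x s"
      using act_Id[OF diag(1)[OF j] x s'] diag(4)[OF j] by simp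
    then show ?case
      unfolding Q_def using s s' u refl[OF j] by (auto simp: poset_cat_def)
  next
    case (trans a b d)
    show ?case
    proof (cases "a = b \<or> b = d")
      case False
      then obtain k l where a: "snd a \<in> sect (omap D (fst a)) x" and b: "snd b \<in> sect (omap D (fst b)) x"
        and d: "snd d \<in> sect (omap D (fst d)) x"
        and k: "(fst a, k) \<in> r" "(fst b, k) \<in> r" "act (amap D (fst a, k)) x (snd a) = act (amap D (fst b, k)) x (snd b)"
        and l: "(fst b, l) \<in> r" "(fst d, l) \<in> r" "act (amap D (fst b, l)) x (snd b) = act (amap D (fst d, l)) x (snd d)"
        using trans unfolding Q_def by blast
      have "k \<in> I" "l \<in> I"
        using diag(2) k(1) l(1) by blast+
      then obtain n where n: "(k, n) \<in> r" "(l, n) \<in> r"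
        using dir unfolding directed_poset_def by blast
      have "act (amap D (fst a, n)) x (snd a) = act (amap D (fst d, n)) x (snd d)"
        using move[OF k(1) n(1) a] move[OF k(2) n(1) b] move[OF l(1) n(2) b] move[OF l(2) n(2) d] k(3) l(3) by simp
      then show ?thesis
        unfolding Q_def using a d \<open>\<And>i j k. (i, j) \<in> r \<Longrightarrow> (j, k) \<in> r \<Longrightarrow> (i, k) \<in> r\<close>[OF k(1) n(1)]
          \<open>\<And>i j k. (i, j) \<in> r \<Longrightarrow> (j, k) \<in> r \<Longrightarrow> (i, k) \<in> r\<close>[OF l(2) n(2)] by blast
    qed (use trans in auto)
  next
    case (sym a b)
    then show ?case
      unfolding Q_def by metis
  qed (simp add: Q_def)
  then show ?thesis
    using refl[OF i(1)] unfolding Q_def by auto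
qed

text \<open>The stage \<open>k\<close> is chosen after the arrow \<open>h\<close>: a cover may be
  infinite, so its pieces need not have a common later stage.\<close>

lemma directed_sections_eq:
  assumes x: "x \<in> Ob C" and i: "i \<in> I" and s: "s \<in> sect (omap D i) x" and t: "t \<in> sect (omap D i) x"
    and eq: "act (c i) x s = act (c i) x t"
  shows "locally x (\<lambda>h. \<exists>k. (i, k) \<in> r \<and>
    act (amap D (i, k)) (Dom C h) (rest (omap D i) h s) = act (amap D (i, k)) (Dom C h) (rest (omap D i) h t))"
proof -
  note Di = diag(1)[OF i]
  have "colim_eq (poset_cat I r) D x (i, s) (i, t)"
    using sectionwise_colimit_eq[OF directed_colimit_sectionwise x _ s _ t eq] i by (simp add: poset_cat_def)
  then have "locally x (\<lambda>h. ((i, rest (omap D i) h s), (i, rest (omap D i) h t)) \<in> stage_eq (poset_cat I r) D (Dom C h))"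
    by (simp add: colim_eq_def)
  then show ?thesis
  proof (rule locally_mono[OF _ x])
    fix h assume h: "h \<in> Ar C" "Cod C h = x"
    note D' = Dom_in_Ob[OF h(1)]
    have rs: "rest (omap D i) h s \<in> sect (omap D i) (Dom C h)" "rest (omap D i) h t \<in> sect (omap D i) (Dom C h)"
      using rest_sect[OF Di h(1)] h(2) s t by auto
    {
      assume "((i, rest (omap D i) h s), (i, rest (omap D i) h t)) \<in> stage_eq (poset_cat I r) D (Dom C h)"
      from directed_stage_eq[OF this D' i rs(1)] show "\<exists>k. (i, k) \<in> r \<and>
        act (amap D (i, k)) (Dom C h) (rest (omap D i) h s) = act (amap D (i, k)) (Dom C h) (rest (omap D i) h t)"
        by blast
    }
    fix g assume g: "g \<in> Ar C" "Cod C g = Dom C h" and "\<exists>k. (i, k) \<in> r \<and>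
      act (amap D (i, k)) (Dom C h) (rest (omap D i) h s) = act (amap D (i, k)) (Dom C h) (rest (omap D i) h t)"
    then obtain k where k: "(i, k) \<in> r"
      "act (amap D (i, k)) (Dom C h) (rest (omap D i) h s) = act (amap D (i, k)) (Dom C h) (rest (omap D i) h t)"
      by blast
    have "act (amap D (i, k)) (Dom C g) (rest (omap D i) g (rest (omap D i) h s))
        = act (amap D (i, k)) (Dom C g) (rest (omap D i) g (rest (omap D i) h t))"
      using act_rest[OF diag(3)[OF k(1)] g(1)] rs g(2) k(2) by simp
    then show "\<exists>k. (i, k) \<in> r \<and> act (amap D (i, k)) (Dom C (h \<cdot>\<^bsub>C\<^esub> g)) (rest (omap D i) (h \<cdot>\<^bsub>C\<^esub> g) s)
        = act (amap D (i, k)) (Dom C (h \<cdot>\<^bsub>C\<^esub> g)) (rest (omap D i) (h \<cdot>\<^bsub>C\<^esub> g) t)"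
      using k(1) comp_in_Ar[of g h] h g rest_comp[OF Di g(1) h(1) g(2)] s t by auto
  qed
qed

text \<open>The stage given by \<open>directed_sections_eq\<close> varies over the cover. For an
  atom one non-null piece is enough: the arrows agree there at stage \<open>k\<close>, and
  \<open>atom_arrow_eq\<close> spreads the equality.\<close>

lemma directed_atom_eq:
  assumes A: "atom E A" and i: "i \<in> I" and f: "f \<in> hom E A (omap D i)" and g: "g \<in> hom E A (omap D i)"
    and eq: "c i \<cdot> f = c i \<cdot> g"
  shows "\<exists>k. (i, k) \<in> r \<and> amap D (i, k) \<cdot> f = amap D (i, k) \<cdot> g"
proof -
  obtain x s where x: "x \<in> Ob C" "\<not> null x" and s: "s \<in> sect A x"
    using atom_section[OF A] .
  have "act (c i) x (act f x s) = act (c i) x (act g x s)"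
    using act_comp[OF f leg[OF i] x(1) s] act_comp[OF g leg[OF i] x(1) s] eq by simp
  from locally_witness[OF directed_sections_eq[OF x(1) i act_sect[OF f x(1) s] act_sect[OF g x(1) s] this] x]
  obtain h k where h: "h \<in> Ar C" "Cod C h = x" "\<not> null (Dom C h)" and k: "(i, k) \<in> r"
    and e: "act (amap D (i, k)) (Dom C h) (rest (omap D i) h (act f x s))
      = act (amap D (i, k)) (Dom C h) (rest (omap D i) h (act g x s))"
    by blast
  note D' = Dom_in_Ob[OF h(1)] and Dk = diag(3)[OF k]
  have rs: "rest A h s \<in> sect A (Dom C h)"
    using rest_sect[OF atom_Ob[OF A] h(1)] h(2) s by simp
  have "act (amap D (i, k) \<cdot> f) (Dom C h) (rest A h s) = act (amap D (i, k) \<cdot> g) (Dom C h) (rest A h s)"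
    using act_comp[OF f Dk D' rs] act_comp[OF g Dk D' rs] act_rest[OF f h(1)] act_rest[OF g h(1)] h(2) s e by simp
  then show ?thesis
    using atom_arrow_eq[OF A E.Comp_in_hom[OF f Dk] E.Comp_in_hom[OF g Dk] D' h(3) rs] k by blast
qed

text \<open>
  The images of \<open>b\<close> at the later stages are successive quotients of the atom \<open>B\<close>; once no further
  proper quotient occurs, the image at that stage embeds into the colimit.
\<close>

lemma directed_image_stabilizes:
  assumes wf: "wf E.proper_quotients"
    and B: "atom E B" and i: "i \<in> I" and b: "b \<in> hom E B (omap D i)"
  obtains k B' q m where "(i, k) \<in> r" and "atom E B'" and "q \<in> hom E B B'" and "m \<in> hom E B' (omap D k)"
    and "m \<cdot> q = amap D (i, k) \<cdot> b" and "injective B' (c k \<cdot> m)"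
proof -
  \<comment> \<open>The atoms that occur as the image of \<open>b\<close> at some later stage; one
    that is minimal for \<open>proper_quotients\<close> is the stable image.\<close>
  define Z where "Z = {B'. atom E B' \<and> (\<exists>k q m. (i, k) \<in> r \<and> q \<in> hom E B B' \<and> m \<in> hom E B' (omap D k) \<and>
    injective B' m \<and> m \<cdot> q = amap D (i, k) \<cdot> b)}"
  have trans: "(i, k) \<in> r" if "(i, j) \<in> r" "(j, k) \<in> r" for i j k
    using directed_po that unfolding order_on_defs by (blast dest: transD)
  have ii: "(i, i) \<in> r"
    using directed_po i by (auto simp: order_on_defs refl_on_def)
  obtain B1 q1 m1 where "atom E B1" "q1 \<in> hom E B B1" "m1 \<in> hom E B1 (omap D i)" "injective B1 m1" "m1 \<cdot> q1 = b"
    using atom_image[OF B b] .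
  moreover have "amap D (i, i) \<cdot> b = b"
    using diag(4)[OF i] E.Id_Comp[OF b] by simp
  ultimately have "B1 \<in> Z"
    using ii unfolding Z_def by (intro CollectI conjI exI[of _ i] exI[of _ q1] exI[of _ m1]) simp_all
  then obtain B' where B': "B' \<in> Z" and min: "\<And>B''. atom E B' \<Longrightarrow> atom E B'' \<Longrightarrow> \<exists>f\<in>hom E B' B''. \<not> iso E f \<Longrightarrow> B'' \<notin> Z"
    by (rule wfE_min[OF wf]) (auto simp: E.proper_quotients_def)
  then obtain k q m where aB': "atom E B'" and k: "(i, k) \<in> r" and q: "q \<in> hom E B B'"
    and m: "m \<in> hom E B' (omap D k)" "injective B' m" and mq: "m \<cdot> q = amap D (i, k) \<cdot> b"
    unfolding Z_def by blast
  have kI: "k \<in> I"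
    using diag(2)[OF k] by blast
  \<comment> \<open>The image of \<open>B'\<close> at a later stage is again an image of
    \<open>B\<close>, hence in \<open>Z\<close>. Minimality makes the quotient map \<open>q'\<close>
    an isomorphism, so \<open>B'\<close> still embeds at stage \<open>l\<close>.\<close>
  have inj: "injective B' (amap D (k, l) \<cdot> m)" if l: "(k, l) \<in> r" for l
  proof -
    note Dl = diag(3)[OF l]
    obtain B'' q' m' where B'': "atom E B''" and q': "q' \<in> hom E B' B''" and m': "m' \<in> hom E B'' (omap D l)" "injective B'' m'"
      and mq': "m' \<cdot> q' = amap D (k, l) \<cdot> m"
      using atom_image[OF aB' E.Comp_in_hom[OF m(1) Dl]] .
    have "m' \<cdot> (q' \<cdot> q) = amap D (k, l) \<cdot> m \<cdot> q"
      using E.Comp_assoc[OF q q' m'(1)] mq' by simp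
    also have "\<dots> = amap D (k, l) \<cdot> (amap D (i, k) \<cdot> b)"
      using E.Comp_assoc[OF q m(1) Dl] mq by simp
    also have "\<dots> = amap D (i, l) \<cdot> b"
      using E.Comp_assoc[OF b diag(3)[OF k] Dl] diag(5)[OF k l] by simp
    finally have "B'' \<in> Z"
      unfolding Z_def using B'' trans[OF k l] E.Comp_in_hom[OF q q'] m' by blast
    then have "iso E q'"
      using min[OF aB' B''] q' by blast
    then have "injective B' (m' \<cdot> q')"
      using injective_comp[OF q' injective_iso[OF q'] m'] by blast
    then show ?thesis
      using mq' by simp
  qed
  have "injective B' (c k \<cdot> m)"
    unfolding injective_def
  proof (intro ballI inj_onI)
    fix x s t assume x: "x \<in> Ob C" and s: "s \<in> sect B' x" and t: "t \<in> sect B' x"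
      and eq: "act (c k \<cdot> m) x s = act (c k \<cdot> m) x t"
    have "act (c k) x (act m x s) = act (c k) x (act m x t)"
      using act_comp[OF m(1) leg[OF kI] x s] act_comp[OF m(1) leg[OF kI] x t] eq by simp
    note L = directed_sections_eq[OF x kI act_sect[OF m(1) x s] act_sect[OF m(1) x t] this]
    \<comment> \<open>Equality in the colimit is equality at some stage on each piece of a cover,
      and \<open>B'\<close> embeds at every stage after \<open>k\<close>; so the sections agree on
      the cover.\<close>
    have "locally x (\<lambda>h. rest B' h s = rest B' h t)"
    proof (rule locally_mono[OF L x])
      fix h assume h: "h \<in> Ar C" "Cod C h = x"
      have rs: "rest B' h s \<in> sect B' (Dom C h)" "rest B' h t \<in> sect B' (Dom C h)"
        using rest_sect[OF atom_Ob[OF aB'] h(1)] h(2) s t by auto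
      note D' = Dom_in_Ob[OF h(1)]
      assume "\<exists>l. (k, l) \<in> r \<and> act (amap D (k, l)) (Dom C h) (rest (omap D k) h (act m x s))
        = act (amap D (k, l)) (Dom C h) (rest (omap D k) h (act m x t))"
      then obtain l where l: "(k, l) \<in> r" and "act (amap D (k, l)) (Dom C h) (rest (omap D k) h (act m x s))
        = act (amap D (k, l)) (Dom C h) (rest (omap D k) h (act m x t))"
        by blast
      then have "act (amap D (k, l) \<cdot> m) (Dom C h) (rest B' h s) = act (amap D (k, l) \<cdot> m) (Dom C h) (rest B' h t)"
        using act_comp[OF m(1) diag(3)[OF l] D'] rs act_rest[OF m(1) h(1)] h(2) s t by simp
      then show "rest B' h s = rest B' h t"
        using injectiveD[OF inj[OF l] D' rs] by blast
    qed (use rest_comp[OF atom_Ob[OF aB']] s t in simp)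
    then show "s = t"
      using sect_separated[OF atom_Ob[OF aB'] _ x s t] by blast
  qed
  then show thesis
    using that k aB' q m(1) mq by blast
qed

text \<open>A section of \<open>A\<close> reaches \<open>X\<close> through a stage, and there
  through an atom \<open>B w\<close>. The arrow \<open>g\<close> itself need not factor through
  \<open>B w\<close>, only through its stable image, which embeds into \<open>X\<close>; hence the
  lift along \<open>c k \<cdot> m\<close>.\<close>

lemma directed_atom_factor:
  assumes wf: "wf E.proper_quotients"
    and A: "atom E A" and g: "g \<in> hom E A X"
  shows "\<exists>i\<in>I. \<exists>f\<in>hom E A (omap D i). c i \<cdot> f = g"
proof -
  note AO = atom_Ob[OF A]
  obtain x s where x: "x \<in> Ob C" "\<not> null x" and s: "s \<in> sect A x"
    using atom_section[OF A] .
  have "locally x (\<lambda>h. \<exists>i\<in>I. \<exists>p\<in>sect (omap D i) (Dom C h). rest X h (act g x s) = act (c i) (Dom C h) p)"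
    using sectionwise_colimit_cover[OF directed_colimit_sectionwise x(1) act_sect[OF g x(1) s]]
    by (simp add: poset_cat_def)
  from locally_witness[OF this x] obtain h i p where h: "h \<in> Ar C" "Cod C h = x" "\<not> null (Dom C h)" and i: "i \<in> I"
    and p: "p \<in> sect (omap D i) (Dom C h)" and eq: "rest X h (act g x s) = act (c i) (Dom C h) p"
    by blast
  note D' = Dom_in_Ob[OF h(1)]
  have s': "rest A h s \<in> sect A (Dom C h)" "act g (Dom C h) (rest A h s) = act (c i) (Dom C h) p"
    using rest_sect[OF AO h(1)] act_rest[OF g h(1)] h(2) s eq by auto
  obtain K :: "'u set" and B b where K: "small TYPE('u) K" and B: "\<forall>k\<in>K. atom E (B k)" and b: "coproduct K E B (omap D i) b"
    using atomic[OF diag(1)[OF i]] by blast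
  have BO: "\<forall>k\<in>K. B k \<in> Ob E"
    using B atom_Ob by blast
  \<comment> \<open>A second restriction: a section of the stage lies in a single summand only after
    passing to a piece of a cover.\<close>
  obtain h' w p' where h': "h' \<in> Ar C" "Cod C h' = Dom C h" "\<not> null (Dom C h')" and w: "w \<in> K"
    and p': "p' \<in> sect (B w) (Dom C h')" and eq': "rest (omap D i) h' p = act (b w) (Dom C h') p'"
    using coproduct_section[OF K BO b D' h(3) p] .
  note D'' = Dom_in_Ob[OF h'(1)] and bw = coprojection[OF K BO b w]
  let ?s = "rest A h' (rest A h s)"
  have s'': "?s \<in> sect A (Dom C h')"
    using rest_sect[OF AO h'(1)] s'(1) h'(2) by simp
  obtain k B' q m where k: "(i, k) \<in> r" and B': "atom E B'" and q: "q \<in> hom E (B w) B'" and m: "m \<in> hom E B' (omap D k)"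
    and mq: "m \<cdot> q = amap D (i, k) \<cdot> b w" and inj: "injective B' (c k \<cdot> m)"
    using directed_image_stabilizes[OF wf _ i bw] B w by blast
  have kI: "k \<in> I"
    using diag(2)[OF k] by blast
  note cm = E.Comp_in_hom[OF m leg[OF kI]]
  have "c k \<cdot> m \<cdot> q = c i \<cdot> b w"
    using E.Comp_assoc[OF q m leg[OF kI]] mq leg_push[OF k bw] by simp
  then have "act (c k \<cdot> m) (Dom C h') (act q (Dom C h') p') = act (c i) (Dom C h') (act (b w) (Dom C h') p')"
    using act_comp[OF q cm D'' p'] act_comp[OF bw leg[OF i] D'' p'] by simp
  also have "\<dots> = act g (Dom C h') ?s"
    using act_rest[OF g h'(1), of "rest A h s"] act_rest[OF leg[OF i] h'(1), of p] s' h'(2) p eq' by simp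
  finally obtain f where f: "f \<in> hom E A B'" "c k \<cdot> m \<cdot> f = g"
    using atom_lift[OF A g cm inj D'' h'(3) s'' act_sect[OF q D'' p']] by metis
  have "c k \<cdot> (m \<cdot> f) = g"
    using E.Comp_assoc[OF f(1) m leg[OF kI]] f(2) by simp
  then show ?thesis
    using kI E.Comp_in_hom[OF f(1) m] by blast
qed

text \<open>Arrows out of a finite coproduct are finite families of arrows out of atoms;
  directedness supplies one stage for all of them.\<close>

lemma hom_finite_preserves_directed:
  assumes wf: "wf E.proper_quotients"
    and L: "finite L" and A: "\<forall>l\<in>L. atom E (A l)" and K: "coproduct L E A K b"
  shows "hom_preserves_colimit E K (poset_cat I r) D X c"
proof (rule E.hom_preserves_colimitI[OF dir D colimit_cocone])
  have AO: "\<forall>l\<in>L. A l \<in> Ob E"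
    using A atom_Ob by blast
  have KO: "K \<in> Ob E"
    using E.coproduct_Ob[OF K AO] .
  have b: "b l \<in> hom E (A l) K" if "l \<in> L" for l
    using E.coprojection_hom[OF K AO that] .
  {
    fix g assume g: "g \<in> hom E K X"
    have "\<exists>i f. i \<in> I \<and> f \<in> hom E (A l) (omap D i) \<and> c i \<cdot> f = g \<cdot> b l" if l: "l \<in> L" for l
      using directed_atom_factor[OF wf bspec[OF A l] E.Comp_in_hom[OF b[OF l] g]] by blast
    then obtain i f where i: "\<And>l. l \<in> L \<Longrightarrow> i l \<in> I" and f: "\<And>l. l \<in> L \<Longrightarrow> f l \<in> hom E (A l) (omap D (i l))"
      and cf: "\<And>l. l \<in> L \<Longrightarrow> c (i l) \<cdot> f l = g \<cdot> b l"
      by metis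
    obtain k where k: "k \<in> I" "\<And>l. l \<in> L \<Longrightarrow> (i l, k) \<in> r"
      using directed_upper_bound[OF dir, of "i ` L"] L i by blast
    have df: "amap D (i l, k) \<cdot> f l \<in> hom E (A l) (omap D k)" if "l \<in> L" for l
      using E.Comp_in_hom[OF f[OF that] diag(3)[OF k(2)[OF that]]] .
    obtain h where h: "h \<in> hom E K (omap D k)" "\<And>l. l \<in> L \<Longrightarrow> h \<cdot> b l = amap D (i l, k) \<cdot> f l"
      using E.coproduct_universal[OF K AO diag(1)[OF k(1)], of "\<lambda>l. amap D (i l, k) \<cdot> f l"] df by blast
    have "c k \<cdot> h = g"
    proof (rule E.coproduct_arrow_eq[OF K AO E.Comp_in_hom[OF h(1) leg[OF k(1)]] g])
      fix l assume l: "l \<in> L"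
      have "c k \<cdot> h \<cdot> b l = c k \<cdot> (amap D (i l, k) \<cdot> f l)"
        using E.Comp_assoc[OF b[OF l] h(1) leg[OF k(1)]] h(2)[OF l] by simp
      then show "c k \<cdot> h \<cdot> b l = g \<cdot> b l"
        using leg_push[OF k(2)[OF l] f[OF l]] cf[OF l] by simp
    qed
    then show "\<exists>i\<in>I. \<exists>f\<in>hom E K (omap D i). c i \<cdot> f = g"
      using k(1) h(1) by blast
  }
  fix i f g assume i: "i \<in> I" and f: "f \<in> hom E K (omap D i)" and g: "g \<in> hom E K (omap D i)" and eq: "c i \<cdot> f = c i \<cdot> g"
  have "\<exists>k. (i, k) \<in> r \<and> amap D (i, k) \<cdot> (f \<cdot> b l) = amap D (i, k) \<cdot> (g \<cdot> b l)" if l: "l \<in> L" for l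
  proof (rule directed_atom_eq[OF bspec[OF A l] i E.Comp_in_hom[OF b[OF l] f] E.Comp_in_hom[OF b[OF l] g]])
    show "c i \<cdot> (f \<cdot> b l) = c i \<cdot> (g \<cdot> b l)"
      using E.Comp_assoc[OF b[OF l] f leg[OF i]] E.Comp_assoc[OF b[OF l] g leg[OF i]] eq by simp
  qed
  then obtain k where k: "\<And>l. l \<in> L \<Longrightarrow> (i, k l) \<in> r"
    and dk: "\<And>l. l \<in> L \<Longrightarrow> amap D (i, k l) \<cdot> (f \<cdot> b l) = amap D (i, k l) \<cdot> (g \<cdot> b l)"
    by metis
  have kI: "k l \<in> I" if "l \<in> L" for l
    using diag(2)[OF k[OF that]] by blast
  \<comment> \<open>The index \<open>i\<close> is included so that the bound lies above it also when
    \<open>L\<close> is empty.\<close>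
  obtain n where n: "n \<in> I" "(i, n) \<in> r" "\<And>l. l \<in> L \<Longrightarrow> (k l, n) \<in> r"
    using directed_upper_bound[OF dir, of "insert i (k ` L)"] L i kI by blast
  note Dn = diag(3)[OF n(2)]
  have "amap D (i, n) \<cdot> f = amap D (i, n) \<cdot> g"
  proof (rule E.coproduct_arrow_eq[OF K AO E.Comp_in_hom[OF f Dn] E.Comp_in_hom[OF g Dn]])
    fix l assume l: "l \<in> L"
    have *: "amap D (i, n) \<cdot> f \<cdot> b l = amap D (k l, n) \<cdot> (amap D (i, k l) \<cdot> (f \<cdot> b l))" if f: "f \<in> hom E K (omap D i)" for f
      using E.Comp_assoc[OF b[OF l] f Dn] diag(5)[OF k[OF l] n(3)[OF l]]
        E.Comp_assoc[OF E.Comp_in_hom[OF b[OF l] f] diag(3)[OF k[OF l]] diag(3)[OF n(3)[OF l]]] by simp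
    show "amap D (i, n) \<cdot> f \<cdot> b l = amap D (i, n) \<cdot> g \<cdot> b l"
      using *[OF f] *[OF g] dk[OF l] by simp
  qed
  then show "\<exists>k. (i, k) \<in> r \<and> amap D (i, k) \<cdot> f = amap D (i, k) \<cdot> g"
    using n(2) by blast
qed

end

lemma finite_coproduct_finitely_presentable:
  assumes "wf E.proper_quotients"
    and "finite L" and A: "\<forall>l\<in>L. atom E (A l)" and K: "coproduct L E A K b"
  shows "finitely_presentable TYPE('u) E K"
proof -
  have AO: "\<forall>l\<in>L. A l \<in> Ob E"
    using A atom_Ob by blast
  then show ?thesis
    unfolding finitely_presentable_def
    using E.coproduct_Ob[OF K] hom_finite_preserves_directed[OF _ _ _ _ assms] by blast
qed

end

section \<open>A small set of atoms\<close>

context presented_atomic_topos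
begin

text \<open>The section \<open>s\<close> amounts to a map from the representable at \<open>x\<close>
  to \<open>A\<close>, and this is its kernel pair. Whatever \<open>A\<close> is, it is a subset of
  \<open>Ar C \<times> Ar C\<close>.\<close>

definition kernel :: "'o \<Rightarrow> 'c \<Rightarrow> 'u \<Rightarrow> ('d \<times> 'd) set"
  where "kernel A x s = {(f, g). f \<in> Ar C \<and> g \<in> Ar C \<and> Cod C f = x \<and> Cod C g = x \<and> Dom C f = Dom C g \<and>
    rest A f s = rest A g s}"

text \<open>Sending the restriction of \<open>s\<close> along \<open>f\<close> to that of
  \<open>t\<close> is well defined by the inclusion of kernels, and the restrictions of
  \<open>s\<close> locally exhaust an atom.\<close>

lemma kernel_arrow:
  assumes A: "atom E A" and B: "B \<in> Ob E" and x: "x \<in> Ob C" "\<not> null x" and s: "s \<in> sect A x" and t: "t \<in> sect B x"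
    and le: "kernel A x s \<subseteq> kernel B x t"
  obtains h where "h \<in> hom E A B" and "act h x s = t"
proof -
  note AO = atom_Ob[OF A]
  define R where "R y a b \<longleftrightarrow> (\<exists>f\<in>Ar C. Cod C f = x \<and> Dom C f = y \<and> a = rest A f s \<and> b = rest B f t)" for y a b
  have R: "R (Dom C h) (rest A h a) (rest B h b)" if h: "h \<in> Ar C" and ab: "R (Cod C h) a b" for h a b
  proof -
    obtain f where f: "f \<in> Ar C" "Cod C f = x" "Dom C f = Cod C h" "a = rest A f s" "b = rest B f t"
      using ab by (auto simp: R_def)
    then show ?thesis
      unfolding R_def using rest_comp[OF AO h f(1)] rest_comp[OF B h f(1)] comp_in_Ar[of h f] h s t
      by (intro bexI[of _ "f \<cdot>\<^bsub>C\<^esub> h"]) auto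
  qed
  have Rst: "R x s t"
    unfolding R_def using Id_in_Ar[OF x(1)] rest_Id[OF AO x(1) s] rest_Id[OF B x(1) t]
    by (intro bexI[of _ "Id C x"]) auto
  have total: "locally y (\<lambda>h. \<exists>b. R (Dom C h) (rest A h a) b)" if "y \<in> Ob C" "a \<in> sect A y" for y a
    by (rule atom_locally[OF A _ x s _ that, of "\<lambda>y a. \<exists>b. R y a b"]) (use R Rst in blast)+
  obtain h where h: "h \<in> hom E A B" "\<And>y a b. y \<in> Ob C \<Longrightarrow> R y a b \<Longrightarrow> act h y a = b"
  proof (rule glue_arrow[OF AO B, of R])
    show "a \<in> sect A y \<and> b \<in> sect B y" if "R y a b" for y a b
      using that rest_sect[OF AO] rest_sect[OF B] s t by (auto simp: R_def)
    show "b = b'" if ab: "R y a b" "R y a b'" for y a b b'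
    proof -
      obtain f f' where f: "f \<in> Ar C" "Cod C f = x" "Dom C f = y" "a = rest A f s" "b = rest B f t"
        and f': "f' \<in> Ar C" "Cod C f' = x" "Dom C f' = y" "a = rest A f' s" "b' = rest B f' t"
        using ab unfolding R_def by blast
      then have "(f, f') \<in> kernel A x s"
        by (simp add: kernel_def)
      then show ?thesis
        using le f f' by (auto simp: kernel_def)
    qed
  qed (rule R total that; assumption)+
  then show thesis
    using that Rst x(1) by blast
qed

lemma atoms_iso_of_kernel:
  assumes A: "atom E A" and B: "atom E B" and x: "x \<in> Ob C" "\<not> null x" and s: "s \<in> sect A x" and t: "t \<in> sect B x"
    and eq: "kernel A x s = kernel B x t"
  shows "\<exists>f\<in>hom E A B. iso E f"
proof -
  note AO = atom_Ob[OF A] and BO = atom_Ob[OF B]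
  obtain h where h: "h \<in> hom E A B" "act h x s = t"
    using kernel_arrow[OF A BO x s t] eq by blast
  obtain k where k: "k \<in> hom E B A" "act k x t = s"
    using kernel_arrow[OF B AO x t s] eq by blast
  have "k \<cdot> h = Id E A"
    using act_comp[OF h(1) k(1) x(1) s] act_Id[OF AO x(1) s] h(2) k(2)
    by (intro atom_arrow_eq[OF A E.Comp_in_hom[OF h(1) k(1)] E.Id_in_hom[OF AO] x s]) simp
  moreover have "h \<cdot> k = Id E B"
    using act_comp[OF k(1) h(1) x(1) t] act_Id[OF BO x(1) t] h(2) k(2)
    by (intro atom_arrow_eq[OF B E.Comp_in_hom[OF k(1) h(1)] E.Id_in_hom[OF BO] x t]) simp
  ultimately show ?thesis
    using E.isoI[OF h(1) k(1)] h(1) by blast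
qed

lemma small_atom_representatives:
  obtains R where "small TYPE('u) R" and "\<forall>B\<in>R. atom E B" and "\<And>A. atom E A \<Longrightarrow> \<exists>B\<in>R. \<exists>f\<in>hom E A B. iso E f"
proof -
  have "\<exists>x s. x \<in> Ob C \<and> \<not> null x \<and> s \<in> sect A x" if "atom E A" for A
    using atom_section[OF that] by blast
  then obtain x s where xs: "\<And>A. atom E A \<Longrightarrow> x A \<in> Ob C \<and> \<not> null (x A) \<and> s A \<in> sect A (x A)"
    by metis
  \<comment> \<open>The invariant \<open>v A\<close> takes values in a small set, and
    \<open>\<rho>\<close> picks one atom for each attained value; the atoms themselves need not form
    a small set.\<close>
  define v where "v A = (x A, kernel A (x A) (s A))" for A
  define \<rho> where "\<rho> w = (SOME A. atom E A \<and> v A = w)" for w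
  have \<rho>: "atom E (\<rho> (v A)) \<and> v (\<rho> (v A)) = v A" if "atom E A" for A
    unfolding \<rho>_def by (rule someI[of "\<lambda>B. atom E B \<and> v B = v A" A]) (use that in simp)
  have "v ` {A. atom E A} \<subseteq> Ob C \<times> Pow (Ar C \<times> Ar C)"
    using xs by (auto simp: v_def kernel_def)
  moreover have "small TYPE('u) (Ob C \<times> Pow (Ar C \<times> Ar C))"
    using small_Ob small_Ar inaccessible by (intro small_Times small_Pow)
  ultimately have "small TYPE('u) (v ` {A. atom E A})"
    by (blast intro: small_subset)
  then have "small TYPE('u) (\<rho> ` v ` {A. atom E A})"
    by (rule small_image)
  moreover have "\<forall>B\<in>\<rho> ` v ` {A. atom E A}. atom E B"
    using \<rho> by blast
  moreover have "\<exists>B\<in>\<rho> ` v ` {A. atom E A}. \<exists>f\<in>hom E A B. iso E f" if A: "atom E A" for A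
  proof -
    define B where "B = \<rho> (v A)"
    have B: "atom E B" and eq: "v B = v A"
      unfolding B_def using \<rho>[OF A] by blast+
    have eq': "x B = x A \<and> kernel B (x B) (s B) = kernel A (x A) (s A)"
      using eq unfolding v_def prod.inject .
    then have x: "x B = x A" and ker: "kernel A (x A) (s A) = kernel B (x A) (s B)"
      by metis+
    have "x A \<in> Ob C" "\<not> null (x A)" "s A \<in> sect A (x A)" "s B \<in> sect B (x A)"
      using xs[OF A] xs[OF B] x by simp_all
    then have "\<exists>f\<in>hom E A (\<rho> (v A)). iso E f"
      using atoms_iso_of_kernel[OF A B _ _ _ _ ker] unfolding B_def by blast
    then show ?thesis
      using A by blast
  qed
  ultimately show thesis
    by (rule that)
qed

end

section \<open>Local finite presentability\<close>

context category
begin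

text \<open>Lets a coproduct of chosen representatives serve as a coproduct of the original
  summands, with the vertex \<open>K\<close> unchanged.\<close>

lemma coproduct_reindex:
  assumes K: "coproduct V C B K k" and B: "\<forall>v\<in>V. B v \<in> Ob C" and \<beta>: "bij_betw \<beta> J V"
    and \<phi>: "\<And>j. j \<in> J \<Longrightarrow> \<phi> j \<in> hom C (A j) (B (\<beta> j)) \<and> iso C (\<phi> j)"
  shows "coproduct J C A K (\<lambda>j. k (\<beta> j) \<cdot> \<phi> j)"
proof -
  have A: "\<forall>j\<in>J. A j \<in> Ob C"
    using \<phi> hom_Ob by blast
  have \<beta>V: "\<beta> j \<in> V" if "j \<in> J" for j
    using \<beta> that by (auto simp: bij_betw_def)
  have k: "k v \<in> hom C (B v) K" if "v \<in> V" for v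
    using coprojection_hom[OF K B that] .
  have k\<phi>: "k (\<beta> j) \<cdot> \<phi> j \<in> hom C (A j) K" if "j \<in> J" for j
    using Comp_in_hom k[OF \<beta>V[OF that]] \<phi>[OF that] by blast
  have "\<exists>!h. h \<in> hom C K Y \<and> (\<forall>j\<in>J. h \<cdot> (k (\<beta> j) \<cdot> \<phi> j) = d j)"
    if Y: "Y \<in> Ob C" and d: "\<forall>j\<in>J. d j \<in> hom C (A j) Y" for Y d
  proof -
    have "\<exists>p. p \<in> hom C (B (\<beta> j)) (A j) \<and> p \<cdot> \<phi> j = Id C (A j) \<and> \<phi> j \<cdot> p = Id C (B (\<beta> j))" if "j \<in> J" for j
      using iso_inverse \<phi>[OF that] by metis
    then obtain p where p: "\<And>j. j \<in> J \<Longrightarrow> p j \<in> hom C (B (\<beta> j)) (A j)"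
      and p\<phi>: "\<And>j. j \<in> J \<Longrightarrow> p j \<cdot> \<phi> j = Id C (A j)" and \<phi>p: "\<And>j. j \<in> J \<Longrightarrow> \<phi> j \<cdot> p j = Id C (B (\<beta> j))"
      by metis
    \<comment> \<open>A family on the new summands is carried back along the inverses
      \<open>p\<close>; \<open>inv_into\<close> recovers the index.\<close>
    define e where "e v = d (inv_into J \<beta> v) \<cdot> p (inv_into J \<beta> v)" for v
    have e\<beta>: "e (\<beta> j) = d j \<cdot> p j" if "j \<in> J" for j
      using \<beta> that by (simp add: e_def bij_betw_inv_into_left)
    have "e v \<in> hom C (B v) Y" if v: "v \<in> V" for v
    proof -
      obtain j where j: "j \<in> J" "v = \<beta> j"
        using \<beta> v by (auto simp: bij_betw_def)
      then show ?thesis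
        using e\<beta> Comp_in_hom[OF p[OF j(1)] bspec[OF d j(1)]] by simp
    qed
    then have ex: "\<exists>!h. h \<in> hom C K Y \<and> (\<forall>v\<in>V. h \<cdot> k v = e v)"
      using coproduct_universal[OF K B Y] by blast
    have "(\<forall>v\<in>V. h \<cdot> k v = e v) \<longleftrightarrow> (\<forall>j\<in>J. h \<cdot> (k (\<beta> j) \<cdot> \<phi> j) = d j)" if h: "h \<in> hom C K Y" for h
    proof -
      have "h \<cdot> k (\<beta> j) = e (\<beta> j) \<longleftrightarrow> h \<cdot> (k (\<beta> j) \<cdot> \<phi> j) = d j" if j: "j \<in> J" for j
      proof
        note kj = k[OF \<beta>V[OF j]] and dj = bspec[OF d j] and \<phi>j = conjunct1[OF \<phi>[OF j]]
        note hk = Comp_in_hom[OF kj h]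
        {
          assume "h \<cdot> k (\<beta> j) = e (\<beta> j)"
          then have "h \<cdot> k (\<beta> j) \<cdot> \<phi> j = d j \<cdot> (p j \<cdot> \<phi> j)"
            using e\<beta>[OF j] Comp_assoc[OF \<phi>j p[OF j] dj] by simp
          then show "h \<cdot> (k (\<beta> j) \<cdot> \<phi> j) = d j"
            using Comp_assoc[OF \<phi>j kj h] p\<phi>[OF j] Comp_Id[OF dj] by simp
        }
        assume "h \<cdot> (k (\<beta> j) \<cdot> \<phi> j) = d j"
        then have "h \<cdot> k (\<beta> j) \<cdot> \<phi> j \<cdot> p j = d j \<cdot> p j"
          using Comp_assoc[OF \<phi>j kj h] by simp
        then show "h \<cdot> k (\<beta> j) = e (\<beta> j)"
          using Comp_assoc[OF p[OF j] \<phi>j hk] \<phi>p[OF j] Comp_Id[OF hk] e\<beta>[OF j] by simp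
      qed
      moreover have "V = \<beta> ` J"
        using \<beta> by (simp add: bij_betw_def)
      ultimately show ?thesis
        by simp
    qed
    then show ?thesis
      using ex by (metis (no_types, lifting))
  qed
  then show ?thesis
    unfolding coproduct_iff[OF A] using coproduct_Ob[OF K B] k\<phi> by blast
qed

text \<open>
  The index set \<open>P\<close> replaces the set of finite subsets of \<open>I\<close> because directed diagrams are indexed
  by subsets of the universe.
\<close>

lemma coproduct_directed_colimit:
  assumes X: "coproduct I C A X c" and A: "\<forall>i\<in>I. A i \<in> Ob C"
    and F: "bij_betw F P {L. finite L \<and> L \<subseteq> I}"
    and K: "\<And>L. finite L \<Longrightarrow> L \<subseteq> I \<Longrightarrow> coproduct L C A (K L) (k L)"
  defines "r \<equiv> {(u, v) \<in> P \<times> P. F u \<subseteq> F v}"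
  obtains D c' where "directed_poset P r" and "functor (poset_cat P r) C D" and "\<And>u. u \<in> P \<Longrightarrow> omap D u = K (F u)"
    and "colimit (poset_cat P r) C D X c'" and "\<And>u. u \<in> P \<Longrightarrow> c' u \<in> hom C (K (F u)) X"
    and "\<And>u i. u \<in> P \<Longrightarrow> i \<in> F u \<Longrightarrow> c' u \<cdot> k (F u) i = c i"
proof -
  have Fu: "finite (F u)" "F u \<subseteq> I" if "u \<in> P" for u
    using F that unfolding bij_betw_def by blast+
  have Fex: "\<exists>u\<in>P. F u = L" if "finite L" "L \<subseteq> I" for L
    using F that unfolding bij_betw_def by (metis (mono_tags, lifting) imageE mem_Collect_eq)
  have AF: "\<forall>i\<in>F u. A i \<in> Ob C" if "u \<in> P" for u
    using A Fu[OF that] by blast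
  have KF: "coproduct (F u) C A (K (F u)) (k (F u))" if "u \<in> P" for u
    using K[OF Fu[OF that]] .
  have KO: "K (F u) \<in> Ob C" if "u \<in> P" for u
    using coproduct_Ob[OF KF[OF that] AF[OF that]] .
  have k: "k (F u) i \<in> hom C (A i) (K (F u))" if "u \<in> P" "i \<in> F u" for u i
    using coprojection_hom[OF KF[OF that(1)] AF[OF that(1)] that(2)] .
  have XO: "X \<in> Ob C"
    using coproduct_Ob[OF X A] .
  have c: "c i \<in> hom C (A i) X" if "i \<in> I" for i
    using coprojection_hom[OF X A that] .
  have r: "u \<in> P" "v \<in> P" "F u \<subseteq> F v" if "(u, v) \<in> r" for u v
    using that by (auto simp: r_def)
  have "\<exists>h. h \<in> hom C (K (F u)) (K (F v)) \<and> (\<forall>i\<in>F u. h \<cdot> k (F u) i = k (F v) i)" if "(u, v) \<in> r" for u v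
    using coproduct_universal[OF KF[OF r(1)[OF that]] AF[OF r(1)[OF that]] KO[OF r(2)[OF that]], of "k (F v)"]
      k[OF r(2)[OF that]] r(3)[OF that] by blast
  then obtain t' where t': "\<And>u v. (u, v) \<in> r \<Longrightarrow>
      t' u v \<in> hom C (K (F u)) (K (F v)) \<and> (\<forall>i\<in>F u. t' u v \<cdot> k (F u) i = k (F v) i)"
    by metis
  define t where "t = (\<lambda>(u, v). t' u v)"
  have t: "\<And>u v. (u, v) \<in> r \<Longrightarrow> t (u, v) \<in> hom C (K (F u)) (K (F v))"
    and tk: "\<And>u v i. (u, v) \<in> r \<Longrightarrow> i \<in> F u \<Longrightarrow> t (u, v) \<cdot> k (F u) i = k (F v) i"
    using t' by (simp_all add: t_def)
  have "\<exists>h. h \<in> hom C (K (F u)) X \<and> (\<forall>i\<in>F u. h \<cdot> k (F u) i = c i)" if "u \<in> P" for u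
    using coproduct_universal[OF KF[OF that] AF[OF that] XO, of c] c Fu(2)[OF that] by blast
  then obtain c' where c': "\<And>u. u \<in> P \<Longrightarrow> c' u \<in> hom C (K (F u)) X"
    and c'k: "\<And>u i. u \<in> P \<Longrightarrow> i \<in> F u \<Longrightarrow> c' u \<cdot> k (F u) i = c i"
    by metis
  define D where "D = \<lparr>omap = \<lambda>u. K (F u), amap = t\<rparr>"
  have inj: "u = v" if "u \<in> P" "v \<in> P" "F u = F v" for u v
    using F that by (auto simp: bij_betw_def dest: inj_onD)
  have po: "partial_order_on P r"
    using inj by (auto simp: r_def order_on_defs refl_on_def trans_def antisym_def)
  have dir: "directed_poset P r"
    unfolding directed_poset_def
  proof (intro conjI ballI)
    show "P \<noteq> {}"
      using Fex[of "{}"] by auto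
    fix u v assume uv: "u \<in> P" "v \<in> P"
    then obtain w where "w \<in> P" "F w = F u \<union> F v"
      using Fex[of "F u \<union> F v"] Fu by auto
    then show "\<exists>w\<in>P. (u, w) \<in> r \<and> (v, w) \<in> r"
      using uv by (auto simp: r_def)
  qed (rule po)
  have KF_eq: "f = g" if u: "u \<in> P" and f: "f \<in> hom C (K (F u)) Y" and g: "g \<in> hom C (K (F u)) Y"
    and eq: "\<And>i. i \<in> F u \<Longrightarrow> f \<cdot> k (F u) i = g \<cdot> k (F u) i" for u f g Y
    using coproduct_arrow_eq[OF KF[OF u] AF[OF u] f g eq] .
  have D: "functor (poset_cat P r) C D"
    unfolding functor_def
  proof (intro conjI ballI impI)
    fix u assume "u \<in> Ob (poset_cat P r)"
    then have u: "u \<in> P" and uu: "(u, u) \<in> r"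
      by (auto simp: poset_cat_def r_def)
    have "t (u, u) = Id C (K (F u))"
      using tk[OF uu] Id_Comp[OF k[OF u]] by (intro KF_eq[OF u t[OF uu] Id_in_hom[OF KO[OF u]]]) simp
    then show "amap D (Id (poset_cat P r) u) = Id C (omap D u)"
      by (simp add: D_def poset_cat_def)
  next
    fix p q assume "p \<in> Ar (poset_cat P r)" "q \<in> Ar (poset_cat P r)" "Cod (poset_cat P r) p = Dom (poset_cat P r) q"
    then obtain u v w where pq: "p = (u, v)" "q = (v, w)" and uv: "(u, v) \<in> r" and vw: "(v, w) \<in> r"
      by (cases p; cases q) (auto simp: poset_cat_def)
    have uw: "(u, w) \<in> r"
      using uv vw by (auto simp: r_def)
    note u = r(1)[OF uv]
    have "t (u, w) = t (v, w) \<cdot> t (u, v)"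
    proof (rule KF_eq[OF u t[OF uw] Comp_in_hom[OF t[OF uv] t[OF vw]]])
      fix i assume i: "i \<in> F u"
      then have iv: "i \<in> F v"
        using r(3)[OF uv] by blast
      show "t (u, w) \<cdot> k (F u) i = t (v, w) \<cdot> t (u, v) \<cdot> k (F u) i"
        using Comp_assoc[OF k[OF u i] t[OF uv] t[OF vw]] tk[OF uv i] tk[OF vw iv] tk[OF uw i] by simp
    qed
    then show "amap D (q \<cdot>\<^bsub>poset_cat P r\<^esub> p) = amap D q \<cdot> amap D p"
      by (simp add: D_def poset_cat_def pq)
  qed (use KO t in \<open>auto simp: D_def poset_cat_def\<close>)
  have "colimit (poset_cat P r) C D X c'"
    unfolding colimit_def
  proof (intro conjI allI impI)
    show "cocone (poset_cat P r) C D X c'"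
      unfolding cocone_def
    proof (intro conjI ballI)
      fix p assume "p \<in> Ar (poset_cat P r)"
      then obtain u v where p: "p = (u, v)" and uv: "(u, v) \<in> r"
        by (cases p) (auto simp: poset_cat_def)
      note u = r(1)[OF uv] and v = r(2)[OF uv]
      have "c' v \<cdot> t (u, v) = c' u"
      proof (rule KF_eq[OF u Comp_in_hom[OF t[OF uv] c'[OF v]] c'[OF u]])
        fix i assume i: "i \<in> F u"
        then have iv: "i \<in> F v"
          using r(3)[OF uv] by blast
        show "c' v \<cdot> t (u, v) \<cdot> k (F u) i = c' u \<cdot> k (F u) i"
          using Comp_assoc[OF k[OF u i] t[OF uv] c'[OF v]] tk[OF uv i] c'k[OF u i] c'k[OF v iv] by simp
      qed
      then show "c' (Cod (poset_cat P r) p) \<cdot> amap D p = c' (Dom (poset_cat P r) p)"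
        by (simp add: D_def poset_cat_def p)
    qed (use XO c' in \<open>auto simp: D_def poset_cat_def\<close>)
    fix Y y assume "cocone (poset_cat P r) C D Y y"
    then have YO: "Y \<in> Ob C" and y: "\<And>u. u \<in> P \<Longrightarrow> y u \<in> hom C (K (F u)) Y"
      and yt: "\<And>u v. (u, v) \<in> r \<Longrightarrow> y v \<cdot> t (u, v) = y u"
      by (auto simp: cocone_def poset_cat_def D_def)
    have "\<exists>u. u \<in> P \<and> F u = {i}" if "i \<in> I" for i
      using Fex[of "{i}"] that by auto
    then obtain o' where o': "\<And>i. i \<in> I \<Longrightarrow> o' i \<in> P" "\<And>i. i \<in> I \<Longrightarrow> F (o' i) = {i}"
      by metis
    \<comment> \<open>Here \<open>o' i\<close> indexes the singleton \<open>{i}\<close>. A cocone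
      over the finite sub-coproducts is determined by its legs at singletons, and these give the
      family on the summands.\<close>
    define z where "z i = y (o' i) \<cdot> k {i} i" for i
    have ki: "k {i} i \<in> hom C (A i) (K {i})" if "i \<in> I" for i
      using k[OF o'(1)[OF that], of i] o'(2)[OF that] by simp
    have yi: "y (o' i) \<in> hom C (K {i}) Y" if "i \<in> I" for i
      using y[OF o'(1)[OF that]] o'(2)[OF that] by simp
    have z: "z i \<in> hom C (A i) Y" if "i \<in> I" for i
      unfolding z_def using Comp_in_hom[OF ki[OF that] yi[OF that]] .
    have yk: "y u \<cdot> k (F u) i = z i" if u: "u \<in> P" and i: "i \<in> F u" for u i
    proof -
      have iI: "i \<in> I"
        using Fu(2)[OF u] i by blast
      have iu: "(o' i, u) \<in> r"
        using u i o'[OF iI] by (simp add: r_def)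
      have T: "t (o' i, u) \<in> hom C (K {i}) (K (F u))" "t (o' i, u) \<cdot> k {i} i = k (F u) i"
        using t[OF iu] tk[OF iu, of i] o'(2)[OF iI] by auto
      show ?thesis
        using Comp_assoc[OF ki[OF iI] T(1) y[OF u]] T(2) yt[OF iu] by (simp add: z_def)
    qed
    have ex: "\<exists>!h. h \<in> hom C X Y \<and> (\<forall>i\<in>I. h \<cdot> c i = z i)"
      using coproduct_universal[OF X A YO z] .
    have "(\<forall>i\<in>I. h \<cdot> c i = z i) \<longleftrightarrow> (\<forall>u\<in>P. h \<cdot> c' u = y u)" if h: "h \<in> hom C X Y" for h
    proof (intro iffI ballI)
      fix u assume hc: "\<forall>i\<in>I. h \<cdot> c i = z i" and u: "u \<in> P"
      show "h \<cdot> c' u = y u"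
      proof (rule KF_eq[OF u Comp_in_hom[OF c'[OF u] h] y[OF u]])
        fix i assume i: "i \<in> F u"
        then have "h \<cdot> c i = z i"
          using hc Fu(2)[OF u] by blast
        then show "h \<cdot> c' u \<cdot> k (F u) i = y u \<cdot> k (F u) i"
          using Comp_assoc[OF k[OF u i] c'[OF u] h] c'k[OF u i] yk[OF u i] by simp
      qed
    next
      fix i assume hc: "\<forall>u\<in>P. h \<cdot> c' u = y u" and i: "i \<in> I"
      note oi = o'(1)[OF i]
      have "k (F (o' i)) i \<in> hom C (A i) (K (F (o' i)))" "c' (o' i) \<cdot> k (F (o' i)) i = c i" "y (o' i) \<cdot> k (F (o' i)) i = z i"
        using k[OF oi] c'k[OF oi] yk[OF oi] o'(2)[OF i] by auto
      then show "h \<cdot> c i = z i"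
        using Comp_assoc[OF _ c'[OF oi] h] hc oi by metis
    qed
    then show "\<exists>!h. h \<in> hom C X Y \<and> (\<forall>u\<in>Ob (poset_cat P r). h \<cdot> c' u = y u)"
      using ex by (simp add: poset_cat_def) (metis (no_types, lifting))
  qed
  then show thesis
    using that[OF dir D] c' c'k by (simp add: D_def)
qed

end

section \<open>Finite presentability against finiteness\<close>

context presented_atomic_topos
begin

lemma locally_small: "locally_small TYPE('u) E"
  unfolding locally_small_def
proof (intro ballI)
  fix X Y assume X: "X \<in> Ob E" and Y: "Y \<in> Ob E"
  let ?V = "SIGMA x:Ob C. sect X x \<times> sect Y x"
  \<comment> \<open>By faithfulness an arrow is determined by the graph of its action, and all
    graphs are subsets of the small set \<open>?V\<close>.\<close>
  define G where "G f = {(x, s, act f x s) |x s. x \<in> Ob C \<and> s \<in> sect X x}" for f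
  have "small TYPE('u) (Pow ?V)"
    using X Y Sec_sheaf by (intro small_Pow small_Sigma small_Times inaccessible small_Ob) (auto simp: sheaf_def presheaf_def)
  moreover have "G ` hom E X Y \<subseteq> Pow ?V"
    using act_sect by (auto simp: G_def)
  moreover have "inj_on G (hom E X Y)"
  proof (rule inj_onI)
    fix f g assume f: "f \<in> hom E X Y" and g: "g \<in> hom E X Y" and eq: "G f = G g"
    show "f = g"
    proof (rule faithful[OF f g])
      fix x s assume "x \<in> Ob C" "s \<in> sect X x"
      then have "(x, s, act f x s) \<in> G f"
        by (auto simp: G_def)
      then have "(x, s, act f x s) \<in> G g"
        using eq by simp
      then show "act f x s = act g x s"
        by (auto simp: G_def)
    qed
  qed
  ultimately show "small TYPE('u) (hom E X Y)"
    by (meson small_inj_on small_subset)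
qed

lemma cocomplete: "cocomplete TYPE('u) E"
  unfolding cocomplete_def small_category_def
  using sectionwise_colimit_exists sectionwise_colimit_imp_colimit by metis

lemma finite_sets_index:
  fixes I :: "'i set"
  assumes "small TYPE('u) I"
  obtains P :: "'u set" and F where "small TYPE('u) P" and "bij_betw F P {L. finite L \<and> L \<subseteq> I}"
proof -
  have "small TYPE('u) (Pow I)"
    using inaccessible assms by (rule small_Pow)
  moreover have "{L. finite L \<and> L \<subseteq> I} \<subseteq> Pow I"
    by blast
  ultimately have s: "small TYPE('u) {L. finite L \<and> L \<subseteq> I}"
    by (rule small_subset)
  then obtain e :: "'i set \<Rightarrow> 'u" where e: "inj_on e {L. finite L \<and> L \<subseteq> I}"
    by (rule small_obtains_inj)
  show thesis
    using that[OF small_image[OF s]] bij_betw_inv_into[OF inj_on_imp_bij_betw[OF e]] by blast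
qed

lemma finitely_presentable_imp_finite:
  assumes fp: "finitely_presentable TYPE('u) E X"
  shows "finite_object E X"
proof -
  have XO: "X \<in> Ob E"
    using fp by (simp add: finitely_presentable_def)
  then obtain I :: "'u set" and A c where I: "small TYPE('u) I" and A: "\<forall>i\<in>I. atom E (A i)" and X: "coproduct I E A X c"
    using atomic by blast
  have AO: "\<forall>i\<in>I. A i \<in> Ob E"
    using A atom_Ob by blast
  have "\<exists>K k. coproduct L E A K k" if L: "L \<subseteq> I" for L
  proof -
    have "\<forall>i\<in>L. A i \<in> Ob E"
      using AO L by blast
    then obtain K k where "coproduct L E A K k"
      using coproduct_exists[OF small_subset[OF I L]] by blast
    then show ?thesis
      by blast
  qed
  then obtain K k where K: "\<And>L. L \<subseteq> I \<Longrightarrow> coproduct L E A (K L) (k L)"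
    by metis
  obtain P :: "'u set" and F where P: "small TYPE('u) P" and F: "bij_betw F P {L. finite L \<and> L \<subseteq> I}"
    using finite_sets_index[OF I] .
  let ?r = "{(u, v) \<in> P \<times> P. F u \<subseteq> F v}"
  obtain D c' where dir: "directed_poset P ?r" and D: "functor (poset_cat P ?r) E D"
    and omap: "\<And>u. u \<in> P \<Longrightarrow> omap D u = K (F u)"
    and colim: "colimit (poset_cat P ?r) E D X c'" and c': "\<And>u. u \<in> P \<Longrightarrow> c' u \<in> hom E (K (F u)) X"
    and c'k: "\<And>u i. u \<in> P \<Longrightarrow> i \<in> F u \<Longrightarrow> c' u \<cdot> k (F u) i = c i"
    by (rule E.coproduct_directed_colimit[OF X AO F]) (rule K, assumption, rule that)
  have "hom_preserves_colimit E X (poset_cat P ?r) D X c'"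
    using fp P dir D colim unfolding finitely_presentable_def by blast
  then obtain u f where u: "u \<in> P" and f: "f \<in> hom E X (omap D u)" and cf: "c' u \<cdot> f = Id E X"
    using E.hom_preserves_colimit_factor[OF dir D _ _ E.Id_in_hom[OF XO]] colim unfolding colimit_def by blast
  have f: "f \<in> hom E X (K (F u))"
    using f omap[OF u] by simp
  have Fu: "finite (F u)" "F u \<subseteq> I"
    using F u unfolding bij_betw_def by blast+
  have AF: "\<forall>i\<in>F u. A i \<in> Ob E"
    using AO Fu by blast
  note sF = small_subset[OF I Fu(2)]
  \<comment> \<open>The summand \<open>A i\<close>, pushed into the finite sub-coproduct, lands in
    one summand \<open>A j\<close> with \<open>j \<in> F u\<close>. Mapped back to \<open>X\<close>
    it is still \<open>c i\<close>, and disjointness forces \<open>j = i\<close>.\<close>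
  have "i \<in> F u" if i: "i \<in> I" for i
  proof -
    note ci = coprojection[OF I AO X i]
    obtain j h where j: "j \<in> F u" and h: "h \<in> hom E (A i) (A j)" and kh: "k (F u) j \<cdot> h = f \<cdot> c i"
      using coproduct_factor[OF sF AF K[OF Fu(2)] bspec[OF A i] E.Comp_in_hom[OF ci f]] .
    note kj = coprojection[OF sF AF K[OF Fu(2)] j]
    have "c j \<cdot> h = c' u \<cdot> (f \<cdot> c i)"
      using E.Comp_assoc[OF h kj c'[OF u]] c'k[OF u j] kh by simp
    also have "\<dots> = c i \<cdot> Id E (A i)"
      using E.Comp_assoc[OF ci f c'[OF u]] cf E.Id_Comp[OF ci] E.Comp_Id[OF ci] by simp
    finally have "j = i"
      using coproduct_disjoint[OF I AO X bspec[OF A i] _ h i E.Id_in_hom[OF bspec[OF AO i]]] j Fu(2) by blast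
    then show ?thesis
      using j by simp
  qed
  then have "I \<subseteq> F u"
    by blast
  then have "finite I"
    using Fu(1) by (rule finite_subset)
  then show ?thesis
    using finite_object_iff[OF I _ X] A by blast
qed

lemma finite_imp_finitely_presentable:
  assumes wf: "wf E.proper_quotients"
    and fin: "finite_object E X"
  shows "finitely_presentable TYPE('u) E X"
proof -
  have "X \<in> Ob E"
    using fin by (simp add: finite_object_def)
  then obtain I :: "'u set" and A c where I: "small TYPE('u) I" and A: "\<forall>i\<in>I. atom E (A i)" and X: "coproduct I E A X c"
    using atomic by blast
  have "finite I"
    using finite_object_iff[OF I _ X] A fin by blast
  then show ?thesis
    using finite_coproduct_finitely_presentable[OF wf _ A X] by blast
qed

lemma locally_finitely_presentable:
  assumes wf: "wf E.proper_quotients"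
  shows "locally_finitely_presentable TYPE('u) E"
proof -
  obtain R where R: "small TYPE('u) R" "\<forall>B\<in>R. atom E B"
    and rep: "\<And>A. atom E A \<Longrightarrow> \<exists>B\<in>R. \<exists>f\<in>hom E A B. iso E f"
    by (rule small_atom_representatives) (rule that)
  \<comment> \<open>Natural number tags allow the same representative to occur several times in a
    finite coproduct.\<close>
  let ?N = "(UNIV :: nat set) \<times> R"
  have N: "small TYPE('u) ?N"
    using inaccessible small_nat[OF inaccessible] R(1) by (rule small_Times)
  have NO: "\<forall>v\<in>V. snd v \<in> Ob E" if "V \<subseteq> ?N" for V
    using that R(2) atom_Ob by auto
  have "\<exists>K k. coproduct V E snd K k" if "V \<subseteq> ?N" for V
    using coproduct_exists[OF small_subset[OF N that] NO[OF that]] by blast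
  then obtain K k where K: "\<And>V. V \<subseteq> ?N \<Longrightarrow> coproduct V E snd (K V) (k V)"
    by metis
  \<comment> \<open>The stages of the diagrams must come from one small set of objects. So a vertex
    is fixed once for each finite set of tagged representatives, and
    \<open>coproduct_reindex\<close> lets it serve every family isomorphic to that one.\<close>
  define G where "G = K ` {V. finite V \<and> V \<subseteq> ?N}"
  have "{V. finite V \<and> V \<subseteq> ?N} \<subseteq> Pow ?N"
    by blast
  then have "small TYPE('u) G"
    unfolding G_def using small_Pow[OF inaccessible N] by (intro small_image) (rule small_subset)
  moreover have "finitely_presentable TYPE('u) E B" if B: "B \<in> G" for B
  proof -
    obtain V where V: "finite V" "V \<subseteq> ?N" "B = K V"
      using B by (auto simp: G_def)
    then have "\<forall>l\<in>V. atom E (snd l)"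
      using R(2) by fastforce
    then show ?thesis
      using finite_coproduct_finitely_presentable[OF wf V(1) _ K[OF V(2)]] V(3) by blast
  qed
  moreover have "\<exists>(P :: 'u set) r D c. small TYPE('u) P \<and> directed_poset P r \<and> functor (poset_cat P r) E D \<and>
      (\<forall>u\<in>P. omap D u \<in> G) \<and> colimit (poset_cat P r) E D X c" if XO: "X \<in> Ob E" for X
  proof -
    obtain I :: "'u set" and A c where I: "small TYPE('u) I" and A: "\<forall>i\<in>I. atom E (A i)" and X: "coproduct I E A X c"
      using atomic[OF XO] by blast
    have AO: "\<forall>i\<in>I. A i \<in> Ob E"
      using A atom_Ob by blast
    have "\<exists>B \<phi>. B \<in> R \<and> \<phi> \<in> hom E (A i) B \<and> iso E \<phi>" if i: "i \<in> I" for i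
      using rep[OF bspec[OF A i]] by blast
    then obtain B \<phi> where B: "\<And>i. i \<in> I \<Longrightarrow> B i \<in> R" and \<phi>: "\<And>i. i \<in> I \<Longrightarrow> \<phi> i \<in> hom E (A i) (B i) \<and> iso E (\<phi> i)"
      by metis
    have "\<exists>M m. M \<in> G \<and> coproduct L E A M m" if L: "finite L" "L \<subseteq> I" for L
    proof -
      \<comment> \<open>The tags separate indices whose atoms have the same representative, which
        makes \<open>\<beta>\<close> injective on \<open>L\<close>.\<close>
      obtain n :: "'u \<Rightarrow> nat" where n: "inj_on n L"
        using finite_imp_inj_to_nat_seg[OF L(1)] by blast
      define \<beta> where "\<beta> i = (n i, B i)" for i
      have \<beta>: "bij_betw \<beta> L (\<beta> ` L)"
        by (rule inj_on_imp_bij_betw) (use n in \<open>auto simp: \<beta>_def inj_on_def\<close>)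
      have V: "\<beta> ` L \<subseteq> ?N"
        using B L(2) by (auto simp: \<beta>_def)
      have "coproduct L E A (K (\<beta> ` L)) (\<lambda>i. k (\<beta> ` L) (\<beta> i) \<cdot> \<phi> i)"
        using \<phi> L(2) by (intro E.coproduct_reindex[OF K[OF V] NO[OF V] \<beta>]) (auto simp: \<beta>_def)
      moreover have "K (\<beta> ` L) \<in> G"
        using V L(1) by (simp add: G_def)
      ultimately show ?thesis
        by blast
    qed
    then obtain M m where MG: "\<And>L. finite L \<Longrightarrow> L \<subseteq> I \<Longrightarrow> M L \<in> G"
      and M: "\<And>L. finite L \<Longrightarrow> L \<subseteq> I \<Longrightarrow> coproduct L E A (M L) (m L)"
      by metis
    obtain P :: "'u set" and F where P: "small TYPE('u) P" and F: "bij_betw F P {L. finite L \<and> L \<subseteq> I}"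
      using finite_sets_index[OF I] .
    let ?r = "{(u, v) \<in> P \<times> P. F u \<subseteq> F v}"
    obtain D c' where "directed_poset P ?r" "functor (poset_cat P ?r) E D" and omap: "\<And>u. u \<in> P \<Longrightarrow> omap D u = M (F u)"
      and "colimit (poset_cat P ?r) E D X c'"
      by (rule E.coproduct_directed_colimit[OF X AO F]) (rule M, assumption, assumption, rule that)
    moreover have "omap D u \<in> G" if u: "u \<in> P" for u
      using F u MG omap[OF u] unfolding bij_betw_def by auto
    ultimately show ?thesis
      using P by blast
  qed
  ultimately show ?thesis
    unfolding locally_finitely_presentable_def
    using E.category_axioms locally_small cocomplete by blast
qed

end

theorem proposition1p2:
  fixes E :: "('o, 'a) cat"
  assumes "strongly_inaccessible TYPE('u)"
    and "atomic_topos TYPE('u) E"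
    and "co_well_founded TYPE('u) (category_of_atoms E)"
  shows "locally_finitely_presentable TYPE('u) E \<and>
    (\<forall>X\<in>Ob E. finitely_presentable TYPE('u) E X \<longleftrightarrow> finite_object E X)"
proof -
  have topos: "grothendieck_topos TYPE('u) E"
    using assms(2) by (simp add: atomic_topos_def)
  then obtain C :: "('u, 'u) cat" and J and Sec :: "'o \<Rightarrow> ('u, 'u, 'u) psh" and act
    where T: "presented_topos C J E Sec act"
    using grothendieck_topos_presented[OF assms(1)] by blast
  interpret presented_atomic_topos C J E Sec act
    using T assms(2) by (intro presented_atomic_topos.intro presented_atomic_topos_axioms.intro)
      (auto simp: atomic_topos_def)
  note wf = E.wf_atoms[OF assms(1,3)]
  show ?thesis
    using locally_finitely_presentable[OF wf] finitely_presentable_imp_finite finite_imp_finitely_presentable[OF wf]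
    by blast
qed

end
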